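(* Consider the discretized problem $\dot U=DU+g(t)$, $t\in[0,t^*]$, in the setting described in the context. Assume that there is a constant $C$ (independent of the spatial grid) such that $$\|U^{(j)}(t)\|_\infty\le C,\quad \|g^{(i)}(t)\|_\infty\le C,\qquad i=0,\ldots,3,\ j=0,\ldots,4,\ t\in[0,t^*],$$ that $\dot g_j(t)=0$ for $j=2,\ldots,m$, and that, with $\varphi_j(t):=D_jU(t)+g_j(t)$, for all indices $i_1<i_2<\cdots<i_r<j$ (with $r\ge 1$) one has $$D_{i_1}D_{i_2}\cdots D_{i_r}\dot\varphi_j(t)=\beta_{i_1}\cdots\beta_{i_r}\beta_j\,\frac{\partial^{2r+2}\,\dot u(t,\vec{x}_G)}{\partial x_{i_1}^2\cdots\partial x_{i_r}^2\,\partial x_j^2}+\mathcal{O}\big((\Delta x_{i_1})^2+\cdots+(\Delta x_{i_r})^2+(\Delta x_j)^2\big),$$ $$D_{i_1}D_{i_2}\cdots D_{i_r}\ddot\varphi_j(t)=\beta_{i_1}\cdots\beta_{i_r}\beta_j\,\frac{\partial^{2r+2}\,\ddot u(t,\vec{x}_G)}{\partial x_{i_1}^2\cdots\partial x_{i_r}^2\,\partial x_j^2}+\mathcal{O}\big((\Delta x_{i_1})^2+\cdots+(\Delta x_{i_r})^2+(\Delta x_j)^2\big).$$ Let $U_n$ be the numerical solution at $t_n=n\tau$ given by the modified one-stage AMF-W-method with $\theta=1/2$: $$K_1^{(0)}=\tau D U_n+\tau g(t_n),\qquad (I-\theta\tau D_j)K_1^{(j)}=K_1^{(j-1)}+\theta\tau^2\dot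 g_j(t_n+\tau/2)\ (j=1,\ldots,m),\qquad U_{n+1}=U_n+K_1^{(m)}.$$ If the global errors $E_n:=U_n-U(t_n)$ satisfy $DE_0=\mathcal{O}(\tau^2)$ in the maximum norm, then $$\|E_n\|_\infty\le C'\tau^2,\qquad n=1,\ldots,n^*=t^*/\tau,$$ where the constant $C'$ depends only on $m$ and $C$ (the fixed data listed in the context being regarded as given); in particular $C'$ is independent of $n$, of $\tau>0$ and of the spatial resolution $N_1,\ldots,N_m$.
   Context: PDE: $m\geq 1$ is an integer, $\beta_1,\ldots,\beta_m>0$ are constants, and $u(t,\vec{x})$ is the solution of $\partial_t u=\sum_{j=1}^m\beta_j\partial_{x_jx_j}u+c(t,\vec{x})$ for $t\in[0,t^*]$, $\vec{x}\in(0,1)^m$, with an initial condition $u(0,\vec{x})=u_0(\vec{x})$ and Dirichlet boundary conditions, which are assumed time-independent. $u$ is assumed to be a smooth function (with as many bounded derivatives as required) on $[0,t^*]\times[0,1]^m$. Spatial discretization: for positive integers $N_1,\ldots,N_m$ let $\Delta x_j=1/(N_j+1)$, let $I_j$ be the identity of dimension $N_j$, $L_j=\frac{1}{\Delta x_j^2}\mathrm{tridiag}(1,-2,1)$ of dimension $N_j$, $D_j=\beta_j(I_m\otimes\cdots\otimes I_{j+1}\otimes L_j\otimes I_{j-1}\otimes\cdots\otimes I_1)$ and $D=\sum_{j=1}^mD_j$ (second-order central differences on the uniform grid $G$ of interior points $\vec{x}_G$). The semidiscrete system is $\dot U=DU+g(t)$, $g(t)=\sum_{j=1}^mg_j(t)$,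 where the discretization of $c$ is included entirely in $g_1$, and $g_j$ for $j\ge 2$ consists only of contributions from the boundary conditions in the $j$-direction. Spatial truncation errors are disregarded: $U(t)=u(t,\vec{x}_G)$ is assumed to be at the same time the exact solution of the ODE system and the restriction of the PDE solution to the grid. The vectors $\varphi_i(t)=D_iU(t)+g_i(t)$ satisfy $\sum_{i=1}^m\varphi_i(t)=\dot U(t)$ and are smooth, i.e. they have first and second time derivatives bounded in the maximum norm independently of the spatial resolution. Conventions: dots and superscripts in parentheses on $U,g,g_j,\varphi_j,u$ denote time derivatives; $I$ is the identity matrix of dimension $N_1\cdots N_m$; $\|\cdot\|_\infty$ is the maximum norm; all $\mathcal{O}$-constants are independent of $\tau$, $t$ and the spatial resolution; $\tau>0$ is the time step with $t^*/\tau$ an integer. The data $t^*$, $\beta_1,\ldots,\beta_m$, $u$, and the constants implied by the $\mathcal{O}$-terms and smoothness assumptions are regarded as fixed. *)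

theory Defs
  imports "HOL-Analysis.Analysis"
begin

text \<open>
  Space dimension \<open>m\<close> is a natural number and directions are \<open>1, \<dots>, m\<close>. A point of \<open>[0,1]^m\<close> is an
  extensional function on \<open>{1..m}\<close>, and so is the multi-index of a grid point. A grid vector is a
  real function of multi-indices, of which only the values on \<open>grid m N\<close> matter; matrices have
  multi-indices as row and column indices.
\<close>

definition cube :: "nat \<Rightarrow> (nat \<Rightarrow> real) set" where
  "cube m = PiE {1..m} (\<lambda>_. {0..1})"

definition open_cube :: "nat \<Rightarrow> (nat \<Rightarrow> real) set" where
  "open_cube m = PiE {1..m} (\<lambda>_. {0<..<1})"

text \<open>
  Derivatives are taken within \<open>[0,T]\<close> and \<open>[0,1]\<close>, hence one-sided at the end points.
  The time derivative serves grid vectors and functions of \<open>(t,x)\<close> alike.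
\<close>

definition time_deriv :: "real \<Rightarrow> (real \<Rightarrow> 'a \<Rightarrow> real) \<Rightarrow> real \<Rightarrow> 'a \<Rightarrow> real" where
  "time_deriv T w t x = vector_derivative (\<lambda>s. w s x) (at t within {0..T})"

definition space_deriv ::
  "nat \<Rightarrow> (real \<Rightarrow> (nat \<Rightarrow> real) \<Rightarrow> real) \<Rightarrow> real \<Rightarrow> (nat \<Rightarrow> real) \<Rightarrow> real" where
  "space_deriv j w t x = vector_derivative (\<lambda>s. w t (x(j := s))) (at (x j) within {0..1})"

definition partial_deriv ::
  "real \<Rightarrow> nat \<Rightarrow> (real \<Rightarrow> (nat \<Rightarrow> real) \<Rightarrow> real) \<Rightarrow> real \<Rightarrow> (nat \<Rightarrow> real) \<Rightarrow> real" where
  "partial_deriv T i = (if i = 0 then time_deriv T else space_deriv i)"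

text \<open>
  All iterated partial derivatives exist and are continuous (hence bounded, by compactness) on
  \<open>[0,T] \<times> [0,1]^m\<close>; direction \<open>0\<close> is time.
\<close>

definition smooth_on_cylinder ::
  "real \<Rightarrow> nat \<Rightarrow> (real \<Rightarrow> (nat \<Rightarrow> real) \<Rightarrow> real) \<Rightarrow> bool" where
  "smooth_on_cylinder T m w \<longleftrightarrow>
     (\<forall>is v. set is \<subseteq> {0..m} \<longrightarrow> v = foldr (partial_deriv T) is w \<longrightarrow>
        continuous_on ({0..T} \<times> cube m) (\<lambda>(t, x). v t x) \<and>
        (\<forall>t\<in>{0..T}. \<forall>x\<in>cube m.
           (\<lambda>s. v s x) differentiable (at t within {0..T}) \<and>
           (\<forall>j\<in>{1..m}. (\<lambda>s. v t (x(j := s))) differentiable (at (x j) within {0..1}))))"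

text \<open>The Dirichlet data \<open>b\<close> do not depend on time.\<close>

definition pde_solution ::
  "real \<Rightarrow> nat \<Rightarrow> (nat \<Rightarrow> real) \<Rightarrow> (real \<Rightarrow> (nat \<Rightarrow> real) \<Rightarrow> real) \<Rightarrow> ((nat \<Rightarrow> real) \<Rightarrow> real) \<Rightarrow>
   ((nat \<Rightarrow> real) \<Rightarrow> real) \<Rightarrow> (real \<Rightarrow> (nat \<Rightarrow> real) \<Rightarrow> real) \<Rightarrow> bool" where
  "pde_solution T m \<beta> c u0 b u \<longleftrightarrow>
     (\<forall>t\<in>{0..T}. \<forall>x\<in>open_cube m.
        time_deriv T u t x = (\<Sum>j\<in>{1..m}. \<beta> j * space_deriv j (space_deriv j u) t x) + c t x) \<and>
     (\<forall>x\<in>cube m. u 0 x = u0 x) \<and>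
     (\<forall>t\<in>{0..T}. \<forall>x\<in>cube m. (\<exists>j\<in>{1..m}. x j = 0 \<or> x j = 1) \<longrightarrow> u t x = b x)"

definition grid :: "nat \<Rightarrow> (nat \<Rightarrow> nat) \<Rightarrow> (nat \<Rightarrow> nat) set" where
  "grid m N = PiE {1..m} (\<lambda>j. {1..N j})"

definition mesh :: "(nat \<Rightarrow> nat) \<Rightarrow> nat \<Rightarrow> real" where
  "mesh N j = 1 / (real (N j) + 1)"

definition grid_point :: "nat \<Rightarrow> (nat \<Rightarrow> nat) \<Rightarrow> (nat \<Rightarrow> nat) \<Rightarrow> nat \<Rightarrow> real" where
  "grid_point m N k = (\<lambda>j\<in>{1..m}. real (k j) * mesh N j)"

definition grid_restrict ::
  "nat \<Rightarrow> (nat \<Rightarrow> nat) \<Rightarrow> (real \<Rightarrow> (nat \<Rightarrow> real) \<Rightarrow> real) \<Rightarrow> real \<Rightarrow> (nat \<Rightarrow> nat) \<Rightarrow> real" where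
  "grid_restrict m N w t k = w t (grid_point m N k)"

definition max_norm :: "nat \<Rightarrow> (nat \<Rightarrow> nat) \<Rightarrow> ((nat \<Rightarrow> nat) \<Rightarrow> real) \<Rightarrow> real" where
  "max_norm m N v = Max ((\<lambda>k. \<bar>v k\<bar>) ` grid m N)"

definition mat_vec ::
  "nat \<Rightarrow> (nat \<Rightarrow> nat) \<Rightarrow> ((nat \<Rightarrow> nat) \<Rightarrow> (nat \<Rightarrow> nat) \<Rightarrow> real) \<Rightarrow>
   ((nat \<Rightarrow> nat) \<Rightarrow> real) \<Rightarrow> (nat \<Rightarrow> nat) \<Rightarrow> real" where
  "mat_vec m N A v k = (\<Sum>l\<in>grid m N. A k l * v l)"

definition L_mat :: "(nat \<Rightarrow> nat) \<Rightarrow> nat \<Rightarrow> nat \<Rightarrow> nat \<Rightarrow> real" where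
  "L_mat N j p q =
     (if p = q then - 2 else if p = Suc q \<or> q = Suc p then 1 else 0) / (mesh N j)\<^sup>2"

text \<open>
  The product over the directions is the \<open>(k,l)\<close> entry of the Kronecker product
  \<open>I \<otimes> \<dots> \<otimes> I \<otimes> L_mat \<otimes> I \<otimes> \<dots> \<otimes> I\<close> with \<open>L_mat\<close> in position \<open>j\<close>.
\<close>

definition D_mat ::
  "nat \<Rightarrow> (nat \<Rightarrow> nat) \<Rightarrow> (nat \<Rightarrow> real) \<Rightarrow> nat \<Rightarrow> (nat \<Rightarrow> nat) \<Rightarrow> (nat \<Rightarrow> nat) \<Rightarrow> real" where
  "D_mat m N \<beta> j k l =
     \<beta> j * (\<Prod>i\<in>{1..m}. if i = j then L_mat N j (k i) (l i) else of_bool (k i = l i))"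

definition D_total ::
  "nat \<Rightarrow> (nat \<Rightarrow> nat) \<Rightarrow> (nat \<Rightarrow> real) \<Rightarrow> (nat \<Rightarrow> nat) \<Rightarrow> (nat \<Rightarrow> nat) \<Rightarrow> real" where
  "D_total m N \<beta> k l = (\<Sum>j\<in>{1..m}. D_mat m N \<beta> j k l)"

text \<open>
  Boundary values that the central difference in direction \<open>j\<close> needs at the grid points next to
  the faces \<open>x j = 0\<close> and \<open>x j = 1\<close> (both of them if \<open>N j = 1\<close>).
\<close>

definition boundary_part ::
  "nat \<Rightarrow> (nat \<Rightarrow> nat) \<Rightarrow> (nat \<Rightarrow> real) \<Rightarrow> ((nat \<Rightarrow> real) \<Rightarrow> real) \<Rightarrow> nat \<Rightarrow> (nat \<Rightarrow> nat) \<Rightarrow> real" where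
  "boundary_part m N \<beta> b j k = \<beta> j / (mesh N j)\<^sup>2 *
     ((if k j = 1 then b ((grid_point m N k)(j := 0)) else 0) +
      (if k j = N j then b ((grid_point m N k)(j := 1)) else 0))"

definition sum_parts :: "nat \<Rightarrow> (nat \<Rightarrow> real \<Rightarrow> 'a \<Rightarrow> real) \<Rightarrow> real \<Rightarrow> 'a \<Rightarrow> real" where
  "sum_parts m g t k = (\<Sum>j\<in>{1..m}. g j t k)"

text \<open>
  The last conjunct says that the restriction of \<open>u\<close> to the grid solves the semidiscrete system
  exactly. With \<open>g 1\<close> carrying the nodal values of \<open>c\<close> themselves this would force the spatial
  truncation error of \<open>u\<close> to vanish, so \<open>g 1\<close> may carry any second-order accurate discretization
  of \<open>c\<close>.
\<close>

definition semidiscretization ::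
  "real \<Rightarrow> nat \<Rightarrow> (nat \<Rightarrow> real) \<Rightarrow> (real \<Rightarrow> (nat \<Rightarrow> real) \<Rightarrow> real) \<Rightarrow> ((nat \<Rightarrow> real) \<Rightarrow> real) \<Rightarrow>
   (real \<Rightarrow> (nat \<Rightarrow> real) \<Rightarrow> real) \<Rightarrow> real \<Rightarrow> (nat \<Rightarrow> nat) \<Rightarrow> (nat \<Rightarrow> real \<Rightarrow> (nat \<Rightarrow> nat) \<Rightarrow> real) \<Rightarrow> bool" where
  "semidiscretization T m \<beta> c b u Kc N g \<longleftrightarrow>
     (\<forall>j\<in>{2..m}. \<forall>t\<in>{0..T}. \<forall>k\<in>grid m N. g j t k = boundary_part m N \<beta> b j k) \<and>
     (\<forall>t\<in>{0..T}. \<forall>k\<in>grid m N.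
        \<bar>g 1 t k - boundary_part m N \<beta> b 1 k - grid_restrict m N c t k\<bar>
          \<le> Kc * (\<Sum>j\<in>{1..m}. (mesh N j)\<^sup>2)) \<and>
     (\<forall>t\<in>{0..T}. \<forall>k\<in>grid m N.
        ((\<lambda>s. grid_restrict m N u s k) has_vector_derivative
           (mat_vec m N (D_total m N \<beta>) (grid_restrict m N u t) k + sum_parts m g t k))
          (at t within {0..T}))"

definition phi ::
  "nat \<Rightarrow> (nat \<Rightarrow> nat) \<Rightarrow> (nat \<Rightarrow> real) \<Rightarrow> (nat \<Rightarrow> real \<Rightarrow> (nat \<Rightarrow> nat) \<Rightarrow> real) \<Rightarrow>
   (real \<Rightarrow> (nat \<Rightarrow> nat) \<Rightarrow> real) \<Rightarrow> nat \<Rightarrow> real \<Rightarrow> (nat \<Rightarrow> nat) \<Rightarrow> real" where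
  "phi m N \<beta> g U j t k = mat_vec m N (D_mat m N \<beta> j) (U t) k + g j t k"

text \<open>
  For \<open>is = [i\<^sub>1, \<dots>, i\<^sub>r]\<close> and grid functions \<open>\<psi>\<close>, functions \<open>w\<close> of \<open>(t,x)\<close>: the relation
  \<open>D\<^sub>i\<^sub>1 \<cdots> D\<^sub>i\<^sub>r \<psi> = \<beta>\<^sub>i\<^sub>1 \<cdots> \<beta>\<^sub>i\<^sub>r \<beta>\<^sub>j \<partial>\<^sub>i\<^sub>1\<^sup>2 \<cdots> \<partial>\<^sub>i\<^sub>r\<^sup>2 \<partial>\<^sub>j\<^sup>2 w + O(h\<^sub>i\<^sub>1\<^sup>2 + \<cdots> + h\<^sub>i\<^sub>r\<^sup>2 + h\<^sub>j\<^sup>2)\<close> in the maximum norm.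
\<close>

definition D_consistent ::
  "real \<Rightarrow> nat \<Rightarrow> (nat \<Rightarrow> real) \<Rightarrow> real \<Rightarrow> (nat \<Rightarrow> nat) \<Rightarrow> nat list \<Rightarrow> nat \<Rightarrow>
   (real \<Rightarrow> (nat \<Rightarrow> nat) \<Rightarrow> real) \<Rightarrow> (real \<Rightarrow> (nat \<Rightarrow> real) \<Rightarrow> real) \<Rightarrow> bool" where
  "D_consistent T m \<beta> K N is j \<psi> w \<longleftrightarrow>
     (\<forall>t\<in>{0..T}.
        max_norm m N (\<lambda>k.
            foldr (\<lambda>i. mat_vec m N (D_mat m N \<beta> i)) is (\<psi> t) k
          - prod_list (map \<beta> is) * \<beta> j *
            grid_restrict m N
              (foldr (\<lambda>i v. space_deriv i (space_deriv i v)) (is @ [j]) w) t k)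
        \<le> K * (sum_list (map (\<lambda>i. (mesh N i)\<^sup>2) is) + (mesh N j)\<^sup>2))"

text \<open>One step, from \<open>V\<close> at time \<open>t\<close> to \<open>V'\<close>, of the modified one-stage AMF-W-method; \<open>K j\<close> is the
  \<open>j\<close>-th inner stage.\<close>

definition amf_w_step ::
  "real \<Rightarrow> nat \<Rightarrow> (nat \<Rightarrow> real) \<Rightarrow> (nat \<Rightarrow> nat) \<Rightarrow> (nat \<Rightarrow> real \<Rightarrow> (nat \<Rightarrow> nat) \<Rightarrow> real) \<Rightarrow>
   real \<Rightarrow> real \<Rightarrow> real \<Rightarrow> ((nat \<Rightarrow> nat) \<Rightarrow> real) \<Rightarrow> ((nat \<Rightarrow> nat) \<Rightarrow> real) \<Rightarrow> bool" where
  "amf_w_step T m \<beta> N g \<theta> \<tau> t V V' \<longleftrightarrow>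
     (\<exists>K :: nat \<Rightarrow> (nat \<Rightarrow> nat) \<Rightarrow> real. \<forall>k\<in>grid m N.
        K 0 k = \<tau> * mat_vec m N (D_total m N \<beta>) V k + \<tau> * sum_parts m g t k \<and>
        (\<forall>j\<in>{1..m}.
           mat_vec m N (\<lambda>k l. of_bool (k = l) - \<theta> * \<tau> * D_mat m N \<beta> j k l) (K j) k
           = K (j - 1) k + \<theta> * \<tau>\<^sup>2 * time_deriv T (g j) (t + \<tau> / 2) k) \<and>
        V' k = V k + K m k)"

end

theory Submission
  imports Defs "HOL-Complex_Analysis.Complex_Analysis"
begin

text \<open>
  One step of the method acts on the error as \<open>E (n+1) = R (E n) - Q (d n)\<close>, where \<open>Q\<close> is the inverse of
  \<open>P = (I - \<tau>/2 D 1) \<cdots> (I - \<tau>/2 D m)\<close>, \<open>R = I + \<tau> Q D\<close>, and \<open>d n\<close> is the defect of the exact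
  trajectory in the equation obtained from the step by multiplying with \<open>P\<close>.

  \<^emph>\<open>The defect.\<close> It is \<open>P (U (t + \<tau>) - U t) - \<tau> U' t - \<tau>\<^sup>2/2 g' (t + \<tau>/2)\<close>. Expanding \<open>P\<close>, the terms
  with at most one factor \<open>D j\<close> combine, through \<open>U' = D U + g\<close>, into a trapezoidal and a midpoint
  quadrature error, of size \<open>\<tau>\<^sup>3\<close>. A term with at least two factors carries at least \<open>\<tau>\<^sup>2\<close>; its largest
  index \<open>j\<close> is at least \<open>2\<close>, so \<open>g j\<close> is constant in time, \<open>D j\<close> turns the increment of \<open>U\<close> into that of
  \<open>\<phi> j\<close>, and the consistency hypotheses bound the remaining factors applied to \<open>\<phi>' j\<close> by derivatives
  of \<open>u\<close>. So \<open>d n\<close> is \<open>O(\<tau>\<^sup>3)\<close> (\<open>defect_bound\<close>), and since its time derivative has the same form, one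
  derivative higher, \<open>d (n+1) - d n\<close> is \<open>O(\<tau>\<^sup>4)\<close>.

  \<^emph>\<open>Summation by parts.\<close> Because \<open>Q = (R - I) (\<tau> D)\<^sup>-\<^sup>1\<close>, the solution of the recursion is a
  combination of \<open>R ^ i D\<^sup>-\<^sup>1\<close> applied to \<open>D (E 0)\<close>, to \<open>d 0 / \<tau>\<close>, to \<open>d (n-1) / \<tau>\<close> and to the
  \<open>n - 1\<close> differences \<open>(d (i+1) - d i) / \<tau>\<close>. All of this is \<open>O(\<tau>\<^sup>2)\<close> as soon as \<open>R ^ n D\<^sup>-\<^sup>1\<close> is bounded
  in the maximum norm uniformly in \<open>n\<close>, \<open>\<tau>\<close> and the grid (\<open>amf_error_bound\<close>). The factor \<open>D\<^sup>-\<^sup>1\<close> matters: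
  the powers of \<open>R\<close> alone are only controlled by this technique up to logarithms.

  \<^emph>\<open>The uniform bound\<close> (\<open>amf_resolvent_max_norm_bound\<close>). In the tensor sine basis \<open>R ^ n D\<^sup>-\<^sup>1\<close> is a Fourier
  multiplier with a symbol \<open>F\<close> that extends holomorphically in each frequency. Summation by
  parts in every direction writes \<open>F\<close> as a combination of tensor products of Fejer symbols; these
  are contractions in the maximum norm because the Fejer kernel is positive. The coefficients are
  mixed second differences of \<open>F\<close>, which Cauchy's estimates bound by \<open>\<Prod>j. 1 / q j\<close> times the supremum of
  \<open>F\<close> for frequencies comparable to \<open>q\<close> in a thin complex sector. There \<open>R\<close> has modulus at most one,
  by an elementary computation with arguments (\<open>amf_symbol_sector_bound\<close>), while \<open>D\<^sup>-\<^sup>1\<close>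
  contributes \<open>1 / (\<Sum>j. (q j)\<^sup>2)\<close>, enough to make the sum over all \<open>q\<close> converge.
\<close>

section \<open>Trigonometric sums and the Fejer kernel\<close>

lemma sum_cos_arith_period:
  fixes M :: nat and x :: int and y :: real
  assumes "0 < M" and "\<not> int M dvd x"
  shows "(\<Sum>p<M. cos (y + real p * (2 * pi * real_of_int x / real M))) = 0"
proof -
  define a where "a = 2 * pi * real_of_int x / real M"
  define z where "z = cis a"
  have "z ^ M = cis (2 * pi * real_of_int x)"
    using assms(1) by (simp add: z_def a_def Complex.DeMoivre)
  then have zM: "z ^ M = 1" by simp
  have "z \<noteq> 1"
  proof
    assume "z = 1"
    then have "cos a = 1" by (simp add: z_def complex_eq_iff)
    then obtain n :: int where n: "a = real_of_int n * 2 * pi"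
      using cos_one_2pi_int by auto
    then have "real_of_int x = real_of_int (n * int M)"
      using assms(1) by (simp add: a_def field_simps)
    then have "x = n * int M" using of_int_eq_iff by blast
    with assms(2) show False by simp
  qed
  then have "(\<Sum>p<M. z ^ p) = 0"
    using zM geometric_sum[of z M] by simp
  then have "Re (cis y * (\<Sum>p<M. z ^ p)) = 0" by simp
  then show ?thesis
    by (simp add: sum_distrib_left z_def Complex.DeMoivre cis_mult a_def)
qed

lemma cosine_sum_full_period:
  fixes N :: nat and x :: int
  assumes "\<bar>x\<bar> < 2 * int N + 2"
  shows "(\<Sum>p<2 * N + 2. cos (real p * (real_of_int x * (pi / real (Suc N)))))
         = (if x = 0 then 2 * real N + 2 else 0)"
proof (cases "x = 0")
  case False
  have "\<not> int (2 * N + 2) dvd x"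
    using assms False dvd_imp_le_int[of x "int (2 * N + 2)"] by auto
  then have "(\<Sum>p<2 * N + 2. cos (0 + real p * (2 * pi * real_of_int x / real (2 * N + 2)))) = 0"
    by (intro sum_cos_arith_period) auto
  moreover have "2 * pi * real_of_int x / real (2 * N + 2) = real_of_int x * (pi / real (Suc N))"
    by (simp add: field_simps)
  ultimately have "(\<Sum>p<2 * N + 2. cos (real p * (real_of_int x * (pi / real (Suc N))))) = 0"
    by (simp only: add_0)
  with False show ?thesis by (simp only: if_False)
qed simp

lemma sum_even_cosine_reflect:
  fixes f :: "nat \<Rightarrow> real"
  assumes "\<And>p. p \<in> {1..N} \<Longrightarrow> f (2 * N + 2 - p) = f p" "f 0 = 0" "f (N + 1) = 0"
  shows "(\<Sum>p<2 * N + 2. f p) = 2 * (\<Sum>p=1..N. f p)"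
proof -
  have r: "f (2 * N + 2 - p) = f p" if "p \<in> {N + 2..2 * N + 1}" for p
  proof -
    have "2 * N + 2 - p \<in> {1..N}" "2 * N + 2 - (2 * N + 2 - p) = p" using that by auto
    then show ?thesis using assms(1)[of "2 * N + 2 - p"] by simp
  qed
  have "{..<2 * N + 2} = insert 0 (insert (N + 1) ({1..N} \<union> {N + 2..2 * N + 1}))" by auto
  then have "(\<Sum>p<2 * N + 2. f p) = (\<Sum>p\<in>{1..N} \<union> {N + 2..2 * N + 1}. f p)"
    using assms(2,3) by simp
  also have "\<dots> = (\<Sum>p=1..N. f p) + (\<Sum>p=N + 2..2 * N + 1. f p)"
    by (rule sum.union_disjoint) auto
  also have "(\<Sum>p=N + 2..2 * N + 1. f p) = (\<Sum>p=1..N. f p)"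
    by (rule sum.reindex_bij_witness[where i = "\<lambda>p. 2 * N + 2 - p" and j = "\<lambda>p. 2 * N + 2 - p"])
       (use r in auto)
  finally show ?thesis by simp
qed

text \<open>
  The product of sines is a difference of two cosines with frequencies \<open>k - l\<close> and \<open>k + l\<close>. These have
  the same parity, so that the difference vanishes at \<open>0\<close> and \<open>N + 1\<close>, and the sum over \<open>{1..N}\<close> is half of
  a sum over a full period.
\<close>

lemma sine_orthogonality:
  fixes N k l :: nat
  assumes k: "k \<in> {1..N}" and l: "l \<in> {1..N}"
  shows "(\<Sum>p=1..N. sin (real p * real k * (pi / real (Suc N))) *
                    sin (real p * real l * (pi / real (Suc N))))
         = (if k = l then (real N + 1) / 2 else 0)"
proof -
  define h where "h = pi / real (Suc N)"
  define f where "f = (\<lambda>p::nat. cos (real p * (real_of_int (int k - int l) * h))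
                               - cos (real p * (real_of_int (int k + int l) * h)))"
  have Nh: "real (N + 1) * h = pi" by (simp add: h_def)
  have per: "cos (real (2 * N + 2 - p) * (real_of_int x * h)) = cos (real p * (real_of_int x * h))"
    if "p \<in> {1..N}" for p x
  proof -
    have "real (2 * N + 2 - p) * (real_of_int x * h)
          = real_of_int x * (2 * pi) - real p * (real_of_int x * h)"
    proof -
      have "real_of_int x * (2 * pi) = real_of_int x * (2 * (real (N + 1) * h))" using Nh by simp
      then show ?thesis using that by (simp add: of_nat_diff algebra_simps)
    qed
    then show ?thesis
      by (simp add: cos_diff mult.commute[of _ "2 * pi"])
  qed
  have half: "cos (real (N + 1) * (real_of_int x * h)) = cos (pi * real_of_int x)" for x
  proof -
    have "real (N + 1) * (real_of_int x * h) = real_of_int x * (real (N + 1) * h)" by simp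
    also have "\<dots> = pi * real_of_int x" unfolding Nh by simp
    finally show ?thesis by (rule arg_cong)
  qed
  have par: "cos (pi * real_of_int (int k - int l)) = cos (pi * real_of_int (int k + int l))"
  proof -
    have "pi * real_of_int (int k + int l) = pi * real_of_int (int k - int l) + 2 * pi * real l"
      by (simp add: algebra_simps)
    then have "cos (pi * real_of_int (int k + int l))
        = cos (pi * real_of_int (int k - int l) + 2 * pi * real l)" by (rule arg_cong)
    moreover have "cos (2 * pi * real l) = 1" "sin (2 * pi * real l) = 0"
      using cos_2npi[of l] sin_2npi[of l] by (simp_all add: mult.commute mult.left_commute)
    ultimately show ?thesis unfolding cos_add by simp
  qed
  have "(\<Sum>p<2 * N + 2. f p) = 2 * (\<Sum>p=1..N. f p)"
  proof (rule sum_even_cosine_reflect)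
    fix p assume "p \<in> {1..N}"
    then show "f (2 * N + 2 - p) = f p" by (simp only: f_def per)
  next
    show "f 0 = 0" by (simp add: f_def)
    show "f (N + 1) = 0" unfolding f_def half par by simp
  qed
  moreover have "(\<Sum>p<2 * N + 2. f p) = (if k = l then 2 * real N + 2 else 0)"
  proof -
    have "(\<Sum>p<2 * N + 2. f p) = (if int k - int l = 0 then 2 * real N + 2 else 0)
            - (if int k + int l = 0 then 2 * real N + 2 else 0)"
      unfolding f_def sum_subtractf h_def
      using k l by (subst (1 2) cosine_sum_full_period) auto
    then show ?thesis using k l by simp
  qed
  moreover have "2 * (\<Sum>p=1..N. sin (real p * real k * h) * sin (real p * real l * h)) = (\<Sum>p=1..N. f p)"
    unfolding sum_distrib_left
  proof (rule sum.cong)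
    fix p
    have "2 * (sin a * sin b) = cos (a - b) - cos (a + b)" for a b :: real
      by (simp add: sin_times_sin)
    moreover have "real p * real k * h - real p * real l * h = real p * (real_of_int (int k - int l) * h)"
      "real p * real k * h + real p * real l * h = real p * (real_of_int (int k + int l) * h)"
      by (simp_all add: algebra_simps)
    ultimately show "2 * (sin (real p * real k * h) * sin (real p * real l * h)) = f p"
      by (simp only: f_def)
  qed simp
  ultimately show ?thesis unfolding h_def by (auto split: if_splits)
qed

definition fejer :: "nat \<Rightarrow> real \<Rightarrow> real" where
  "fejer q x = 1 + 2 * (\<Sum>p=1..<q. (1 - real p / real q) * cos (real p * x))"

text \<open>
  This is the source of the positivity of the Fejer kernel: it is the squared modulus of
  \<open>\<Sum>j<q. exp (\<i> j x)\<close>, divided by \<open>q\<close>.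
\<close>

lemma fejer_eq_square:
  assumes "0 < q"
  shows "real q * fejer q x = (\<Sum>j<q. cos (real j * x))\<^sup>2 + (\<Sum>j<q. sin (real j * x))\<^sup>2"
proof -
  have step: "real q * fejer q x = real q + 2 * (\<Sum>p=1..<q. (real q - real p) * cos (real p * x))"
    if "0 < q" for q
  proof -
    have "real q * (\<Sum>p=1..<q. (1 - real p / real q) * cos (real p * x))
        = (\<Sum>p=1..<q. (real q - real p) * cos (real p * x))"
      unfolding sum_distrib_left
      by (rule sum.cong) (use that in \<open>auto simp: right_diff_distrib left_diff_distrib\<close>)
    then show ?thesis by (simp add: fejer_def distrib_left mult.left_commute[of _ 2])
  qed
  have "real q + 2 * (\<Sum>p=1..<q. (real q - real p) * cos (real p * x))
        = (\<Sum>j<q. cos (real j * x))\<^sup>2 + (\<Sum>j<q. sin (real j * x))\<^sup>2" for q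
  proof (induction q)
    case (Suc q)
    have "(\<Sum>p=1..<Suc q. (real (Suc q) - real p) * cos (real p * x))
          = (\<Sum>p=1..<q. (real q - real p) * cos (real p * x)) + (\<Sum>p=1..<Suc q. cos (real p * x))"
    proof (cases "q = 0")
      case False
      then show ?thesis
        by (simp add: sum.distrib[symmetric] algebra_simps)
    qed simp
    moreover have "(\<Sum>p=1..<Suc q. cos (real p * x)) = (\<Sum>j<q. cos ((real q - real j) * x))"
      by (rule sum.reindex_bij_witness[where i = "\<lambda>j. q - j" and j = "\<lambda>p. q - p"])
         (auto simp: of_nat_diff)
    moreover have "(\<Sum>j<q. cos ((real q - real j) * x))
          = cos (real q * x) * (\<Sum>j<q. cos (real j * x)) + sin (real q * x) * (\<Sum>j<q. sin (real j * x))"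
      by (simp add: left_diff_distrib cos_diff sum.distrib sum_distrib_left)
    moreover have "(A + c)\<^sup>2 + (B + s)\<^sup>2 = A\<^sup>2 + B\<^sup>2 + 2 * (c * A + s * B) + (c\<^sup>2 + s\<^sup>2)"
      for A B c s :: real
      by (simp add: power2_eq_square algebra_simps)
    ultimately show ?case
      using Suc.IH by simp
  qed simp
  with step[OF assms] show ?thesis by simp
qed

lemma fejer_nonneg: "0 < q \<Longrightarrow> 0 \<le> fejer q x"
  using fejer_eq_square[of q x] zero_le_mult_iff[of "real q" "fejer q x"] by simp

text \<open>
  For \<open>q \<le> N + 1\<close> the coefficients of the Fejer kernel. The extra index \<open>q = N + 2\<close> stands for the constant
  symbol, that is for the identity; it represents the boundary value left over by summation by parts.
\<close>

definition fejer_symbol :: "nat \<Rightarrow> nat \<Rightarrow> nat \<Rightarrow> real" where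
  "fejer_symbol N q p = (if q = N + 2 then 1 else max 0 (1 - real p / real q))"

text \<open>
  The \<open>(k, l)\<close> entry of the operator with eigenvalues \<open>h p\<close> on the one-dimensional discrete sine modes.
\<close>

definition sine_kernel :: "nat \<Rightarrow> (nat \<Rightarrow> real) \<Rightarrow> nat \<Rightarrow> nat \<Rightarrow> real" where
  "sine_kernel N h k l = (\<Sum>p=1..N. 2 / real (Suc N) * h p *
     (sin (real p * real k * (pi / real (Suc N))) * sin (real p * real l * (pi / real (Suc N)))))"

lemma sum_fejer_full_period:
  assumes "1 \<le> q" "q \<le> N + 1"
  shows "(\<Sum>l<2 * N + 2. fejer q (y + real l * (pi / real (Suc N)))) = 2 * real N + 2"
proof -
  have "(\<Sum>l<2 * N + 2. fejer q (y + real l * (pi / real (Suc N))))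
    = 2 * real N + 2 + 2 * (\<Sum>p=1..<q. (1 - real p / real q) *
         (\<Sum>l<2 * N + 2. cos (real p * y + real l * (2 * pi * real_of_int (int p) / real (2 * N + 2)))))"
  proof -
    have arg: "real p * (y + real l * (pi / real (Suc N)))
        = real p * y + real l * (2 * pi * real_of_int (int p) / real (2 * N + 2))" for p l
      by (simp add: field_simps)
    have swap: "(\<Sum>l\<in>A. 1 + 2 * (\<Sum>p\<in>B. w p * c p l))
        = real (card A) + 2 * (\<Sum>p\<in>B. w p * (\<Sum>l\<in>A. c p l))"
      for A B :: "nat set" and w :: "nat \<Rightarrow> real" and c
    proof -
      have "(\<Sum>p\<in>B. w p * (\<Sum>l\<in>A. c p l)) = (\<Sum>l\<in>A. \<Sum>p\<in>B. w p * c p l)"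
        unfolding sum_distrib_left by (rule sum.swap)
      then show ?thesis by (simp only: sum.distrib sum_distrib_left[symmetric]) simp
    qed
    show ?thesis
      unfolding fejer_def arg by (subst swap) simp
  qed
  also have "(\<Sum>p=1..<q. (1 - real p / real q) *
         (\<Sum>l<2 * N + 2. cos (real p * y + real l * (2 * pi * real_of_int (int p) / real (2 * N + 2))))) = 0"
  proof (rule sum.neutral, rule ballI)
    fix p assume p: "p \<in> {1..<q}"
    have "\<not> int (2 * N + 2) dvd int p"
      using p assms dvd_imp_le_int[of "int p" "int (2 * N + 2)"] by auto
    then have "(\<Sum>l<2 * N + 2. cos (real p * y + real l * (2 * pi * real_of_int (int p) / real (2 * N + 2)))) = 0"
      by (intro sum_cos_arith_period) auto
    then show "(1 - real p / real q) *
         (\<Sum>l<2 * N + 2. cos (real p * y + real l * (2 * pi * real_of_int (int p) / real (2 * N + 2)))) = 0"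
      by simp
  qed
  finally show ?thesis by simp
qed

lemma sine_kernel_fejer:
  assumes "2 \<le> q" "q \<le> N + 1"
  shows "sine_kernel N (fejer_symbol N q) k l
    = (fejer q ((real k - real l) * (pi / real (Suc N))) - fejer q ((real k + real l) * (pi / real (Suc N))))
      / (2 * real (Suc N))"
proof -
  define h where "h = pi / real (Suc N)"
  have "sine_kernel N (fejer_symbol N q) k l = (\<Sum>p=1..<q. 2 / real (Suc N) * (1 - real p / real q) *
     (sin (real p * real k * h) * sin (real p * real l * h)))"
    unfolding sine_kernel_def fejer_symbol_def h_def
    by (rule sum.mono_neutral_cong_right) (use assms in \<open>auto simp: max_def field_simps\<close>)
  also have "\<dots> = (\<Sum>p=1..<q. ((1 - real p / real q) * cos (real p * ((real k - real l) * h))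
     - (1 - real p / real q) * cos (real p * ((real k + real l) * h))) / real (Suc N))"
  proof (rule sum.cong)
    fix p
    have cancel: "2 / S * w * ((x - y) / 2) = w * (x - y) / S" for S w x y :: real by simp
    have *: "sin (real p * real k * h) * sin (real p * real l * h)
      = (cos (real p * ((real k - real l) * h)) - cos (real p * ((real k + real l) * h))) / 2"
      by (simp add: sin_times_sin algebra_simps)
    show "2 / real (Suc N) * (1 - real p / real q) * (sin (real p * real k * h) * sin (real p * real l * h))
      = ((1 - real p / real q) * cos (real p * ((real k - real l) * h))
     - (1 - real p / real q) * cos (real p * ((real k + real l) * h))) / real (Suc N)"
      unfolding * right_diff_distrib[of "1 - real p / real q", symmetric] by (rule cancel)
  qed simp
  also have "\<dots> = (fejer q ((real k - real l) * h) - fejer q ((real k + real l) * h)) / (2 * real (Suc N))"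
  proof -
    have cancel: "(x - y) / S = (1 + 2 * x - (1 + 2 * y)) / (2 * S)" for S x y :: real
      by (cases "S = 0") (auto simp: field_simps)
    show ?thesis unfolding fejer_def sum_divide_distrib[symmetric] sum_subtractf by (rule cancel)
  qed
  finally show ?thesis by (simp add: h_def)
qed

lemma sine_kernel_one:
  assumes "k \<in> {1..N}" "l \<in> {1..N}"
  shows "sine_kernel N (\<lambda>_. 1) k l = of_bool (k = l)"
  unfolding sine_kernel_def mult_1_right sum_distrib_left[symmetric] sine_orthogonality[OF assms]
  by simp

text \<open>
  The kernel is a difference of Fejer kernels at \<open>k - l\<close> and \<open>k + l\<close>. By positivity its modulus is at most
  their sum, and as \<open>l\<close> runs through \<open>{1..N}\<close> the points \<open>k - l\<close> and \<open>k + l\<close> are distinct modulo the period, so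
  the total is at most the mean value of one Fejer kernel.
\<close>

lemma fejer_multiplier_bound:
  assumes k: "k \<in> {1..N}" and q: "q \<in> {2..N + 2}"
  shows "(\<Sum>l=1..N. \<bar>sine_kernel N (fejer_symbol N q) k l\<bar>) \<le> 1"
proof (cases "q = N + 2")
  case True
  then have "sine_kernel N (fejer_symbol N q) k l = sine_kernel N (\<lambda>_. 1) k l" for l
    by (simp add: fejer_symbol_def sine_kernel_def)
  then have "(\<Sum>l=1..N. \<bar>sine_kernel N (fejer_symbol N q) k l\<bar>) = (\<Sum>l=1..N. of_bool (k = l))"
    using sine_kernel_one[OF k] by (intro sum.cong) auto
  also have "\<dots> = 1" using k by (simp add: of_bool_def)
  finally show ?thesis by simp
next
  case False
  with q have q': "2 \<le> q" "q \<le> N + 1" by auto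
  define h where "h = pi / real (Suc N)"
  have nn: "0 \<le> fejer q x" for x using q' fejer_nonneg[of q x] by simp
  \<comment> \<open>Lists the Fejer kernel along one full period, starting at \<open>k - N\<close>.\<close>
  define G where "G = (\<lambda>l::nat. fejer q ((real k - real N) * h + real l * h))"
  have "(\<Sum>l=1..N. \<bar>sine_kernel N (fejer_symbol N q) k l\<bar>)
     \<le> (\<Sum>l=1..N. (fejer q ((real k - real l) * h) + fejer q ((real k + real l) * h)) / (2 * real (Suc N)))"
  proof (rule sum_mono)
    fix l
    show "\<bar>sine_kernel N (fejer_symbol N q) k l\<bar>
      \<le> (fejer q ((real k - real l) * h) + fejer q ((real k + real l) * h)) / (2 * real (Suc N))"
      unfolding sine_kernel_fejer[OF q'] h_def[symmetric]
      using nn[of "(real k - real l) * h"] nn[of "(real k + real l) * h"]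
      by (auto simp: abs_div intro!: divide_right_mono)
  qed
  also have "\<dots> = ((\<Sum>l=1..N. fejer q ((real k - real l) * h)) + (\<Sum>l=1..N. fejer q ((real k + real l) * h)))
      / (2 * real (Suc N))"
    by (simp add: sum_divide_distrib[symmetric] sum.distrib)
  also have "(\<Sum>l=1..N. fejer q ((real k - real l) * h)) = (\<Sum>l\<in>{0..<N}. G l)"
    by (rule sum.reindex_bij_witness[where i = "\<lambda>l. N - l" and j = "\<lambda>l. N - l"])
       (auto simp: G_def of_nat_diff algebra_simps)
  also have "(\<Sum>l=1..N. fejer q ((real k + real l) * h)) = (\<Sum>l\<in>{N + 1..2 * N}. G l)"
    by (rule sum.reindex_bij_witness[where i = "\<lambda>l. l - N" and j = "\<lambda>l. l + N"])
       (auto simp: G_def of_nat_diff algebra_simps)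
  also have "(\<Sum>l\<in>{0..<N}. G l) + (\<Sum>l\<in>{N + 1..2 * N}. G l) = (\<Sum>l\<in>{0..<N} \<union> {N + 1..2 * N}. G l)"
    by (rule sum.union_disjoint[symmetric]) auto
  also have "\<dots> \<le> (\<Sum>l<2 * N + 2. G l)"
    by (rule sum_mono2) (auto simp: G_def nn)
  also have "\<dots> = 2 * real N + 2"
    unfolding G_def h_def by (rule sum_fejer_full_period) (use q' in auto)
  finally show ?thesis by (simp add: divide_right_mono add.commute)
qed

section \<open>Summation by parts and Cauchy estimates\<close>

text \<open>
  The coefficient with which \<open>f x\<close> enters the \<open>q\<close>-th term when \<open>f\<close> is summed by parts twice against
  \<open>fejer_symbol\<close>: \<open>q\<close> times the second difference at \<open>q\<close>, and at the right end \<open>N + 1\<close> times a first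
  difference and the value \<open>f (N + 1)\<close> itself. The node \<open>N + 1\<close> is not a frequency of the grid, but symbols
  are defined there; using it keeps the last first difference bounded by Cauchy's estimate.
\<close>

definition diff_weight :: "nat \<Rightarrow> nat \<Rightarrow> nat \<Rightarrow> real" where
  "diff_weight N q x =
     (if q = N + 2 then of_bool (x = N + 1)
      else if q = N + 1 then real q * (of_bool (x = N) - of_bool (x = N + 1))
      else real q * (of_bool (x = q + 1) - 2 * of_bool (x = q) + of_bool (x + 1 = q)))"

text \<open>
  Dually to summation by parts: the second difference in \<open>q\<close> of \<open>max 0 (q - p)\<close> is the unit vector at \<open>p\<close>.
\<close>

lemma fejer_symbol_expansion:
  assumes p: "p \<in> {1..N}" and x: "x \<in> {1..N + 1}"
  shows "(\<Sum>q=2..N + 2. fejer_symbol N q p * diff_weight N q x) = of_bool (p = x)"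
proof -
  define g where "g = (\<lambda>q::nat. max 0 (real q - real p))"
  have gq: "fejer_symbol N q p * real q = g q" if "1 \<le> q" "q \<le> N + 1" for q
    using that by (auto simp: fejer_symbol_def g_def max_def field_simps)
  have "{2..N + 2} = insert (N + 2) (insert (N + 1) {2..N})" using p by auto
  then have "(\<Sum>q=2..N + 2. fejer_symbol N q p * diff_weight N q x)
      = fejer_symbol N (N + 2) p * diff_weight N (N + 2) x
        + (fejer_symbol N (N + 1) p * diff_weight N (N + 1) x
        + (\<Sum>q=2..N. fejer_symbol N q p * diff_weight N q x))"
    by simp
  also have "fejer_symbol N (N + 2) p * diff_weight N (N + 2) x = of_bool (x = N + 1)"
    by (simp add: fejer_symbol_def diff_weight_def)
  also have "fejer_symbol N (N + 1) p * diff_weight N (N + 1) x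
      = g (N + 1) * (of_bool (x = N) - of_bool (x = N + 1))"
    by (simp add: diff_weight_def gq[symmetric] del: of_nat_Suc)
  also have "(\<Sum>q=2..N. fejer_symbol N q p * diff_weight N q x)
      = (\<Sum>q=2..N. g q * of_bool (q = x - 1 \<and> 2 \<le> x) - 2 * (g q * of_bool (q = x))
           + g q * of_bool (q = x + 1))"
  proof (rule sum.cong)
    fix q assume q: "q \<in> {2..N}"
    then have e: "(x = q + 1) = (q = x - 1 \<and> 2 \<le> x)" "(x = q) = (q = x)" "(x + 1 = q) = (q = x + 1)"
      by auto
    have "fejer_symbol N q p * diff_weight N q x = (fejer_symbol N q p * real q) *
       (of_bool (q = x - 1 \<and> 2 \<le> x) - 2 * of_bool (q = x) + of_bool (q = x + 1))"
      using q unfolding diff_weight_def e by simp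
    also have "fejer_symbol N q p * real q = g q" using q by (intro gq) auto
    finally show "fejer_symbol N q p * diff_weight N q x = g q * of_bool (q = x - 1 \<and> 2 \<le> x)
      - 2 * (g q * of_bool (q = x)) + g q * of_bool (q = x + 1)"
      by (simp only: distrib_left right_diff_distrib mult.left_commute)
  qed simp
  also have "\<dots> = (if x - 1 \<in> {2..N} \<and> 2 \<le> x then g (x - 1) else 0)
      - 2 * (if x \<in> {2..N} then g x else 0) + (if x + 1 \<in> {2..N} then g (x + 1) else 0)"
  proof -
    have "(\<Sum>q=2..N. g q * of_bool (q = y \<and> P)) = (if y \<in> {2..N} \<and> P then g y else 0)" for y P
      by (cases P) (simp_all add: of_bool_def if_distrib[of "\<lambda>u. _ * u"] cong: if_cong)
    from this[of "x - 1" "2 \<le> x"] this[of x True] this[of "x + 1" True]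
    show ?thesis
      by (simp only: sum.distrib sum_subtractf sum_distrib_left[symmetric] simp_thms)
  qed
  finally show ?thesis
    using p x by (auto simp: g_def max_def of_nat_diff split: if_splits)
qed

text \<open>
  The radius of each disc is proportional to its centre, so that Cauchy's estimate at a frequency \<open>x\<close> gains
  a factor \<open>1 / x\<close> per derivative, whatever the scale.
\<close>

definition sector_nbhd :: "real \<Rightarrow> real \<Rightarrow> real \<Rightarrow> complex set" where
  "sector_nbhd \<epsilon> a b = (\<Union>x\<in>{a..b}. ball (of_real x) (\<epsilon> * x))"

lemma open_sector_nbhd: "open (sector_nbhd \<epsilon> a b)"
  by (auto simp: sector_nbhd_def)

lemma of_real_in_sector_nbhd:
  assumes "0 < \<epsilon>" "0 < a" "x \<in> {a..b}"
  shows "of_real x \<in> sector_nbhd \<epsilon> a b"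
  unfolding sector_nbhd_def by (rule UN_I[of x]) (use assms in auto)

lemma deriv_bound_sector_nbhd:
  assumes f: "f holomorphic_on sector_nbhd \<epsilon> a b"
    and B: "\<And>z. z \<in> sector_nbhd \<epsilon> a b \<Longrightarrow> norm (f z) \<le> B"
    and "0 < \<epsilon>" "0 < a" and x: "x \<in> {a..b}"
  shows "norm ((deriv ^^ n) f (of_real x)) \<le> fact n * B * (2 / (\<epsilon> * a)) ^ n"
proof -
  define r where "r = \<epsilon> * x / 2"
  have "0 < x" "a \<le> x" using assms by auto
  have r: "0 < r" using \<open>0 < x\<close> \<open>0 < \<epsilon>\<close> by (simp add: r_def)
  have "0 \<le> B" using B[OF of_real_in_sector_nbhd[OF \<open>0 < \<epsilon>\<close> \<open>0 < a\<close> x]] norm_ge_zero order_trans by blast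
  have sub: "cball (of_real x) r \<subseteq> sector_nbhd \<epsilon> a b"
  proof -
    have "cball (of_real x) r \<subseteq> ball (of_real x :: complex) (\<epsilon> * x)"
      using r by (auto simp: r_def)
    also have "\<dots> \<subseteq> sector_nbhd \<epsilon> a b" using x by (auto simp: sector_nbhd_def)
    finally show ?thesis .
  qed
  have "norm ((deriv ^^ n) f (of_real x)) \<le> fact n * B / r ^ n"
  proof (rule Cauchy_inequality)
    show "f holomorphic_on ball (of_real x) r"
      using f sub ball_subset_cball by (meson holomorphic_on_subset order_trans)
    show "continuous_on (cball (of_real x) r) f"
      using f sub holomorphic_on_imp_continuous_on holomorphic_on_subset by blast
    show "norm (f y) \<le> B" if "norm (of_real x - y) = r" for y
      using that sub by (intro B) (auto simp: dist_norm)
  qed (use r in auto)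
  also have "\<dots> = fact n * B * (1 / r) ^ n" by (simp add: power_divide)
  also have "\<dots> \<le> fact n * B * (2 / (\<epsilon> * a)) ^ n"
    using \<open>0 \<le> B\<close> \<open>0 < a\<close> \<open>a \<le> x\<close> \<open>0 < \<epsilon>\<close> r
    by (intro mult_left_mono power_mono) (auto simp: r_def frac_le)
  finally show ?thesis .
qed

lemma difference_bound_sector_nbhd:
  assumes f: "f holomorphic_on sector_nbhd \<epsilon> a b"
    and B: "\<And>z. z \<in> sector_nbhd \<epsilon> a b \<Longrightarrow> norm (f z) \<le> B"
    and "0 < \<epsilon>" "0 < a" and x: "x \<in> {a..b}" and y: "y \<in> {a..b}"
  shows "norm (f (of_real x) - f (of_real y)) \<le> B * (2 / (\<epsilon> * a)) * \<bar>x - y\<bar>"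
proof -
  have "norm (f (of_real x) - f (of_real y)) \<le> B * (2 / (\<epsilon> * a)) * norm (of_real x - of_real y :: complex)"
  proof (rule field_differentiable_bound[where S = "of_real ` {a..b}" and f' = "deriv f"])
    show "convex (complex_of_real ` {a..b})"
      by (intro convex_linear_image bounded_linear.linear[OF bounded_linear_of_real] convex_real_interval)
    fix z :: complex assume "z \<in> of_real ` {a..b}"
    then obtain t where t: "z = of_real t" "t \<in> {a..b}" by auto
    have "z \<in> sector_nbhd \<epsilon> a b" unfolding t using assms t by (intro of_real_in_sector_nbhd)
    then show "(f has_field_derivative deriv f z) (at z within of_real ` {a..b})"
      using f open_sector_nbhd holomorphic_derivI by blast
    show "norm (deriv f z) \<le> B * (2 / (\<epsilon> * a))"
      using deriv_bound_sector_nbhd[OF f B \<open>0 < \<epsilon>\<close> \<open>0 < a\<close> t(2), of 1] t by simp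
  qed (use x y in auto)
  then show ?thesis by (simp flip: of_real_diff)
qed

lemma second_difference_bound_sector_nbhd:
  assumes f: "f holomorphic_on sector_nbhd \<epsilon> a b"
    and B: "\<And>z. z \<in> sector_nbhd \<epsilon> a b \<Longrightarrow> norm (f z) \<le> B"
    and "0 < \<epsilon>" "0 < a" and x: "a \<le> x - 1" "x + 1 \<le> b"
  shows "norm (f (of_real (x + 1)) - 2 * f (of_real x) + f (of_real (x - 1))) \<le> 2 * B * (2 / (\<epsilon> * a))\<^sup>2"
proof -
  define K where "K = 2 * B * (2 / (\<epsilon> * a))\<^sup>2"
  define h where "h = (\<lambda>z. f (z + 1) - f z)"
  have mem: "of_real t \<in> sector_nbhd \<epsilon> a b" if "t \<in> {a..b}" for t
    using that assms by (intro of_real_in_sector_nbhd)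
  have d1: "(f has_field_derivative deriv f (of_real t)) (at (of_real t))" if "t \<in> {a..b}" for t
    using f open_sector_nbhd mem[OF that] holomorphic_derivI by blast
  have df: "deriv f holomorphic_on sector_nbhd \<epsilon> a b"
    using f open_sector_nbhd by (rule holomorphic_deriv)
  have d2: "norm (deriv f (of_real (t + 1)) - deriv f (of_real t)) \<le> K"
    if "t \<in> {x - 1..x}" for t
  proof -
    have "norm (deriv f (of_real (t + 1)) - deriv f (of_real t))
        \<le> K * norm (of_real (t + 1) - of_real t :: complex)"
    proof (rule field_differentiable_bound[where S = "of_real ` {a..b}" and f' = "deriv (deriv f)"])
      show "convex (complex_of_real ` {a..b})"
        by (intro convex_linear_image bounded_linear.linear[OF bounded_linear_of_real] convex_real_interval)
      fix z :: complex assume "z \<in> of_real ` {a..b}"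
      then obtain t where t: "z = of_real t" "t \<in> {a..b}" by auto
      show "(deriv f has_field_derivative deriv (deriv f) z) (at z within of_real ` {a..b})"
        using df open_sector_nbhd mem[OF t(2)] holomorphic_derivI t(1) by blast
      show "norm (deriv (deriv f) z) \<le> K"
        using deriv_bound_sector_nbhd[OF f B \<open>0 < \<epsilon>\<close> \<open>0 < a\<close> t(2), of 2] t
        by (simp add: K_def numeral_2_eq_2)
    next
      show "complex_of_real (t + 1) \<in> complex_of_real ` {a..b}" "complex_of_real t \<in> complex_of_real ` {a..b}"
        using x that by (intro imageI; simp)+
    qed
    then show ?thesis by simp
  qed
  have "norm (h (of_real x) - h (of_real (x - 1))) \<le> K * norm (of_real x - of_real (x - 1) :: complex)"
  proof (rule field_differentiable_bound[where S = "of_real ` {x - 1..x}"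
        and f' = "\<lambda>z. deriv f (z + 1) - deriv f z"])
    show "convex (complex_of_real ` {x - 1..x})"
      by (intro convex_linear_image bounded_linear.linear[OF bounded_linear_of_real] convex_real_interval)
    fix z :: complex assume "z \<in> of_real ` {x - 1..x}"
    then obtain t where t: "z = of_real t" "t \<in> {x - 1..x}" by auto
    have "(f has_field_derivative deriv f (of_real t)) (at (of_real t))"
      using t x by (intro d1) auto
    moreover have "(f has_field_derivative deriv f (of_real (t + 1))) (at (of_real (t + 1)))"
      using t x by (intro d1) auto
    then have "((\<lambda>z. f (z + 1)) has_field_derivative deriv f (z + 1)) (at z)"
      using t by (simp add: DERIV_shift)
    ultimately have "(h has_field_derivative (deriv f (z + 1) - deriv f z)) (at z)"
      unfolding h_def using t by (intro DERIV_diff) auto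
    then show "(h has_field_derivative (deriv f (z + 1) - deriv f z)) (at z within of_real ` {x - 1..x})"
      by (rule has_field_derivative_at_within)
    show "norm (deriv f (z + 1) - deriv f z) \<le> K"
      using d2[OF t(2)] t by simp
  next
    show "complex_of_real x \<in> complex_of_real ` {x - 1..x}"
      "complex_of_real (x - 1) \<in> complex_of_real ` {x - 1..x}"
      by (intro imageI; simp)+
  qed
  moreover have "h (of_real x) - h (of_real (x - 1)) = f (of_real (x + 1)) - 2 * f (of_real x) + f (of_real (x - 1))"
    by (simp add: h_def)
  ultimately show ?thesis by (simp add: K_def)
qed

text \<open>
  The number \<open>32\<close> covers the three kinds of coefficients: \<open>2 (2 / (\<epsilon> q / 2))\<^sup>2 q = 32 / (\<epsilon>\<^sup>2 q)\<close> for second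
  differences, \<open>4 / \<epsilon>\<close> for the first difference and \<open>1\<close> for the end value.
\<close>

definition coefficient_bound :: "real \<Rightarrow> nat \<Rightarrow> nat \<Rightarrow> real" where
  "coefficient_bound \<epsilon> N q = 32 / \<epsilon>\<^sup>2 * (if q \<le> N then 1 / real q else 1)"

lemma diff_weight_functional_bound:
  assumes "1 \<le> N" "0 < \<epsilon>" "\<epsilon> \<le> 1" and q: "q \<in> {2..N + 2}"
    and f: "f holomorphic_on sector_nbhd \<epsilon> (real q / 2) (real N + 1)"
    and B: "\<And>z. z \<in> sector_nbhd \<epsilon> (real q / 2) (real N + 1) \<Longrightarrow> norm (f z) \<le> B"
  shows "norm (\<Sum>x=1..N + 1. of_real (diff_weight N q x) * f (of_nat x)) \<le> coefficient_bound \<epsilon> N q * B"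
proof -
  have q0: "0 < real q / 2" using q by simp
  have "of_real (real N + 1) \<in> sector_nbhd \<epsilon> (real q / 2) (real N + 1)"
    using assms(1,2) q q0 by (intro of_real_in_sector_nbhd) auto
  then have fN: "norm (f (of_nat (N + 1))) \<le> B" using B by (metis of_nat_1 of_nat_add of_real_of_nat_eq)
  then have "0 \<le> B" using norm_ge_zero order_trans by blast
  have eps: "1 \<le> 1 / \<epsilon>\<^sup>2" "1 / \<epsilon> \<le> 1 / \<epsilon>\<^sup>2"
    using assms(2,3) by (simp_all add: power2_eq_square field_simps mult_le_one mult_left_le)
  have delta: "(\<Sum>x=1..N + 1. of_real (of_bool (x = y)) * f (of_nat x)) = (f (of_nat y) :: complex)"
    if "y \<in> {1..N + 1}" for y
  proof -
    have "(\<Sum>x=1..N + 1. of_real (of_bool (x = y)) * f (of_nat x))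
        = (\<Sum>x=1..N + 1. if x = y then f (of_nat x) else 0)" by (rule sum.cong) auto
    then show ?thesis using that by simp
  qed
  consider "q = N + 2" | "q = N + 1" | "q \<le> N" using q by force
  then show ?thesis
  proof cases
    case 1
    then have "(\<Sum>x=1..N + 1. of_real (diff_weight N q x) * f (of_nat x)) = f (of_nat (N + 1))"
      using delta[of "N + 1"] unfolding diff_weight_def by simp
    moreover have "B \<le> 32 / \<epsilon>\<^sup>2 * B" using eps \<open>0 \<le> B\<close> mult_right_mono[of 1 "32 / \<epsilon>\<^sup>2" B] by simp
    ultimately show ?thesis using fN 1 by (simp add: coefficient_bound_def)
  next
    case 2
    have "(\<Sum>x=1..N + 1. of_real (diff_weight N q x) * f (of_nat x))
        = of_nat q * ((\<Sum>x=1..N + 1. of_real (of_bool (x = N)) * f (of_nat x))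
           - (\<Sum>x=1..N + 1. of_real (of_bool (x = N + 1)) * f (of_nat x)))"
      unfolding sum_distrib_left sum_subtractf[symmetric]
      by (rule sum.cong) (use 2 in \<open>auto simp: diff_weight_def\<close>)
    also have "\<dots> = of_nat q * (f (of_nat N) - f (of_nat (N + 1)))"
      using assms(1) by (subst (1 2) delta) auto
    finally have "norm (\<Sum>x=1..N + 1. of_real (diff_weight N q x) * f (of_nat x))
        = real q * norm (f (of_real (real N)) - f (of_real (real N + 1)))"
      by (simp only: norm_mult norm_of_nat) (simp add: add.commute)
    also have "\<dots> \<le> real q * (B * (2 / (\<epsilon> * (real q / 2))) * \<bar>real N - (real N + 1)\<bar>)"
      using assms(1,2) q0 2 by (intro mult_left_mono difference_bound_sector_nbhd[OF f B]) auto
    also have "\<dots> = 4 * (1 / \<epsilon>) * B" using q assms(2) by (simp add: field_simps)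
    also have "\<dots> \<le> 32 * (1 / \<epsilon>\<^sup>2) * B"
      using eps \<open>0 \<le> B\<close> assms(2) by (intro mult_right_mono mult_mono) auto
    finally show ?thesis using 2 by (simp add: coefficient_bound_def)
  next
    case 3
    have "(\<Sum>x=1..N + 1. of_real (diff_weight N q x) * f (of_nat x))
        = of_nat q * ((\<Sum>x=1..N + 1. of_real (of_bool (x = q + 1)) * f (of_nat x))
           - 2 * (\<Sum>x=1..N + 1. of_real (of_bool (x = q)) * f (of_nat x))
           + (\<Sum>x=1..N + 1. of_real (of_bool (x = q - 1)) * f (of_nat x)))"
      unfolding sum_distrib_left sum_subtractf[symmetric] sum.distrib[symmetric]
      by (rule sum.cong) (use 3 q in \<open>auto simp: diff_weight_def\<close>)
    also have "\<dots> = of_nat q * (f (of_nat (q + 1)) - 2 * f (of_nat q) + f (of_nat (q - 1)))"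
      using 3 q by (subst (1 2 3) delta) auto
    finally have "norm (\<Sum>x=1..N + 1. of_real (diff_weight N q x) * f (of_nat x))
        = real q * norm (f (of_real (real q + 1)) - 2 * f (of_real (real q)) + f (of_real (real q - 1)))"
      using q by (simp only: norm_mult norm_of_nat) (simp add: of_nat_diff add.commute)
    also have "\<dots> \<le> real q * (2 * B * (2 / (\<epsilon> * (real q / 2)))\<^sup>2)"
      using assms(2) q0 3 q by (intro mult_left_mono second_difference_bound_sector_nbhd[OF f B]) auto
    also have "\<dots> = coefficient_bound \<epsilon> N q * B"
      using q 3 assms(2) by (simp add: coefficient_bound_def field_simps power2_eq_square)
    finally show ?thesis .
  qed
qed

lemma sum_PiE_insert:
  fixes h :: "('i \<Rightarrow> 'b) \<Rightarrow> 'c::comm_monoid_add"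
  assumes "i \<notin> J"
  shows "(\<Sum>x\<in>PiE (insert i J) X. h x) = (\<Sum>x\<in>PiE J X. \<Sum>y\<in>X i. h (x(i := y)))"
proof -
  have "(\<Sum>x\<in>PiE (insert i J) X. h x) = (\<Sum>(y, x)\<in>X i \<times> PiE J X. h (x(i := y)))"
    unfolding PiE_insert_eq
    by (subst sum.reindex) (use assms in \<open>auto intro!: inj_combinator sum.cong\<close>)
  also have "\<dots> = (\<Sum>y\<in>X i. \<Sum>x\<in>PiE J X. h (x(i := y)))"
    by (rule sum.cartesian_product[symmetric])
  also have "\<dots> = (\<Sum>x\<in>PiE J X. \<Sum>y\<in>X i. h (x(i := y)))"
    by (rule sum.swap)
  finally show ?thesis .
qed

text \<open>
  One-dimensional functionals that are bounded on bounded holomorphic functions tensorize: applying one of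
  them in its own variable preserves holomorphy and boundedness in the other variables, so the set of variables
  can be exhausted by induction.
\<close>

lemma tensor_functional_bound:
  fixes G :: "('i \<Rightarrow> complex) \<Rightarrow> complex" and a :: "'i \<Rightarrow> nat \<Rightarrow> complex"
  assumes "finite J"
    and "\<And>j. j \<in> J \<Longrightarrow> of_nat ` X j \<subseteq> \<Omega> j \<and> \<Omega> j \<noteq> {}"
    and "\<And>j f B. \<lbrakk>j \<in> J; f holomorphic_on \<Omega> j; \<And>z. z \<in> \<Omega> j \<Longrightarrow> norm (f z) \<le> B\<rbrakk>
           \<Longrightarrow> norm (\<Sum>x\<in>X j. a j x * f (of_nat x)) \<le> w j * B"
    and "\<And>z j. \<lbrakk>\<And>i. i \<in> J \<Longrightarrow> z i \<in> \<Omega> i; j \<in> J\<rbrakk> \<Longrightarrow> (\<lambda>s. G (z(j := s))) holomorphic_on \<Omega> j"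
    and "\<And>z. (\<And>i. i \<in> J \<Longrightarrow> z i \<in> \<Omega> i) \<Longrightarrow> norm (G z) \<le> B"
  shows "norm (\<Sum>x\<in>PiE J X. (\<Prod>j\<in>J. a j (x j)) * G (\<lambda>j. of_nat (x j))) \<le> (\<Prod>j\<in>J. w j) * B"
  using assms
proof (induction J arbitrary: G B rule: finite_induct)
  case empty
  then show ?case by simp
next
  case (insert i J)
  define G' where "G' = (\<lambda>z. \<Sum>y\<in>X i. a i y * G (z(i := of_nat y)))"
  have upd: "(\<lambda>j. of_nat ((x(i := y)) j)) = (\<lambda>j. of_nat (x j) :: complex)(i := of_nat y)"
    for x :: "'i \<Rightarrow> nat" and y by auto
  have "(\<Sum>x\<in>PiE (insert i J) X. (\<Prod>j\<in>insert i J. a j (x j)) * G (\<lambda>j. of_nat (x j)))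
      = (\<Sum>x\<in>PiE J X. (\<Prod>j\<in>J. a j (x j)) * G' (\<lambda>j. of_nat (x j)))"
    unfolding sum_PiE_insert[OF insert.hyps(2)]
  proof (rule sum.cong)
    fix x
    have "(\<Prod>j\<in>insert i J. a j ((x(i := y)) j)) = a i y * (\<Prod>j\<in>J. a j (x j))" for y
    proof -
      have "(\<Prod>j\<in>J. a j ((x(i := y)) j)) = (\<Prod>j\<in>J. a j (x j))"
        by (rule prod.cong) (use insert.hyps(2) in auto)
      then show ?thesis using insert.hyps by simp
    qed
    then show "(\<Sum>y\<in>X i. (\<Prod>j\<in>insert i J. a j ((x(i := y)) j)) * G (\<lambda>j. of_nat ((x(i := y)) j)))
        = (\<Prod>j\<in>J. a j (x j)) * G' (\<lambda>j. of_nat (x j))"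
      unfolding upd G'_def by (simp add: sum_distrib_left mult_ac)
  qed simp
  moreover have "norm (\<Sum>x\<in>PiE J X. (\<Prod>j\<in>J. a j (x j)) * G' (\<lambda>j. of_nat (x j)))
      \<le> (\<Prod>j\<in>J. w j) * (w i * B)"
  proof (rule insert.IH)
    show "of_nat ` X j \<subseteq> \<Omega> j \<and> \<Omega> j \<noteq> {}" if "j \<in> J" for j
      using that insert.prems(1)[of j] by simp
    show "norm (\<Sum>x\<in>X j. a j x * f (of_nat x)) \<le> w j * B'"
      if "j \<in> J" "f holomorphic_on \<Omega> j" "\<And>z. z \<in> \<Omega> j \<Longrightarrow> norm (f z) \<le> B'" for j f B'
      using that by (intro insert.prems(2)) auto
    show "(\<lambda>s. G' (z(j := s))) holomorphic_on \<Omega> j"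
      if z: "\<And>k. k \<in> J \<Longrightarrow> z k \<in> \<Omega> k" and j: "j \<in> J" for z j
    proof -
      have ij: "j \<noteq> i" using j insert.hyps(2) by auto
      show ?thesis
        unfolding G'_def fun_upd_twist[OF ij]
      proof (intro holomorphic_on_sum holomorphic_on_mult holomorphic_on_const insert.prems(3))
        fix y k assume "y \<in> X i" "k \<in> insert i J"
        then show "(z(i := of_nat y)) k \<in> \<Omega> k"
          using z insert.prems(1)[of i] by auto
      qed (use j in auto)
    qed
    show "norm (G' z) \<le> w i * B" if z: "\<And>k. k \<in> J \<Longrightarrow> z k \<in> \<Omega> k" for z
      unfolding G'_def
    proof (rule insert.prems(2)[of i "\<lambda>s. G (z(i := s))"])
      obtain s0 where s0: "s0 \<in> \<Omega> i" using insert.prems(1)[of i] by auto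
      have "(\<lambda>s. G ((z(i := s0))(i := s))) holomorphic_on \<Omega> i"
        using z s0 by (intro insert.prems(3)) auto
      then show "(\<lambda>s. G (z(i := s))) holomorphic_on \<Omega> i" by simp
      show "norm (G (z(i := s))) \<le> B" if "s \<in> \<Omega> i" for s
        using that z by (intro insert.prems(4)) auto
    qed simp
  qed
  ultimately show ?case using insert.hyps by (simp add: mult_ac)
qed

lemma sin_ge_half:
  fixes x :: real
  assumes "0 \<le> x" "x \<le> pi / 2"
  shows "x / 2 \<le> sin x"
proof (cases "x \<le> pi / 3")
  case True
  have "sin 0 - 0 / 2 \<le> sin x - x / 2"
  proof (rule DERIV_nonneg_imp_nondecreasing[OF assms(1)])
    fix t :: real assume t: "0 \<le> t" "t \<le> x"
    have "cos (pi / 3) \<le> cos t" using t True by (intro cos_monotone_0_pi_le) auto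
    then have "0 \<le> cos t - 1 / 2" by (simp add: cos_60)
    moreover have "((\<lambda>t. sin t - t / 2) has_real_derivative cos t - 1 / 2) (at t)"
      by (auto intro!: derivative_eq_intros)
    ultimately show "\<exists>y. ((\<lambda>t. sin t - t / 2) has_real_derivative y) (at t) \<and> 0 \<le> y" by blast
  qed
  then show ?thesis by simp
next
  case False
  have "sin (pi / 3) \<le> sin x" using False assms by (intro sin_monotone_2pi_le) auto
  moreover have "8 / 5 < sqrt 3" by (rule real_less_rsqrt) (simp add: power2_eq_square)
  ultimately show ?thesis using assms pi_less_4 pi_approx by (simp add: sin_60)
qed

text \<open>
  On the relevant discs \<open>cmod (cos w) \<le> exp 2 \<le> 9\<close>, so \<open>sin\<close> moves by at most \<open>9 \<epsilon> x\<close> away from its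
  value at the centre, which is at least \<open>x / 2\<close>.
\<close>

lemma sin_near_real_axis:
  fixes z :: complex
  assumes x: "0 < x" "x \<le> pi / 2" and \<epsilon>: "0 < \<epsilon>" "\<epsilon> \<le> 1 / 36" and z: "norm (z - of_real x) \<le> \<epsilon> * x"
  shows "x / 4 \<le> Re (sin z)" and "\<bar>Im (sin z)\<bar> \<le> 9 * \<epsilon> * x"
proof -
  have "norm (sin z - sin (of_real x)) \<le> 9 * norm (z - of_real x)"
  proof (rule field_differentiable_bound[where S = "cball (of_real x) (\<epsilon> * x)" and f' = cos])
    fix w :: complex assume w: "w \<in> cball (of_real x) (\<epsilon> * x)"
    show "(sin has_field_derivative cos w) (at w within cball (of_real x) (\<epsilon> * x))"
      by (auto intro!: derivative_eq_intros)
    have "norm w \<le> norm (of_real x :: complex) + norm (of_real x - w)"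
      using norm_triangle_sub[of w "of_real x"] by (simp add: norm_minus_commute)
    also have "\<dots> \<le> x + \<epsilon> * x" using w x by (simp add: dist_norm)
    also have "\<epsilon> * x \<le> (1 / 36) * x" using \<epsilon> x by (intro mult_right_mono) auto
    also have "x + (1 / 36) * x \<le> 2" using x pi_approx by simp
    finally have "norm w \<le> 2" by simp
    then have "norm (cos w) \<le> exp 2" using norm_cos_le[of w] by (meson exp_le_cancel_iff order_trans)
    also have "exp (2::real) = exp 1 * exp 1" by (simp flip: exp_add)
    also have "\<dots> \<le> 3 * 3" using exp_le by (intro mult_mono) auto
    finally show "norm (cos w) \<le> 9" by simp
  qed (use x \<epsilon> z in \<open>auto simp: dist_norm norm_minus_commute\<close>)
  also have "\<dots> \<le> 9 * (\<epsilon> * x)" using z by simp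
  finally have d: "norm (sin z - of_real (sin x)) \<le> 9 * \<epsilon> * x" by (simp add: sin_of_real)
  from abs_Im_le_cmod[of "sin z - of_real (sin x)"] d
  show "\<bar>Im (sin z)\<bar> \<le> 9 * \<epsilon> * x" by simp
  have "9 * \<epsilon> * x \<le> 9 * (1 / 36) * x" using \<epsilon> x by (intro mult_right_mono) auto
  also have "9 * (1 / 36) * x = x / 4" by simp
  finally have "norm (sin z - of_real (sin x)) \<le> x / 4" using d by (rule order_trans[rotated])
  moreover have "sin x - Re (sin z) \<le> norm (sin z - of_real (sin x))"
    using abs_Re_le_cmod[of "sin z - of_real (sin x)"] by simp
  moreover have "x / 2 \<le> sin x" using sin_ge_half[of x] x by simp
  ultimately show "x / 4 \<le> Re (sin z)"
    by linarith
qed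

section \<open>Stability of the method on a sector\<close>

text \<open>
  Described through logarithms, so that the arguments of products simply add.
\<close>

definition sector :: "real \<Rightarrow> complex set" where
  "sector \<alpha> = {exp l | l. \<bar>Im l\<bar> \<le> \<alpha>}"

lemma Re_sector_ge:
  assumes "z \<in> sector \<alpha>" "\<alpha> \<le> pi / 3"
  shows "norm z / 2 \<le> Re z"
proof -
  obtain l where l: "z = exp l" "\<bar>Im l\<bar> \<le> \<alpha>" using assms(1) by (auto simp: sector_def)
  have "cos (pi / 3) \<le> cos \<bar>Im l\<bar>" using l(2) assms(2) by (intro cos_monotone_0_pi_le) auto
  then have "1 / 2 \<le> cos (Im l)" by (simp add: cos_60)
  then have "exp (Re l) * (1 / 2) \<le> exp (Re l) * cos (Im l)" by (intro mult_left_mono) auto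
  then show ?thesis by (simp add: l(1) Re_exp)
qed

lemma sector_nonzero: "z \<in> sector \<alpha> \<Longrightarrow> z \<noteq> 0"
  by (auto simp: sector_def)

text \<open>
  The arguments add up to at most \<open>(card X + 1) \<alpha> \<le> \<pi> / 2\<close>.
\<close>

lemma Re_prod_cnj_sector_nonneg:
  assumes "finite X" "\<And>i. i \<in> X \<Longrightarrow> z i \<in> sector \<alpha>" "y \<in> sector \<alpha>" "(real (card X) + 1) * \<alpha> \<le> pi / 2"
  shows "0 \<le> Re ((\<Prod>i\<in>X. z i) * cnj y)"
proof -
  have "\<forall>i\<in>X. \<exists>l. z i = exp l \<and> \<bar>Im l\<bar> \<le> \<alpha>" using assms(2) by (auto simp: sector_def)
  then obtain l where l: "\<And>i. i \<in> X \<Longrightarrow> z i = exp (l i) \<and> \<bar>Im (l i)\<bar> \<le> \<alpha>" by metis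
  obtain k where k: "y = exp k" "\<bar>Im k\<bar> \<le> \<alpha>" using assms(3) by (auto simp: sector_def)
  have "(\<Prod>i\<in>X. z i) * cnj y = exp ((\<Sum>i\<in>X. l i) + cnj k)"
    using l by (simp add: exp_add exp_sum[OF assms(1)] k(1) exp_cnj)
  moreover have "\<bar>Im ((\<Sum>i\<in>X. l i) + cnj k)\<bar> \<le> pi / 2"
  proof -
    have "\<bar>Im ((\<Sum>i\<in>X. l i) + cnj k)\<bar> \<le> \<bar>\<Sum>i\<in>X. Im (l i)\<bar> + \<bar>Im k\<bar>" by simp
    also have "\<bar>\<Sum>i\<in>X. Im (l i)\<bar> \<le> (\<Sum>i\<in>X. \<bar>Im (l i)\<bar>)" by (rule sum_abs)
    also have "\<dots> \<le> real (card X) * \<alpha>" by (rule sum_bounded_above) (use l in auto)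
    finally show ?thesis using k(2) assms(4) by (simp add: algebra_simps)
  qed
  ultimately show ?thesis
    by (simp only: Re_exp abs_le_iff) (intro mult_nonneg_nonneg cos_ge_zero exp_ge_zero; linarith)
qed

text \<open>
  With \<open>S = \<Sum>j. z j\<close> and \<open>P = \<Prod>j. 1 + z j\<close>, the bound \<open>cmod (P - 2 S) \<le> cmod P\<close> is equivalent to
  \<open>(cmod S)\<^sup>2 \<le> Re (P * cnj S)\<close>. Expanding \<open>P\<close> over subsets, the singletons contribute exactly
  \<open>(cmod S)\<^sup>2\<close>, and every other subset contributes a nonnegative real part if the sector is narrow enough.
\<close>

lemma amf_symbol_sector_bound:
  fixes z :: "'i \<Rightarrow> complex"
  assumes J: "finite J" "J \<noteq> {}" and z: "\<And>j. j \<in> J \<Longrightarrow> z j \<in> sector \<alpha>"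
    and \<alpha>: "0 \<le> \<alpha>" "(real (card J) + 1) * \<alpha> \<le> pi / 2"
  shows "(\<Prod>j\<in>J. 1 + z j) \<noteq> 0" and "norm (1 - 2 * (\<Sum>j\<in>J. z j) / (\<Prod>j\<in>J. 1 + z j)) \<le> 1"
proof -
  define S where "S = (\<Sum>j\<in>J. z j)"
  define P where "P = (\<Prod>j\<in>J. 1 + z j)"
  have cJ: "1 \<le> card J" using J by (simp add: Suc_le_eq card_gt_0_iff)
  have "2 * \<alpha> \<le> (real (card J) + 1) * \<alpha>" using cJ \<alpha>(1) by (intro mult_right_mono) auto
  with \<alpha>(2) have a3: "\<alpha> \<le> pi / 3" using pi_gt_zero by linarith
  have "0 < Re (z j)" if "j \<in> J" for j
  proof -
    have "0 < norm (z j)" using sector_nonzero[OF z[OF that]] by simp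
    then show ?thesis using Re_sector_ge[OF z[OF that] a3] by linarith
  qed
  then have "0 < Re S" unfolding S_def Re_sum using J by (intro sum_pos) auto
  then have S0: "S \<noteq> 0" by auto
  have nonneg: "0 \<le> Re ((\<Prod>i\<in>X. z i) * cnj S)" if "X \<in> Pow J" for X
  proof -
    have X: "X \<subseteq> J" "finite X" using that J finite_subset by auto
    have "real (card X) \<le> real (card J)" using X J by (simp add: card_mono)
    then have "(real (card X) + 1) * \<alpha> \<le> (real (card J) + 1) * \<alpha>" using \<alpha>(1) by (intro mult_right_mono) auto
    then have "0 \<le> (\<Sum>j\<in>J. Re ((\<Prod>i\<in>X. z i) * cnj (z j)))"
      using \<alpha>(2) X z by (intro sum_nonneg Re_prod_cnj_sector_nonneg[where \<alpha> = \<alpha>]) auto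
    also have "\<dots> = Re ((\<Prod>i\<in>X. z i) * cnj S)"
      by (simp only: S_def cnj_sum sum_distrib_left Re_sum)
    finally show ?thesis .
  qed
  have "P = (\<Sum>X\<in>Pow J. \<Prod>i\<in>X. z i)"
    unfolding P_def using prod_add[OF J(1), of z "\<lambda>_. 1"] by (simp add: add.commute)
  then have "Re (P * cnj S) = (\<Sum>X\<in>Pow J. Re ((\<Prod>i\<in>X. z i) * cnj S))"
    by (simp only: sum_distrib_right Re_sum)
  also have "\<dots> \<ge> (\<Sum>X\<in>(\<lambda>i. {i}) ` J. Re ((\<Prod>i\<in>X. z i) * cnj S))"
    by (rule sum_mono2) (use J nonneg in auto)
  also have "(\<Sum>X\<in>(\<lambda>i. {i}) ` J. Re ((\<Prod>i\<in>X. z i) * cnj S)) = Re (S * cnj S)"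
    by (subst sum.reindex) (auto simp: S_def sum_distrib_right simp del: cnj_sum)
  finally have ge: "(norm S)\<^sup>2 \<le> Re (P * cnj S)" by (simp add: complex_norm_square[symmetric] flip: of_real_power)
  with S0 show "(\<Prod>j\<in>J. 1 + z j) \<noteq> 0" unfolding P_def[symmetric] by auto
  then have P0: "P \<noteq> 0" by (simp add: P_def)
  have "(norm (P - 2 * S))\<^sup>2 = (norm P)\<^sup>2 - 4 * Re (P * cnj S) + 4 * (norm S)\<^sup>2"
    unfolding cmod_power2 by (simp add: power2_eq_square algebra_simps)
  also have "\<dots> \<le> (norm P)\<^sup>2" using ge by simp
  finally have "norm (P - 2 * S) \<le> norm P" by (rule power2_le_imp_le) simp
  moreover have "1 - 2 * S / P = (P - 2 * S) / P" using P0 by (simp add: field_simps)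
  ultimately show "norm (1 - 2 * (\<Sum>j\<in>J. z j) / (\<Prod>j\<in>J. 1 + z j)) \<le> 1"
    unfolding S_def[symmetric] P_def[symmetric] using P0 by (simp add: norm_divide divide_le_eq_1)
qed

text \<open>
  At an integer \<open>w \<in> {1..N}\<close> this is the \<open>w\<close>-th eigenvalue of \<open>- b L\<close> for the one-dimensional difference
  matrix \<open>L\<close>. The type is left open because the frequency \<open>w\<close> also takes complex values.
\<close>

definition eigenvalue :: "nat \<Rightarrow> real \<Rightarrow> 'a::{real_normed_field,banach} \<Rightarrow> 'a" where
  "eigenvalue N b w = of_real (4 * b * (real N + 1)\<^sup>2) * (sin (of_real (pi / (2 * (real N + 1))) * w))\<^sup>2"

lemma eigenvalue_of_real: "eigenvalue N b (complex_of_real x) = of_real (eigenvalue N b x)"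
  unfolding eigenvalue_def of_real_mult[symmetric] sin_of_real by simp

text \<open>
  The function is a positive multiple of \<open>(sin (c w))\<^sup>2\<close>. The value of the sine has polar angle at most
  \<open>36 \<epsilon>\<close> by \<open>sin_near_real_axis\<close>, and squaring doubles the angle.
\<close>

lemma eigenvalue_sector:
  assumes "0 < b" "0 < a" "0 < \<epsilon>" "\<epsilon> \<le> 1 / 36" and w: "w \<in> sector_nbhd \<epsilon> a (real N + 1)"
  shows "eigenvalue N b w \<in> sector (72 * \<epsilon>)" and "b * a\<^sup>2 / 2 \<le> norm (eigenvalue N b w)"
proof -
  obtain x where x: "x \<in> {a..real N + 1}" "norm (w - of_real x) < \<epsilon> * x"
    using w by (auto simp: sector_nbhd_def dist_norm norm_minus_commute)
  define c where "c = pi / (2 * (real N + 1))"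
  have c: "0 < c" by (simp add: c_def)
  define s where "s = sin (of_real c * w)"
  have "norm (of_real c * w - of_real (c * x)) = norm (of_real c * (w - of_real x))"
    by (simp add: algebra_simps)
  also have "\<dots> = c * norm (w - of_real x)" using c by (simp add: norm_mult)
  also have "\<dots> \<le> \<epsilon> * (c * x)" using c x by simp
  finally have near: "norm (of_real c * w - of_real (c * x)) \<le> \<epsilon> * (c * x)" .
  have cx: "0 < c * x" "c * x \<le> pi / 2" 
  proof -
    show "0 < c * x" using c x assms(2) by simp
    have "c * x \<le> c * (real N + 1)" using c x by simp
    also have "\<dots> = pi / 2" by (simp add: c_def field_simps)
    finally show "c * x \<le> pi / 2" .
  qed
  note sn = sin_near_real_axis[OF cx assms(3,4) near, folded s_def]
  have Re0: "0 < Re s" using sn(1) cx(1) by linarith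
  have C: "0 < 4 * b * (real N + 1)\<^sup>2" using assms(1) by simp
  have ev: "eigenvalue N b w = of_real (4 * b * (real N + 1)\<^sup>2) * s\<^sup>2"
    by (simp add: eigenvalue_def s_def c_def)
  show "eigenvalue N b w \<in> sector (72 * \<epsilon>)"
  proof -
    have "s \<noteq> 0" using Re0 by auto
    then have "eigenvalue N b w = exp (2 * Ln s + of_real (ln (4 * b * (real N + 1)\<^sup>2)))"
    proof -
      have "exp (of_real (ln (4 * b * (real N + 1)\<^sup>2))) = complex_of_real (4 * b * (real N + 1)\<^sup>2)"
        using C by (simp only: exp_of_real exp_ln)
      then show ?thesis
        using \<open>s \<noteq> 0\<close> unfolding ev by (simp only: exp_add exp_double exp_Ln[OF \<open>s \<noteq> 0\<close>]) (simp only: mult.commute)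
    qed
    moreover have "\<bar>Im (Ln s)\<bar> \<le> 36 * \<epsilon>"
    proof -
      have "\<bar>Im (Ln s)\<bar> = \<bar>arctan (Im s / Re s)\<bar>"
        using Re0 \<open>s \<noteq> 0\<close> by (metis Arg_eq_Im_Ln arg_conv_arctan)
      also have "\<dots> \<le> \<bar>Im s / Re s\<bar>" by (rule abs_arctan_le)
      also have "\<dots> = \<bar>Im s\<bar> / Re s" using Re0 by simp
      also have "\<dots> \<le> (9 * \<epsilon> * (c * x)) / (c * x / 4)"
        using sn cx assms(3) by (intro frac_le) auto
      also have "\<dots> = 36 * \<epsilon>" 
      proof -
        have "y \<noteq> 0 \<Longrightarrow> 9 * \<epsilon> * y / (y / 4) = 36 * \<epsilon>" for y :: real by simp
        then show ?thesis using cx(1) by (metis less_irrefl)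
      qed
      finally show ?thesis .
    qed
    ultimately show ?thesis unfolding sector_def by fastforce
  qed
  have "c * x / 4 \<le> norm s" using sn(1) complex_Re_le_cmod[of s] by linarith
  then have "(c * x / 4)\<^sup>2 \<le> (norm s)\<^sup>2" using cx by (intro power_mono) auto
  then have "4 * b * (real N + 1)\<^sup>2 * (c * x / 4)\<^sup>2 \<le> norm (eigenvalue N b w)"
    unfolding ev norm_mult norm_power norm_of_real using C by (simp only: abs_of_pos mult_left_mono)
  moreover have "4 * b * (real N + 1)\<^sup>2 * (c * x / 4)\<^sup>2 = b * (x\<^sup>2 * (pi\<^sup>2 / 16))"
  proof -
    have "((real N + 1) * c)\<^sup>2 = (pi / 2)\<^sup>2"
      unfolding c_def by (rule arg_cong[where f = "\<lambda>y. y\<^sup>2"]) (simp add: divide_simps)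
    then have e1: "(real N + 1)\<^sup>2 * c\<^sup>2 = pi\<^sup>2 / 4" by (simp only: power_mult_distrib power_divide) simp
    have e2: "4 * b * (real N + 1)\<^sup>2 * (c * x / 4)\<^sup>2 = b * x\<^sup>2 / 4 * ((real N + 1)\<^sup>2 * c\<^sup>2)"
      by (simp only: power_mult_distrib power_divide) simp
    show ?thesis unfolding e2 e1 by simp
  qed
  moreover have "b * (a\<^sup>2 * (1 / 2)) \<le> b * (x\<^sup>2 * (pi\<^sup>2 / 16))"
  proof -
    have "3 ^ 2 \<le> pi\<^sup>2" using pi_approx by (intro power_mono) auto
    then show ?thesis using assms(1,2) x(1) by (intro mult_mono power_mono) auto
  qed
  ultimately show "b * a\<^sup>2 / 2 \<le> norm (eigenvalue N b w)" by simp
qed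

section \<open>Multipliers of the tensor sine transform\<close>

definition mode :: "nat \<Rightarrow> (nat \<Rightarrow> nat) \<Rightarrow> (nat \<Rightarrow> nat) \<Rightarrow> (nat \<Rightarrow> nat) \<Rightarrow> real" where
  "mode m N p k = (\<Prod>j\<in>{1..m}. sin (real (p j) * real (k j) * (pi / real (Suc (N j)))))"

definition sine_coeff :: "nat \<Rightarrow> (nat \<Rightarrow> nat) \<Rightarrow> ((nat \<Rightarrow> nat) \<Rightarrow> real) \<Rightarrow> (nat \<Rightarrow> nat) \<Rightarrow> real" where
  "sine_coeff m N v p = (\<Prod>j\<in>{1..m}. 2 / real (Suc (N j))) * (\<Sum>l\<in>grid m N. mode m N p l * v l)"

definition sine_synth :: "nat \<Rightarrow> (nat \<Rightarrow> nat) \<Rightarrow> ((nat \<Rightarrow> nat) \<Rightarrow> real) \<Rightarrow> (nat \<Rightarrow> nat) \<Rightarrow> real" where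
  "sine_synth m N c k = (\<Sum>p\<in>grid m N. c p * mode m N p k)"

lemma finite_grid [simp]: "finite (grid m N)"
  by (simp add: grid_def finite_PiE)

lemma prod_of_bool_grid:
  fixes m :: nat
  assumes "k \<in> PiE {1..m} A" "l \<in> PiE {1..m} B"
  shows "(\<Prod>j\<in>{1..m}. of_bool (k j = l j) :: real) = of_bool (k = l)"
proof (cases "k = l")
  case False
  then obtain j where "j \<in> {1..m}" "k j \<noteq> l j" using assms by (metis PiE_ext PiE_iff ext extensional_arb)
  then show ?thesis using False by (auto intro!: prod_zero)
qed simp

lemma tensor_multiplier_kernel:
  "sine_synth m N (\<lambda>p. (\<Prod>j\<in>{1..m}. h j (p j)) * sine_coeff m N v p) k
   = (\<Sum>l\<in>grid m N. v l * (\<Prod>j\<in>{1..m}. sine_kernel (N j) (h j) (k j) (l j)))"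
proof -
  define s where "s = (\<lambda>j p k. sin (real p * real k * (pi / real (Suc (N j)))))"
  have "sine_synth m N (\<lambda>p. (\<Prod>j\<in>{1..m}. h j (p j)) * sine_coeff m N v p) k
    = (\<Sum>p\<in>grid m N. \<Sum>l\<in>grid m N. v l *
        (\<Prod>j\<in>{1..m}. 2 / real (Suc (N j)) * h j (p j) * (s j (p j) (k j) * s j (p j) (l j))))"
    unfolding sine_synth_def sine_coeff_def mode_def s_def
    by (simp only: sum_distrib_left sum_distrib_right prod.distrib mult_ac)
  also have "\<dots> = (\<Sum>l\<in>grid m N. v l * (\<Sum>p\<in>grid m N.
        (\<Prod>j\<in>{1..m}. 2 / real (Suc (N j)) * h j (p j) * (s j (p j) (k j) * s j (p j) (l j)))))"
    by (subst sum.swap) (simp add: sum_distrib_left)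
  also have "\<dots> = (\<Sum>l\<in>grid m N. v l * (\<Prod>j\<in>{1..m}. sine_kernel (N j) (h j) (k j) (l j)))"
    unfolding grid_def sine_kernel_def s_def by (subst prod_sum_PiE) auto
  finally show ?thesis .
qed

lemma sine_inversion:
  assumes "k \<in> grid m N"
  shows "sine_synth m N (sine_coeff m N v) k = v k"
proof -
  have "sine_synth m N (sine_coeff m N v) k
      = (\<Sum>l\<in>grid m N. v l * (\<Prod>j\<in>{1..m}. sine_kernel (N j) (\<lambda>_. 1) (k j) (l j)))"
    using tensor_multiplier_kernel[of m N "\<lambda>_ _. 1" v k] by simp
  also have "\<dots> = (\<Sum>l\<in>grid m N. if l = k then v l else 0)"
  proof (rule sum.cong)
    fix l assume l: "l \<in> grid m N"
    have "(\<Prod>j\<in>{1..m}. sine_kernel (N j) (\<lambda>_. 1) (k j) (l j)) = (\<Prod>j\<in>{1..m}. of_bool (k j = l j))"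
      using assms l by (intro prod.cong sine_kernel_one) (auto simp: grid_def PiE_iff)
    also have "\<dots> = of_bool (k = l)"
      using assms l unfolding grid_def by (rule prod_of_bool_grid)
    finally show "v l * (\<Prod>j\<in>{1..m}. sine_kernel (N j) (\<lambda>_. 1) (k j) (l j)) = (if l = k then v l else 0)"
      by auto
  qed simp
  also have "\<dots> = v k" using assms by simp
  finally show ?thesis .
qed

text \<open>
  Summed over \<open>l\<close>, the product kernel is a product of one-dimensional sums, each at most \<open>1\<close>.
\<close>

lemma tensor_fejer_bound:
  assumes k: "k \<in> grid m N" and q: "q \<in> PiE {1..m} (\<lambda>j. {2..N j + 2})"
    and v: "\<And>l. l \<in> grid m N \<Longrightarrow> \<bar>v l\<bar> \<le> W"
  shows "\<bar>sine_synth m N (\<lambda>p. (\<Prod>j\<in>{1..m}. fejer_symbol (N j) (q j) (p j)) * sine_coeff m N v p) k\<bar> \<le> W"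
proof -
  have "0 \<le> W" using v[OF k] by simp
  have "\<bar>sine_synth m N (\<lambda>p. (\<Prod>j\<in>{1..m}. fejer_symbol (N j) (q j) (p j)) * sine_coeff m N v p) k\<bar>
     \<le> (\<Sum>l\<in>grid m N. \<bar>v l * (\<Prod>j\<in>{1..m}. sine_kernel (N j) (fejer_symbol (N j) (q j)) (k j) (l j))\<bar>)"
    unfolding tensor_multiplier_kernel[where h = "\<lambda>j. fejer_symbol (N j) (q j)"] by (rule sum_abs)
  also have "\<dots> \<le> (\<Sum>l\<in>grid m N. W * (\<Prod>j\<in>{1..m}. \<bar>sine_kernel (N j) (fejer_symbol (N j) (q j)) (k j) (l j)\<bar>))"
    unfolding abs_mult abs_prod using v by (intro sum_mono mult_right_mono prod_nonneg) auto
  also have "\<dots> = W * (\<Prod>j\<in>{1..m}. \<Sum>l=1..N j. \<bar>sine_kernel (N j) (fejer_symbol (N j) (q j)) (k j) l\<bar>)"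
    unfolding sum_distrib_left[symmetric] grid_def by (subst prod_sum_PiE) auto
  also have "\<dots> \<le> W * 1"
    using k q \<open>0 \<le> W\<close>
    by (intro mult_left_mono prod_le_1 conjI sum_nonneg fejer_multiplier_bound) (auto simp: grid_def PiE_iff)
  finally show ?thesis by simp
qed

text \<open>
  The mixed second difference of the symbol \<open>F\<close>: \<open>diff_weight\<close> applied in every direction.
\<close>

definition fejer_coeff :: "nat \<Rightarrow> (nat \<Rightarrow> nat) \<Rightarrow> ((nat \<Rightarrow> nat) \<Rightarrow> real) \<Rightarrow> (nat \<Rightarrow> nat) \<Rightarrow> real" where
  "fejer_coeff m N F q =
     (\<Sum>x\<in>PiE {1..m} (\<lambda>j. {1..N j + 1}). (\<Prod>j\<in>{1..m}. diff_weight (N j) (q j) (x j)) * F x)"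

lemma tensor_fejer_expansion:
  assumes p: "p \<in> grid m N"
  shows "F p = (\<Sum>q\<in>PiE {1..m} (\<lambda>j. {2..N j + 2}).
           fejer_coeff m N F q * (\<Prod>j\<in>{1..m}. fejer_symbol (N j) (q j) (p j)))"
proof -
  have "(\<Sum>q\<in>PiE {1..m} (\<lambda>j. {2..N j + 2}).
           fejer_coeff m N F q * (\<Prod>j\<in>{1..m}. fejer_symbol (N j) (q j) (p j)))
     = (\<Sum>q\<in>PiE {1..m} (\<lambda>j. {2..N j + 2}). \<Sum>x\<in>PiE {1..m} (\<lambda>j. {1..N j + 1}).
           F x * (\<Prod>j\<in>{1..m}. fejer_symbol (N j) (q j) (p j) * diff_weight (N j) (q j) (x j)))"
    unfolding fejer_coeff_def sum_distrib_right prod.distrib by (simp add: mult_ac)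
  also have "\<dots> = (\<Sum>x\<in>PiE {1..m} (\<lambda>j. {1..N j + 1}). F x * (\<Sum>q\<in>PiE {1..m} (\<lambda>j. {2..N j + 2}).
           (\<Prod>j\<in>{1..m}. fejer_symbol (N j) (q j) (p j) * diff_weight (N j) (q j) (x j))))"
    by (subst sum.swap) (simp add: sum_distrib_left)
  also have "\<dots> = (\<Sum>x\<in>PiE {1..m} (\<lambda>j. {1..N j + 1}). if x = p then F x else 0)"
  proof (rule sum.cong)
    fix x assume x: "x \<in> PiE {1..m} (\<lambda>j. {1..N j + 1})"
    have "(\<Sum>q\<in>PiE {1..m} (\<lambda>j. {2..N j + 2}).
           (\<Prod>j\<in>{1..m}. fejer_symbol (N j) (q j) (p j) * diff_weight (N j) (q j) (x j)))
        = (\<Prod>j\<in>{1..m}. \<Sum>q=2..N j + 2. fejer_symbol (N j) q (p j) * diff_weight (N j) q (x j))"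
      by (subst prod_sum_PiE) auto
    also have "\<dots> = (\<Prod>j\<in>{1..m}. of_bool (p j = x j))"
      using p x by (intro prod.cong fejer_symbol_expansion) (auto simp: grid_def PiE_iff)
    also have "\<dots> = of_bool (p = x)"
      using p x unfolding grid_def by (rule prod_of_bool_grid)
    finally show "F x * (\<Sum>q\<in>PiE {1..m} (\<lambda>j. {2..N j + 2}).
           (\<Prod>j\<in>{1..m}. fejer_symbol (N j) (q j) (p j) * diff_weight (N j) (q j) (x j)))
        = (if x = p then F x else 0)" by auto
  qed simp
  also have "\<dots> = F p"
  proof -
    have "p \<in> PiE {1..m} (\<lambda>j. {1..N j + 1})" using p by (force simp: grid_def PiE_iff)
    then show ?thesis by (simp add: finite_PiE)
  qed
  finally show ?thesis by simp
qed

text \<open>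
  By the expansion into Fejer symbols the operator is a linear combination of maximum-norm contractions.
\<close>

lemma multiplier_max_norm_bound:
  assumes k: "k \<in> grid m N" and v: "\<And>l. l \<in> grid m N \<Longrightarrow> \<bar>v l\<bar> \<le> W"
  shows "\<bar>sine_synth m N (\<lambda>p. F p * sine_coeff m N v p) k\<bar>
     \<le> (\<Sum>q\<in>PiE {1..m} (\<lambda>j. {2..N j + 2}). \<bar>fejer_coeff m N F q\<bar>) * W"
proof -
  let ?Q = "PiE {1..m} (\<lambda>j. {2..N j + 2})"
  have "sine_synth m N (\<lambda>p. F p * sine_coeff m N v p) k
      = sine_synth m N (\<lambda>p. (\<Sum>q\<in>?Q. fejer_coeff m N F q * (\<Prod>j\<in>{1..m}. fejer_symbol (N j) (q j) (p j)))
           * sine_coeff m N v p) k"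
    unfolding sine_synth_def using tensor_fejer_expansion[of _ m N F] by (intro sum.cong) auto
  also have "\<dots> = (\<Sum>q\<in>?Q. fejer_coeff m N F q *
       sine_synth m N (\<lambda>p. (\<Prod>j\<in>{1..m}. fejer_symbol (N j) (q j) (p j)) * sine_coeff m N v p) k)"
    unfolding sine_synth_def sum_distrib_right sum_distrib_left by (subst sum.swap) (simp add: mult_ac)
  finally have eq: "sine_synth m N (\<lambda>p. F p * sine_coeff m N v p) k = \<dots>" .
  show ?thesis
    unfolding eq sum_distrib_right
    using tensor_fejer_bound[OF k _ v]
    by (intro order_trans[OF sum_abs] sum_mono) (auto simp: abs_mult intro!: mult_left_mono)
qed

section \<open>The uniform maximum-norm bound\<close>

text \<open>
  The eigenvalue of \<open>R\<close> on a common eigenvector on which \<open>D j\<close> acts as \<open>- \<mu> j\<close>.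
\<close>

definition amf_symbol :: "nat \<Rightarrow> real \<Rightarrow> (nat \<Rightarrow> 'a) \<Rightarrow> 'a::{real_normed_field}" where
  "amf_symbol m \<tau> \<mu> = 1 - of_real \<tau> * (\<Sum>j\<in>{1..m}. \<mu> j) / (\<Prod>j\<in>{1..m}. 1 + of_real (\<tau> / 2) * \<mu> j)"

text \<open>
  The symbol of \<open>R ^ n (- D)\<^sup>-\<^sup>1\<close>, as a function of a vector \<open>w\<close> of possibly complex frequencies.
\<close>

definition amf_resolvent :: "nat \<Rightarrow> (nat \<Rightarrow> nat) \<Rightarrow> (nat \<Rightarrow> real) \<Rightarrow> real \<Rightarrow> nat \<Rightarrow> (nat \<Rightarrow> 'a) \<Rightarrow> 'a::{real_normed_field,banach}" where
  "amf_resolvent m N \<beta> \<tau> n w =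
     amf_symbol m \<tau> (\<lambda>j. eigenvalue (N j) (\<beta> j) (w j)) ^ n / (\<Sum>j\<in>{1..m}. eigenvalue (N j) (\<beta> j) (w j))"

lemma amf_symbol_of_real: "amf_symbol m \<tau> (\<lambda>j. complex_of_real (\<mu> j)) = of_real (amf_symbol m \<tau> \<mu>)"
  by (simp add: amf_symbol_def)

lemma amf_resolvent_of_real:
  "amf_resolvent m N \<beta> \<tau> n (\<lambda>j. complex_of_real (x j)) = of_real (amf_resolvent m N \<beta> \<tau> n x)"
  by (simp add: amf_resolvent_def eigenvalue_of_real amf_symbol_of_real)

text \<open>
  Chosen so that the eigenvalues have arguments at most \<open>72 aperture = 1 / (m + 1)\<close>, which is below the angle
  \<open>\<pi> / (2 (m + 1))\<close> admitted by \<open>amf_symbol_sector_bound\<close>.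
\<close>

definition aperture :: "nat \<Rightarrow> real" where
  "aperture m = 1 / (72 * (real m + 1))"

lemma aperture_bounds: "1 \<le> m \<Longrightarrow> 0 < aperture m \<and> aperture m \<le> 1 / 36"
  by (simp add: aperture_def field_simps)

lemma sector_scale: "0 < c \<Longrightarrow> z \<in> sector \<alpha> \<Longrightarrow> of_real c * z \<in> sector \<alpha>"
proof -
  assume c: "0 < c" and "z \<in> sector \<alpha>"
  then obtain l where l: "z = exp l" "\<bar>Im l\<bar> \<le> \<alpha>" by (auto simp: sector_def)
  have "of_real c * z = exp (of_real (ln c) + l)"
    using c l(1) by (simp only: exp_add exp_of_real exp_ln)
  moreover have "\<bar>Im (of_real (ln c) + l)\<bar> \<le> \<alpha>" using l(2) by simp
  ultimately show ?thesis unfolding sector_def by blast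
qed

lemma amf_resolvent_parts:
  fixes w :: "nat \<Rightarrow> complex"
  assumes m: "1 \<le> m" and \<tau>: "0 < \<tau>" and b: "0 < b" "\<And>j. j \<in> {1..m} \<Longrightarrow> b \<le> \<beta> j"
    and q: "\<And>j. j \<in> {1..m} \<Longrightarrow> 0 < q j"
    and w: "\<And>j. j \<in> {1..m} \<Longrightarrow> w j \<in> sector_nbhd (aperture m) (real (q j) / 2) (real (N j) + 1)"
  defines "\<mu> \<equiv> \<lambda>j. eigenvalue (N j) (\<beta> j) (w j)"
  shows "(\<Prod>j\<in>{1..m}. 1 + of_real (\<tau> / 2) * \<mu> j) \<noteq> 0"
    and "norm (amf_symbol m \<tau> \<mu>) \<le> 1"
    and "b / 16 * (\<Sum>j\<in>{1..m}. (real (q j))\<^sup>2) \<le> norm (\<Sum>j\<in>{1..m}. \<mu> j)"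
    and "0 < b / 16 * (\<Sum>j\<in>{1..m}. (real (q j))\<^sup>2)"
proof -
  define \<alpha> where "\<alpha> = 1 / (real m + 1)"
  have ap: "0 < aperture m" "aperture m \<le> 1 / 36" "72 * aperture m = \<alpha>"
    using aperture_bounds[OF m] by (auto simp: aperture_def \<alpha>_def divide_simps)
  have \<alpha>: "0 \<le> \<alpha>" "(real (card {1..m}) + 1) * \<alpha> \<le> pi / 2" "\<alpha> \<le> pi / 3"
  proof -
    have "\<alpha> \<le> 1" by (simp add: \<alpha>_def)
    then show "\<alpha> \<le> pi / 3" using pi_approx by simp
    show "(real (card {1..m}) + 1) * \<alpha> \<le> pi / 2" using pi_approx by (simp add: \<alpha>_def)
  qed (simp add: \<alpha>_def)
  have \<mu>: "\<mu> j \<in> sector \<alpha>" "\<beta> j * (real (q j) / 2)\<^sup>2 / 2 \<le> norm (\<mu> j)" if j: "j \<in> {1..m}" for j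
    using eigenvalue_sector[OF _ _ ap(1,2) w[OF j], of "\<beta> j"] b(1) b(2)[OF j] q[OF j] ap(3)
    by (auto simp: \<mu>_def)
  have \<tau>\<mu>: "of_real (\<tau> / 2) * \<mu> j \<in> sector \<alpha>" if "j \<in> {1..m}" for j
    using \<mu>(1)[OF that] \<tau> by (intro sector_scale) auto
  have J: "finite {1..m}" "{1..m} \<noteq> {}" using m by auto
  show "(\<Prod>j\<in>{1..m}. 1 + of_real (\<tau> / 2) * \<mu> j) \<noteq> 0"
    by (rule amf_symbol_sector_bound(1)[OF J \<tau>\<mu> \<alpha>(1,2)])
  have "amf_symbol m \<tau> \<mu> = 1 - 2 * (\<Sum>j\<in>{1..m}. of_real (\<tau> / 2) * \<mu> j) / (\<Prod>j\<in>{1..m}. 1 + of_real (\<tau> / 2) * \<mu> j)"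
    unfolding amf_symbol_def sum_distrib_left[symmetric] by simp
  then show "norm (amf_symbol m \<tau> \<mu>) \<le> 1"
    using amf_symbol_sector_bound(2)[OF J \<tau>\<mu> \<alpha>(1,2)] by simp
  have "b / 16 * (\<Sum>j\<in>{1..m}. (real (q j))\<^sup>2) \<le> (\<Sum>j\<in>{1..m}. Re (\<mu> j))"
    unfolding sum_distrib_left
  proof (rule sum_mono)
    fix j assume j: "j \<in> {1..m}"
    have "b / 16 * (real (q j))\<^sup>2 \<le> \<beta> j / 16 * (real (q j))\<^sup>2"
      using b(2)[OF j] by (intro mult_right_mono) auto
    also have "\<dots> = \<beta> j * (real (q j) / 2)\<^sup>2 / 2 / 2" by (simp add: power2_eq_square)
    also have "\<dots> \<le> norm (\<mu> j) / 2" using \<mu>(2)[OF j] by simp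
    also have "\<dots> \<le> Re (\<mu> j)" using Re_sector_ge[OF \<mu>(1)[OF j] \<alpha>(3)] .
    finally show "b / 16 * (real (q j))\<^sup>2 \<le> Re (\<mu> j)" .
  qed
  also have "\<dots> \<le> norm (\<Sum>j\<in>{1..m}. \<mu> j)"
    using complex_Re_le_cmod[of "\<Sum>j\<in>{1..m}. \<mu> j"] by simp
  finally show "b / 16 * (\<Sum>j\<in>{1..m}. (real (q j))\<^sup>2) \<le> norm (\<Sum>j\<in>{1..m}. \<mu> j)" .
  show "0 < b / 16 * (\<Sum>j\<in>{1..m}. (real (q j))\<^sup>2)"
    using b(1) q J by (intro mult_pos_pos sum_pos) auto
qed

lemma eigenvalue_holomorphic: "(\<lambda>s. eigenvalue N b s) holomorphic_on A"
  unfolding eigenvalue_def by (intro holomorphic_intros)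

text \<open>
  Stability on the sector bounds the powers of \<open>R\<close> by \<open>1\<close> on the whole product of neighbourhoods, uniformly
  in \<open>n\<close> and \<open>\<tau>\<close>, so the difference estimates only see the decay of \<open>(- D)\<^sup>-\<^sup>1\<close>.
\<close>

lemma amf_resolvent_coeff_bound:
  assumes m: "1 \<le> m" and \<tau>: "0 < \<tau>" and b: "0 < b" "\<And>j. j \<in> {1..m} \<Longrightarrow> b \<le> \<beta> j"
    and N: "\<And>j. j \<in> {1..m} \<Longrightarrow> 1 \<le> N j"
    and q: "q \<in> PiE {1..m} (\<lambda>j. {2..N j + 2})"
  shows "\<bar>fejer_coeff m N (\<lambda>p. amf_resolvent m N \<beta> \<tau> n (\<lambda>j. real (p j))) q\<bar>
    \<le> (\<Prod>j\<in>{1..m}. coefficient_bound (aperture m) (N j) (q j)) * (16 / (b * (\<Sum>j\<in>{1..m}. (real (q j))\<^sup>2)))"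
proof -
  define \<Omega> where "\<Omega> = (\<lambda>j. sector_nbhd (aperture m) (real (q j) / 2) (real (N j) + 1))"
  have ap: "0 < aperture m" "aperture m \<le> 1" using aperture_bounds[OF m] by auto
  have qj: "2 \<le> q j" "q j \<le> N j + 2" "q j \<in> {2..N j + 2}" if "j \<in> {1..m}" for j
    using q that by (auto simp: PiE_iff)
  have qpos: "0 < q j" if "j \<in> {1..m}" for j using qj(1)[OF that] by simp
  have parts: "(\<Prod>j\<in>{1..m}. 1 + of_real (\<tau> / 2) * eigenvalue (N j) (\<beta> j) (w j)) \<noteq> 0"
    "norm (amf_symbol m \<tau> (\<lambda>j. eigenvalue (N j) (\<beta> j) (w j))) \<le> 1"
    "b / 16 * (\<Sum>j\<in>{1..m}. (real (q j))\<^sup>2) \<le> norm (\<Sum>j\<in>{1..m}. eigenvalue (N j) (\<beta> j) (w j))"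
    "0 < b / 16 * (\<Sum>j\<in>{1..m}. (real (q j))\<^sup>2)"
    if w: "\<And>j. j \<in> {1..m} \<Longrightarrow> w j \<in> \<Omega> j" for w :: "nat \<Rightarrow> complex"
  proof -
    note prems = m \<tau> b qpos w[unfolded \<Omega>_def]
    show "(\<Prod>j\<in>{1..m}. 1 + of_real (\<tau> / 2) * eigenvalue (N j) (\<beta> j) (w j)) \<noteq> 0"
      by (rule amf_resolvent_parts(1)[where b = b and q = q]) (fact prems)+
    show "norm (amf_symbol m \<tau> (\<lambda>j. eigenvalue (N j) (\<beta> j) (w j))) \<le> 1"
      by (rule amf_resolvent_parts(2)[where b = b and q = q]) (fact prems)+
    show "b / 16 * (\<Sum>j\<in>{1..m}. (real (q j))\<^sup>2) \<le> norm (\<Sum>j\<in>{1..m}. eigenvalue (N j) (\<beta> j) (w j))"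
      by (rule amf_resolvent_parts(3)[where \<tau> = \<tau>]) (fact prems)+
    show "0 < b / 16 * (\<Sum>j\<in>{1..m}. (real (q j))\<^sup>2)"
      by (rule amf_resolvent_parts(4)[where \<tau> = \<tau>]) (fact prems)+
  qed
  define B where "B = 16 / (b * (\<Sum>j\<in>{1..m}. (real (q j))\<^sup>2))"
  \<comment> \<open>The nodes on which \<open>diff_weight\<close> lives; they all lie inside the neighbourhood \<open>\<Omega> j\<close>.\<close>
  define X where "X = (\<lambda>j. {x \<in> {1..N j + 1}. q j \<le> 2 * x})"
  have zero: "diff_weight (N j) (q j) x = 0" if "j \<in> {1..m}" "x \<in> {1..N j + 1}" "x \<notin> X j" for j x
    using that qj[OF that(1)] N[OF that(1)] by (auto simp: diff_weight_def X_def)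
  have "norm (\<Sum>x\<in>PiE {1..m} X. (\<Prod>j\<in>{1..m}. complex_of_real (diff_weight (N j) (q j) (x j))) *
            amf_resolvent m N \<beta> \<tau> n (\<lambda>j. of_nat (x j)))
    \<le> (\<Prod>j\<in>{1..m}. coefficient_bound (aperture m) (N j) (q j)) * B"
  proof (rule tensor_functional_bound[where \<Omega> = \<Omega>])
    fix j assume j: "j \<in> {1..m}"
    have "of_nat x \<in> \<Omega> j" if "x \<in> X j" for x
    proof -
      have "of_real (real x) \<in> \<Omega> j"
        unfolding \<Omega>_def using that ap qj(1)[OF j] by (intro of_real_in_sector_nbhd) (auto simp: X_def)
      then show ?thesis by simp
    qed
    moreover have "N j + 1 \<in> X j" using qj[OF j] N[OF j] by (auto simp: X_def)
    ultimately show "of_nat ` X j \<subseteq> \<Omega> j \<and> \<Omega> j \<noteq> {}" by blast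
  next
    fix j f B assume j: "j \<in> {1..m}" and f: "f holomorphic_on \<Omega> j" "\<And>z. z \<in> \<Omega> j \<Longrightarrow> norm (f z) \<le> B"
    have "(\<Sum>x\<in>X j. of_real (diff_weight (N j) (q j) x) * f (of_nat x))
        = (\<Sum>x=1..N j + 1. of_real (diff_weight (N j) (q j) x) * f (of_nat x))"
      by (rule sum.mono_neutral_left) (use zero[OF j] in \<open>auto simp: X_def\<close>)
    also have "norm \<dots> \<le> coefficient_bound (aperture m) (N j) (q j) * B"
      using f unfolding \<Omega>_def by (intro diff_weight_functional_bound N j ap qj) auto
    finally show "norm (\<Sum>x\<in>X j. of_real (diff_weight (N j) (q j) x) * f (of_nat x))
       \<le> coefficient_bound (aperture m) (N j) (q j) * B" .
  next
    fix z j assume z: "\<And>i. i \<in> {1..m} \<Longrightarrow> z i \<in> \<Omega> i" and j: "j \<in> {1..m}"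
    have ev: "(\<lambda>s. eigenvalue (N i) (\<beta> i) ((z(j := s)) i)) holomorphic_on \<Omega> j" for i
      by (cases "i = j") (auto intro: eigenvalue_holomorphic)
    have zs: "(z(j := s)) i \<in> \<Omega> i" if "s \<in> \<Omega> j" "i \<in> {1..m}" for s i using that z by auto
    show "(\<lambda>s. amf_resolvent m N \<beta> \<tau> n (z(j := s))) holomorphic_on \<Omega> j"
      unfolding amf_resolvent_def amf_symbol_def
    proof (intro holomorphic_on_divide holomorphic_on_power holomorphic_on_diff holomorphic_on_mult
        holomorphic_on_sum holomorphic_on_prod holomorphic_on_add holomorphic_on_const ev)
      fix s assume s: "s \<in> \<Omega> j"
      show "(\<Prod>i\<in>{1..m}. 1 + of_real (\<tau> / 2) * eigenvalue (N i) (\<beta> i) ((z(j := s)) i)) \<noteq> 0"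
        by (rule parts(1)[OF zs[OF s]])
      have "0 < norm (\<Sum>i\<in>{1..m}. eigenvalue (N i) (\<beta> i) ((z(j := s)) i))"
        by (rule less_le_trans[OF parts(4,3)[OF zs[OF s]]])
      then show "(\<Sum>i\<in>{1..m}. eigenvalue (N i) (\<beta> i) ((z(j := s)) i)) \<noteq> 0" by auto
    qed
  next
    fix z assume z: "\<And>i. i \<in> {1..m} \<Longrightarrow> z i \<in> \<Omega> i"
    have "norm (amf_resolvent m N \<beta> \<tau> n z) \<le> 1 / (b / 16 * (\<Sum>j\<in>{1..m}. (real (q j))\<^sup>2))"
      unfolding amf_resolvent_def norm_divide norm_power
      using parts(2,3,4)[OF z] by (intro frac_le power_le_one) auto
    then show "norm (amf_resolvent m N \<beta> \<tau> n z) \<le> B" by (simp add: B_def)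
  qed simp
  also have "(\<Sum>x\<in>PiE {1..m} X. (\<Prod>j\<in>{1..m}. complex_of_real (diff_weight (N j) (q j) (x j))) *
            amf_resolvent m N \<beta> \<tau> n (\<lambda>j. of_nat (x j)))
      = (\<Sum>x\<in>PiE {1..m} (\<lambda>j. {1..N j + 1}). (\<Prod>j\<in>{1..m}. complex_of_real (diff_weight (N j) (q j) (x j))) *
            amf_resolvent m N \<beta> \<tau> n (\<lambda>j. of_nat (x j)))"
  proof (rule sum.mono_neutral_left)
    show "PiE {1..m} X \<subseteq> PiE {1..m} (\<lambda>j. {1..N j + 1})" by (rule PiE_mono) (auto simp: X_def)
    show "\<forall>x\<in>PiE {1..m} (\<lambda>j. {1..N j + 1}) - PiE {1..m} X.
        (\<Prod>j\<in>{1..m}. complex_of_real (diff_weight (N j) (q j) (x j))) *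
            amf_resolvent m N \<beta> \<tau> n (\<lambda>j. of_nat (x j)) = 0"
    proof
      fix x assume x: "x \<in> PiE {1..m} (\<lambda>j. {1..N j + 1}) - PiE {1..m} X"
      then obtain j where j: "j \<in> {1..m}" "x j \<notin> X j" by (auto simp: PiE_iff)
      then have "diff_weight (N j) (q j) (x j) = 0" using x by (intro zero) (auto simp: PiE_iff)
      with j(1) have "(\<Prod>j\<in>{1..m}. complex_of_real (diff_weight (N j) (q j) (x j))) = 0"
        by (intro prod_zero) auto
      then show "(\<Prod>j\<in>{1..m}. complex_of_real (diff_weight (N j) (q j) (x j))) *
            amf_resolvent m N \<beta> \<tau> n (\<lambda>j. of_nat (x j)) = 0" by simp
    qed
  qed (simp add: finite_PiE)
  also have "\<dots>
      = complex_of_real (fejer_coeff m N (\<lambda>p. amf_resolvent m N \<beta> \<tau> n (\<lambda>j. real (p j))) q)"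
    unfolding fejer_coeff_def of_real_sum of_real_mult of_real_prod
    by (simp flip: amf_resolvent_of_real)
  finally show ?thesis by (simp add: B_def)
qed

text \<open>
  The bound for the absolute sum of all coefficients: after \<open>inverse_sum_squares_le_prod\<close> that sum factorizes,
  and each factor is dominated by the convergent series plus \<open>2\<close> for the two boundary indices.
\<close>

definition multiplier_constant :: "nat \<Rightarrow> real \<Rightarrow> real" where
  "multiplier_constant m b = 16 / b *
     (32 / (aperture m)\<^sup>2 * ((\<Sum>n. real n powr - (1 + 2 / real m)) + 2)) ^ m"

lemma coefficient_bound_sum:
  assumes "1 \<le> m" "0 < \<epsilon>"
  shows "(\<Sum>q=2..N + 2. coefficient_bound \<epsilon> N q * real q powr - (2 / real m))
     \<le> 32 / \<epsilon>\<^sup>2 * ((\<Sum>n. real n powr - (1 + 2 / real m)) + 2)"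
proof -
  define s where "s = 2 / real m"
  have s: "0 < s" using assms(1) by (simp add: s_def)
  have summable: "summable (\<lambda>n. real n powr - (1 + s))"
    using s by (subst summable_real_powr_iff) auto
  have "(\<Sum>q=2..N + 2. coefficient_bound \<epsilon> N q * real q powr - s)
     \<le> (\<Sum>q=2..N + 2. 32 / \<epsilon>\<^sup>2 * (real q powr - (1 + s) + (if N < q then 1 else 0)))"
  proof (rule sum_mono)
    fix q assume q: "q \<in> {2..N + 2}"
    have "(if q \<le> N then 1 / real q else 1) * real q powr - s
        \<le> real q powr - (1 + s) + (if N < q then 1 else 0)"
    proof (cases "q \<le> N")
      case True
      have "real q powr - (1 + s) = real q powr - 1 * real q powr - s"
        unfolding powr_add[symmetric] by simp
      moreover have "real q powr - 1 = 1 / real q" using q by (simp add: powr_minus_divide)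
      ultimately show ?thesis using True by simp
    next
      case False
      have "real q powr - s \<le> real q powr 0" using q s by (intro powr_mono) auto
      then have "real q powr - s \<le> 1" using q by simp
      then show ?thesis using False by (simp add: add_increasing)
    qed
    then show "coefficient_bound \<epsilon> N q * real q powr - s
        \<le> 32 / \<epsilon>\<^sup>2 * (real q powr - (1 + s) + (if N < q then 1 else 0))"
      unfolding coefficient_bound_def mult.assoc using assms(2) by (intro mult_left_mono) auto
  qed
  also have "\<dots> = 32 / \<epsilon>\<^sup>2 * ((\<Sum>q=2..N + 2. real q powr - (1 + s)) + (\<Sum>q=2..N + 2. if N < q then 1 else 0))"
    unfolding sum_distrib_left[symmetric] sum.distrib ..
  also have "\<dots> \<le> 32 / \<epsilon>\<^sup>2 * ((\<Sum>n. real n powr - (1 + s)) + 2)"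
  proof (intro mult_left_mono add_mono)
    show "(\<Sum>q=2..N + 2. real q powr - (1 + s)) \<le> (\<Sum>n. real n powr - (1 + s))"
      using summable by (intro sum_le_suminf) auto
    have "(\<Sum>q=2..N + 2. if N < q then 1 else 0 :: real) = (\<Sum>q\<in>{q \<in> {2..N + 2}. N < q}. 1)"
      by (rule sum.inter_filter[symmetric]) simp
    also have "\<dots> \<le> (\<Sum>q\<in>{N + 1, N + 2}. 1 :: real)"
      by (rule sum_mono2) auto
    finally show "(\<Sum>q=2..N + 2. if N < q then 1 else 0 :: real) \<le> 2" by simp
  qed (use assms(2) in auto)
  finally show ?thesis by (simp add: s_def)
qed

text \<open>
  Each \<open>(q j)\<^sup>2\<close> is at most the sum \<open>S\<close>, hence \<open>\<Prod>j. (q j) powr (2 / m) \<le> (S powr (1 / m)) ^ m = S\<close>. This splits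
  the decay of \<open>1 / S\<close> evenly among the directions and leaves a summable power of \<open>q j\<close> in each.
\<close>

lemma inverse_sum_squares_le_prod:
  assumes m: "1 \<le> m" and q: "\<And>j. j \<in> {1..m} \<Longrightarrow> 0 < q j"
  shows "1 / (\<Sum>j\<in>{1..m}. (real (q j))\<^sup>2) \<le> (\<Prod>j\<in>{1..m}. real (q j) powr - (2 / real m))"
proof -
  define S where "S = (\<Sum>j\<in>{1..m}. (real (q j))\<^sup>2)"
  have S: "0 < S" unfolding S_def using m q by (intro sum_pos) auto
  have le: "real (q j) powr (2 / real m) \<le> S powr (1 / real m)" if j: "j \<in> {1..m}" for j
  proof -
    have "(real (q j))\<^sup>2 \<le> S" unfolding S_def using j by (intro member_le_sum) auto
    then have "((real (q j))\<^sup>2) powr (1 / real m) \<le> S powr (1 / real m)"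
      by (intro powr_mono2) auto
    moreover have "((real (q j))\<^sup>2) powr (1 / real m) = real (q j) powr (2 / real m)"
      using q[OF j] by (simp add: powr_powr flip: powr_numeral)
    ultimately show ?thesis by simp
  qed
  have "(\<Prod>j\<in>{1..m}. real (q j) powr (2 / real m)) \<le> (\<Prod>j\<in>{1..m}. S powr (1 / real m))"
    using le by (intro prod_mono) auto
  also have "\<dots> = S"
    using m S by (simp add: powr_realpow[symmetric] powr_powr)
  finally have "1 / S \<le> 1 / (\<Prod>j\<in>{1..m}. real (q j) powr (2 / real m))"
    using S q by (intro divide_left_mono mult_pos_pos prod_pos) auto
  also have "\<dots> = (\<Prod>j\<in>{1..m}. real (q j) powr - (2 / real m))"
    by (simp add: powr_minus_divide prod_dividef)
  finally show ?thesis by (simp add: S_def)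
qed

lemma amf_resolvent_max_norm_bound:
  assumes m: "1 \<le> m" and \<tau>: "0 < \<tau>" and b: "0 < b" "\<And>j. j \<in> {1..m} \<Longrightarrow> b \<le> \<beta> j"
    and N: "\<And>j. j \<in> {1..m} \<Longrightarrow> 1 \<le> N j"
    and k: "k \<in> grid m N" and v: "\<And>l. l \<in> grid m N \<Longrightarrow> \<bar>v l\<bar> \<le> W"
  shows "\<bar>sine_synth m N (\<lambda>p. amf_resolvent m N \<beta> \<tau> n (\<lambda>j. real (p j)) * sine_coeff m N v p) k\<bar>
    \<le> multiplier_constant m b * W"
proof -
  let ?Q = "PiE {1..m} (\<lambda>j. {2..N j + 2})"
  let ?F = "\<lambda>p::nat \<Rightarrow> nat. amf_resolvent m N \<beta> \<tau> n (\<lambda>j. real (p j)) :: real"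
  have W: "0 \<le> W" using v[OF k] by simp
  have ap: "0 < aperture m" using aperture_bounds[OF m] by simp
  have cb: "0 \<le> coefficient_bound (aperture m) N q" for N q
    by (simp add: coefficient_bound_def)
  have "(\<Sum>q\<in>?Q. \<bar>fejer_coeff m N ?F q\<bar>)
     \<le> (\<Sum>q\<in>?Q. 16 / b * (\<Prod>j\<in>{1..m}. coefficient_bound (aperture m) (N j) (q j) * real (q j) powr - (2 / real m)))"
  proof (rule sum_mono)
    fix q assume q: "q \<in> ?Q"
    then have qpos: "0 < q j" if "j \<in> {1..m}" for j using that by (force simp: PiE_iff)
    let ?P = "\<Prod>j\<in>{1..m}. coefficient_bound (aperture m) (N j) (q j)"
    have "\<bar>fejer_coeff m N ?F q\<bar> \<le> ?P * (16 / (b * (\<Sum>j\<in>{1..m}. (real (q j))\<^sup>2)))"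
      by (rule amf_resolvent_coeff_bound[OF m \<tau> b N q])
    also have "\<dots> = 16 / b * (?P * (1 / (\<Sum>j\<in>{1..m}. (real (q j))\<^sup>2)))" by simp
    also have "\<dots> \<le> 16 / b * (?P * (\<Prod>j\<in>{1..m}. real (q j) powr - (2 / real m)))"
      using b(1) inverse_sum_squares_le_prod[OF m qpos] cb by (intro mult_left_mono prod_nonneg) auto
    finally show "\<bar>fejer_coeff m N ?F q\<bar>
       \<le> 16 / b * (\<Prod>j\<in>{1..m}. coefficient_bound (aperture m) (N j) (q j) * real (q j) powr - (2 / real m))"
      by (simp only: prod.distrib)
  qed
  also have "\<dots> = 16 / b * (\<Prod>j\<in>{1..m}. \<Sum>q=2..N j + 2. coefficient_bound (aperture m) (N j) q * real q powr - (2 / real m))"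
    unfolding sum_distrib_left[symmetric] by (subst prod_sum_PiE) auto
  also have "\<dots> \<le> 16 / b * (\<Prod>j\<in>{1..m}. 32 / (aperture m)\<^sup>2 * ((\<Sum>n. real n powr - (1 + 2 / real m)) + 2))"
    using b(1) cb by (intro mult_left_mono prod_mono conjI sum_nonneg coefficient_bound_sum m ap) auto
  also have "\<dots> = multiplier_constant m b" by (simp add: multiplier_constant_def)
  finally have "(\<Sum>q\<in>?Q. \<bar>fejer_coeff m N ?F q\<bar>) * W \<le> multiplier_constant m b * W"
    using W by (rule mult_right_mono)
  with multiplier_max_norm_bound[OF k v, where F = ?F] show ?thesis by (rule order_trans)
qed

section \<open>Difference operators and the method in sine coefficients\<close>

lemma sine_coeff_cong:
  assumes "\<And>l. l \<in> grid m N \<Longrightarrow> v l = w l"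
  shows "sine_coeff m N v p = sine_coeff m N w p"
  unfolding sine_coeff_def using assms by (simp cong: sum.cong)

lemma sine_coeff_add: "sine_coeff m N (\<lambda>k. v k + w k) p = sine_coeff m N v p + sine_coeff m N w p"
  unfolding sine_coeff_def by (simp only: distrib_left sum.distrib)

lemma sine_coeff_scale: "sine_coeff m N (\<lambda>k. a * v k) p = a * sine_coeff m N v p"
proof -
  have "(\<Sum>l\<in>grid m N. mode m N p l * (a * v l)) = a * (\<Sum>l\<in>grid m N. mode m N p l * v l)"
    by (simp add: sum_distrib_left mult.left_commute)
  then show ?thesis unfolding sine_coeff_def by simp
qed

lemma sine_coeff_diff: "sine_coeff m N (\<lambda>k. v k - w k) p = sine_coeff m N v p - sine_coeff m N w p"
  unfolding sine_coeff_def by (simp only: right_diff_distrib sum_subtractf)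

lemma sine_coeff_sum:
  "sine_coeff m N (\<lambda>k. \<Sum>i\<in>A. v i k) p = (\<Sum>i\<in>A. sine_coeff m N (v i) p)"
proof -
  have "(\<Sum>l\<in>grid m N. mode m N p l * (\<Sum>i\<in>A. v i l)) = (\<Sum>i\<in>A. \<Sum>l\<in>grid m N. mode m N p l * v i l)"
    unfolding sum_distrib_left by (rule sum.swap)
  then show ?thesis unfolding sine_coeff_def by (simp only: sum_distrib_left)
qed

lemma sine_coeff_mat_vec:
  "sine_coeff m N (mat_vec m N A v) p
   = (\<Prod>j\<in>{1..m}. 2 / real (Suc (N j))) * (\<Sum>l\<in>grid m N. (\<Sum>k\<in>grid m N. mode m N p k * A k l) * v l)"
proof -
  have "(\<Sum>k\<in>grid m N. mode m N p k * (\<Sum>l\<in>grid m N. A k l * v l))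
      = (\<Sum>l\<in>grid m N. \<Sum>k\<in>grid m N. mode m N p k * (A k l * v l))"
    unfolding sum_distrib_left by (rule sum.swap)
  then show ?thesis unfolding sine_coeff_def mat_vec_def by (simp only: sum_distrib_right mult.assoc)
qed

text \<open>
  Each sine mode vanishes at the nodes \<open>0\<close> and \<open>N + 1\<close>, so the truncated difference matrix acts on it like the
  full second difference. The sum is over the row index: this is the transpose acting on the mode.
\<close>

lemma mode_L_mat:
  assumes l: "l \<in> {1..N j}"
  shows "(\<Sum>k=1..N j. sin (real p * real k * (pi / real (Suc (N j)))) * L_mat N j k l)
    = - eigenvalue (N j) 1 (real p) * sin (real p * real l * (pi / real (Suc (N j))))"
proof -
  define n where "n = N j"
  define a where "a = real p * (pi / real (Suc n))"
  define s where "s = (\<lambda>k::nat. sin (real k * a))"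
  have sk: "sin (real p * real k * (pi / real (Suc n))) = s k" for k
    by (simp add: s_def a_def mult_ac)
  have l': "1 \<le> l" "l \<le> n" using l by (auto simp: n_def)
  have s0: "s 0 = 0" by (simp add: s_def)
  have "real (n + 1) * a = real p * pi" by (simp add: a_def)
  then have sn: "s (n + 1) = 0" by (simp only: s_def sin_npi)
  have L: "L_mat N j k l = (real n + 1)\<^sup>2 * (of_bool (k = l + 1) - 2 * of_bool (k = l) + of_bool (k = l - 1))"
    if "k \<in> {1..n}" for k
    using that l' by (auto simp: L_mat_def mesh_def n_def power_divide)
  have delta: "(\<Sum>k=1..n. s k * of_bool (k = y)) = s y" if "y \<le> n + 1" for y
  proof -
    have "(\<Sum>k=1..n. s k * of_bool (k = y)) = (\<Sum>k=1..n. if k = y then s k else 0)"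
      by (rule sum.cong) auto
    also have "\<dots> = (if y \<in> {1..n} then s y else 0)" by simp
    also have "\<dots> = s y" using that s0 sn by (cases "y = 0"; cases "y = n + 1") auto
    finally show ?thesis .
  qed
  have "(\<Sum>k=1..n. s k * L_mat N j k l)
     = (\<Sum>k=1..n. (real n + 1)\<^sup>2 * (s k * of_bool (k = l + 1) - 2 * (s k * of_bool (k = l)) + s k * of_bool (k = l - 1)))"
  proof (rule sum.cong)
    fix k assume "k \<in> {1..n}"
    from L[OF this] show "s k * L_mat N j k l
      = (real n + 1)\<^sup>2 * (s k * of_bool (k = l + 1) - 2 * (s k * of_bool (k = l)) + s k * of_bool (k = l - 1))"
      by (simp only: distrib_left right_diff_distrib mult.left_commute)
  qed simp
  also have "\<dots> = (real n + 1)\<^sup>2 * (s (l + 1) - 2 * s l + s (l - 1))"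
    unfolding sum_distrib_left[symmetric] sum.distrib sum_subtractf
    using l' by (subst (1 2 3) delta) auto
  also have "s (l + 1) - 2 * s l + s (l - 1) = - (4 * (sin (a / 2))\<^sup>2) * s l"
  proof -
    have "s (l + 1) + s (l - 1) = sin (real l * a + a) + sin (real l * a - a)"
      using l' by (simp add: s_def of_nat_diff algebra_simps)
    also have "\<dots> = 2 * s l * cos a" by (simp add: sin_add sin_diff s_def)
    also have "cos a = 1 - 2 * (sin (a / 2))\<^sup>2" using cos_double_sin[of "a / 2"] by simp
    finally show ?thesis by (simp add: algebra_simps)
  qed
  also have "(real n + 1)\<^sup>2 * (- (4 * (sin (a / 2))\<^sup>2) * s l) = - eigenvalue n 1 (real p) * s l"
  proof -
    have "pi / (2 * (real n + 1)) * real p = a / 2" by (simp add: a_def divide_simps)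
    then show ?thesis by (simp only: eigenvalue_def of_real_eq_id id_apply) simp
  qed
  finally show ?thesis by (simp only: sk n_def[symmetric])
qed

lemma sine_1d_identity:
  fixes f :: "nat \<Rightarrow> real"
  assumes "l \<in> {1..n}"
  shows "(\<Sum>k=1..n. f k * of_bool (k = l)) = f l"
proof -
  have "(\<Sum>k=1..n. f k * of_bool (k = l)) = (\<Sum>k=1..n. if k = l then f k else 0)"
    by (rule sum.cong) auto
  then show ?thesis using assms by simp
qed

lemma eigenvalue_scale: "eigenvalue n b (x::real) = b * eigenvalue n 1 x"
  by (simp add: eigenvalue_def)

lemma sine_coeff_D_mat:
  assumes j: "j \<in> {1..m}"
  shows "sine_coeff m N (mat_vec m N (D_mat m N \<beta> j) v) p
    = - eigenvalue (N j) (\<beta> j) (real (p j)) * sine_coeff m N v p"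
proof -
  define s where "s = (\<lambda>i k. sin (real (p i) * real k * (pi / real (Suc (N i)))))"
  have "(\<Sum>k\<in>grid m N. mode m N p k * D_mat m N \<beta> j k l)
      = - eigenvalue (N j) (\<beta> j) (real (p j)) * mode m N p l" if l: "l \<in> grid m N" for l
  proof -
    have l': "l i \<in> {1..N i}" if "i \<in> {1..m}" for i using l that by (auto simp: grid_def PiE_iff)
    have "(\<Sum>k\<in>grid m N. mode m N p k * D_mat m N \<beta> j k l)
        = \<beta> j * (\<Sum>k\<in>PiE {1..m} (\<lambda>i. {1..N i}). \<Prod>i\<in>{1..m}. s i (k i) *
             (if i = j then L_mat N j (k i) (l i) else of_bool (k i = l i)))"
      unfolding mode_def D_mat_def grid_def s_def by (simp only: sum_distrib_left prod.distrib mult.left_commute)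
    also have "(\<Sum>k\<in>PiE {1..m} (\<lambda>i. {1..N i}). \<Prod>i\<in>{1..m}. s i (k i) *
             (if i = j then L_mat N j (k i) (l i) else of_bool (k i = l i)))
        = (\<Prod>i\<in>{1..m}. \<Sum>k=1..N i. s i k * (if i = j then L_mat N j k (l i) else of_bool (k = l i)))"
      by (subst prod_sum_PiE) auto
    also have "\<dots> = (\<Prod>i\<in>{1..m}. (if i = j then - eigenvalue (N j) 1 (real (p j)) else 1) * s i (l i))"
    proof (rule prod.cong)
      fix i assume i: "i \<in> {1..m}"
      show "(\<Sum>k=1..N i. s i k * (if i = j then L_mat N j k (l i) else of_bool (k = l i)))
          = (if i = j then - eigenvalue (N j) 1 (real (p j)) else 1) * s i (l i)"
      proof (cases "i = j")
        case True
        then show ?thesis using mode_L_mat[of "l j" N j "p j"] l'[OF j] by (simp add: s_def)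
      next
        case False
        then show ?thesis using sine_1d_identity[OF l'[OF i], of "s i"] by simp
      qed
    qed simp
    also have "\<dots> = - eigenvalue (N j) 1 (real (p j)) * mode m N p l"
      unfolding prod.distrib mode_def s_def using j by (simp add: prod.delta)
    finally show ?thesis by (simp add: eigenvalue_scale[of _ "\<beta> j"])
  qed
  then have eq: "(\<Sum>l\<in>grid m N. (\<Sum>k\<in>grid m N. mode m N p k * D_mat m N \<beta> j k l) * v l)
      = - eigenvalue (N j) (\<beta> j) (real (p j)) * (\<Sum>l\<in>grid m N. mode m N p l * v l)"
    unfolding sum_distrib_left by (intro sum.cong) (auto simp: mult.assoc)
  show ?thesis
    by (subst sine_coeff_mat_vec, subst eq) (simp add: sine_coeff_def)
qed

lemma mat_vec_D_total: "mat_vec m N (D_total m N \<beta>) v k = (\<Sum>j\<in>{1..m}. mat_vec m N (D_mat m N \<beta> j) v k)"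
proof -
  have "(\<Sum>l\<in>grid m N. \<Sum>j\<in>{1..m}. D_mat m N \<beta> j k l * v l) = (\<Sum>j\<in>{1..m}. \<Sum>l\<in>grid m N. D_mat m N \<beta> j k l * v l)"
    by (rule sum.swap)
  then show ?thesis by (simp only: mat_vec_def D_total_def sum_distrib_right)
qed

lemma sine_coeff_D_total:
  "sine_coeff m N (mat_vec m N (D_total m N \<beta>) v) p
    = - (\<Sum>j\<in>{1..m}. eigenvalue (N j) (\<beta> j) (real (p j))) * sine_coeff m N v p"
proof -
  have "sine_coeff m N (mat_vec m N (D_total m N \<beta>) v) p
      = (\<Sum>j\<in>{1..m}. sine_coeff m N (mat_vec m N (D_mat m N \<beta> j) v) p)"
    unfolding sine_coeff_sum[symmetric] by (rule sine_coeff_cong) (rule mat_vec_D_total)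
  also have "\<dots> = (\<Sum>j\<in>{1..m}. - eigenvalue (N j) (\<beta> j) (real (p j)) * sine_coeff m N v p)"
    by (intro sum.cong sine_coeff_D_mat) auto
  finally show ?thesis by (simp only: sum_distrib_right[symmetric] sum_negf)
qed

text \<open>
  Products of directional operators are indexed by lists of directions, the first of which acts last.
\<close>

definition D_word :: "nat \<Rightarrow> (nat \<Rightarrow> nat) \<Rightarrow> (nat \<Rightarrow> real) \<Rightarrow> nat list \<Rightarrow> ((nat \<Rightarrow> nat) \<Rightarrow> real) \<Rightarrow> (nat \<Rightarrow> nat) \<Rightarrow> real" where
  "D_word m N \<beta> is = foldr (\<lambda>i. mat_vec m N (D_mat m N \<beta> i)) is"

lemma D_word_simps [simp]:
  "D_word m N \<beta> [] v = v"
  "D_word m N \<beta> (i # is) v = mat_vec m N (D_mat m N \<beta> i) (D_word m N \<beta> is v)"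
  by (simp_all add: D_word_def)

lemma D_word_append: "D_word m N \<beta> (is @ js) v = D_word m N \<beta> is (D_word m N \<beta> js v)"
  by (simp add: D_word_def)

lemma sine_coeff_D_word:
  assumes "set is \<subseteq> {1..m}"
  shows "sine_coeff m N (D_word m N \<beta> is v) p
    = (\<Prod>i\<leftarrow>is. - eigenvalue (N i) (\<beta> i) (real (p i))) * sine_coeff m N v p"
  using assms by (induction "is") (simp_all add: sine_coeff_D_mat)

text \<open>
  \<open>(I - \<theta> D 1) \<cdots> (I - \<theta> D m)\<close> applied to \<open>v\<close>, expanded over sets of directions.
\<close>

definition factored_apply :: "nat \<Rightarrow> (nat \<Rightarrow> nat) \<Rightarrow> (nat \<Rightarrow> real) \<Rightarrow> real \<Rightarrow> ((nat \<Rightarrow> nat) \<Rightarrow> real) \<Rightarrow> (nat \<Rightarrow> nat) \<Rightarrow> real" where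
  "factored_apply m N \<beta> \<theta> v k =
     (\<Sum>S\<in>Pow {1..m}. (- \<theta>) ^ card S * D_word m N \<beta> (sorted_list_of_set S) v k)"

lemma sine_coeff_factored_apply:
  "sine_coeff m N (factored_apply m N \<beta> \<theta> v) p
    = (\<Prod>j\<in>{1..m}. 1 + \<theta> * eigenvalue (N j) (\<beta> j) (real (p j))) * sine_coeff m N v p"
proof -
  define \<mu> where "\<mu> = (\<lambda>j. eigenvalue (N j) (\<beta> j) (real (p j)) :: real)"
  have "sine_coeff m N (factored_apply m N \<beta> \<theta> v) p
     = (\<Sum>S\<in>Pow {1..m}. (- \<theta>) ^ card S * sine_coeff m N (D_word m N \<beta> (sorted_list_of_set S) v) p)"
    unfolding factored_apply_def sine_coeff_sum sine_coeff_scale ..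
  also have "\<dots> = (\<Sum>S\<in>Pow {1..m}. (\<Prod>j\<in>S. \<theta> * \<mu> j) * sine_coeff m N v p)"
  proof (rule sum.cong)
    fix S assume S: "S \<in> Pow {1..m}"
    then have fin: "finite S" using finite_subset by auto
    have "sine_coeff m N (D_word m N \<beta> (sorted_list_of_set S) v) p
        = (\<Prod>i\<leftarrow>sorted_list_of_set S. - \<mu> i) * sine_coeff m N v p"
      unfolding \<mu>_def using S fin by (intro sine_coeff_D_word) auto
    also have "(\<Prod>i\<leftarrow>sorted_list_of_set S. - \<mu> i) = (\<Prod>i\<in>S. - \<mu> i)"
      using fin by (metis distinct_sorted_list_of_set prod.distinct_set_conv_list set_sorted_list_of_set)
    finally show "(- \<theta>) ^ card S * sine_coeff m N (D_word m N \<beta> (sorted_list_of_set S) v) p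
        = (\<Prod>j\<in>S. \<theta> * \<mu> j) * sine_coeff m N v p"
      by (simp add: prod.distrib prod_uminus power_minus[of \<theta>] mult_ac)
  qed simp
  also have "\<dots> = (\<Prod>j\<in>{1..m}. 1 + \<theta> * \<mu> j) * sine_coeff m N v p"
    using prod_add[of "{1..m}" "\<lambda>j. \<theta> * \<mu> j" "\<lambda>_. 1"] by (simp add: sum_distrib_right add.commute)
  finally show ?thesis by (simp add: \<mu>_def)
qed

lemma eigenvalue_pos:
  assumes "0 < b" "p \<in> {1..n}"
  shows "0 < eigenvalue n b (real p)"
proof -
  have "pi / (2 * (real n + 1)) * real p \<le> pi / (2 * (real n + 1)) * (real n + 1)"
    using assms by (intro mult_left_mono) auto
  also have "\<dots> = pi / 2" by (simp add: divide_simps)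
  also have "\<dots> < pi" by simp
  finally have "0 < sin (pi / (2 * (real n + 1)) * real p)" using assms by (intro sin_gt_zero) auto
  then show ?thesis using assms(1) by (simp add: eigenvalue_def)
qed

text \<open>
  In sine coefficients the stage equations are scalar; multiplying them together removes all inner stages.
  The hypothesis on \<open>g\<close> leaves the first stage as the only one with a source term.
\<close>

lemma amf_w_step_coeff:
  assumes step: "amf_w_step T m \<beta> N g \<theta> \<tau> t V V'" and m: "1 \<le> m"
    and g: "\<And>j k. \<lbrakk>j \<in> {2..m}; k \<in> grid m N\<rbrakk> \<Longrightarrow> time_deriv T (g j) (t + \<tau> / 2) k = 0"
    and nz: "\<And>j. j \<in> {1..m} \<Longrightarrow> 1 + \<theta> * \<tau> * eigenvalue (N j) (\<beta> j) (real (p j)) \<noteq> (0::real)"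
  shows "(\<Prod>j\<in>{1..m}. 1 + \<theta> * \<tau> * eigenvalue (N j) (\<beta> j) (real (p j)))
        * (sine_coeff m N V' p - sine_coeff m N V p)
     = \<tau> * (sine_coeff m N (sum_parts m g t) p
          - (\<Sum>j\<in>{1..m}. eigenvalue (N j) (\<beta> j) (real (p j))) * sine_coeff m N V p)
       + \<theta> * \<tau>\<^sup>2 * sine_coeff m N (time_deriv T (g 1) (t + \<tau> / 2)) p"
proof -
  define \<mu> where "\<mu> = (\<lambda>j. eigenvalue (N j) (\<beta> j) (real (p j)) :: real)"
  define G where "G = \<theta> * \<tau>\<^sup>2 * sine_coeff m N (time_deriv T (g 1) (t + \<tau> / 2)) p"
  obtain K where K: "\<And>k. k \<in> grid m N \<Longrightarrow>
        K 0 k = \<tau> * mat_vec m N (D_total m N \<beta>) V k + \<tau> * sum_parts m g t k"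
      "\<And>k j. \<lbrakk>k \<in> grid m N; j \<in> {1..m}\<rbrakk> \<Longrightarrow>
           mat_vec m N (\<lambda>k l. of_bool (k = l) - \<theta> * \<tau> * D_mat m N \<beta> j k l) (K j) k
           = K (j - 1) k + \<theta> * \<tau>\<^sup>2 * time_deriv T (g j) (t + \<tau> / 2) k"
      "\<And>k. k \<in> grid m N \<Longrightarrow> V' k = V k + K m k"
    using step unfolding amf_w_step_def by blast
  define c where "c = (\<lambda>j. sine_coeff m N (K j) p)"
  have c0: "c 0 = \<tau> * (sine_coeff m N (sum_parts m g t) p - (\<Sum>j\<in>{1..m}. \<mu> j) * sine_coeff m N V p)"
  proof -
    have "c 0 = sine_coeff m N (\<lambda>k. \<tau> * mat_vec m N (D_total m N \<beta>) V k + \<tau> * sum_parts m g t k) p"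
      unfolding c_def by (rule sine_coeff_cong) (rule K(1))
    then show ?thesis
      by (simp add: sine_coeff_add sine_coeff_scale sine_coeff_D_total \<mu>_def right_diff_distrib)
  qed
  have cj: "(1 + \<theta> * \<tau> * \<mu> j) * c j = c (j - 1) + (if j = 1 then G else 0)" if j: "j \<in> {1..m}" for j
  proof -
    have split: "mat_vec m N (\<lambda>k l. of_bool (k = l) - \<theta> * \<tau> * D_mat m N \<beta> j k l) (K j) k
        = K j k - \<theta> * \<tau> * mat_vec m N (D_mat m N \<beta> j) (K j) k" if "k \<in> grid m N" for k
    proof -
      have "(\<Sum>l\<in>grid m N. of_bool (k = l) * K j l) = (\<Sum>l\<in>grid m N. if l = k then K j l else 0)"
        by (rule sum.cong) auto
      also have "\<dots> = K j k" using that by simp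
      finally show ?thesis
        by (simp add: mat_vec_def left_diff_distrib sum_subtractf sum_distrib_left mult.assoc)
    qed
    have "sine_coeff m N (\<lambda>k. K j k - \<theta> * \<tau> * mat_vec m N (D_mat m N \<beta> j) (K j) k) p
        = sine_coeff m N (\<lambda>k. K (j - 1) k + \<theta> * \<tau>\<^sup>2 * time_deriv T (g j) (t + \<tau> / 2) k) p"
      using K(2)[OF _ j] split by (intro sine_coeff_cong) auto
    then have "(1 + \<theta> * \<tau> * \<mu> j) * c j
        = c (j - 1) + \<theta> * \<tau>\<^sup>2 * sine_coeff m N (time_deriv T (g j) (t + \<tau> / 2)) p"
      by (simp only: sine_coeff_diff sine_coeff_add sine_coeff_scale sine_coeff_D_mat[OF j] c_def \<mu>_def)
         (simp add: algebra_simps)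
    moreover have "sine_coeff m N (time_deriv T (g j) (t + \<tau> / 2)) p = 0" if "j \<noteq> 1"
    proof -
      have "sine_coeff m N (time_deriv T (g j) (t + \<tau> / 2)) p = sine_coeff m N (\<lambda>_. 0) p"
        using that j g[of j] by (intro sine_coeff_cong) auto
      then show ?thesis by (simp add: sine_coeff_def)
    qed
    ultimately show ?thesis by (auto simp: G_def)
  qed
  have prod: "(\<Prod>i\<in>{1..j}. 1 + \<theta> * \<tau> * \<mu> i) * c j = c 0 + (if j = 0 then 0 else G)" if "j \<le> m" for j
    using that
  proof (induction j)
    case (Suc j)
    have "(\<Prod>i\<in>{1..Suc j}. 1 + \<theta> * \<tau> * \<mu> i) * c (Suc j)
        = (\<Prod>i\<in>{1..j}. 1 + \<theta> * \<tau> * \<mu> i) * ((1 + \<theta> * \<tau> * \<mu> (Suc j)) * c (Suc j))"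
      by (simp add: prod.nat_ivl_Suc' mult_ac)
    also have "(1 + \<theta> * \<tau> * \<mu> (Suc j)) * c (Suc j) = c j + (if j = 0 then G else 0)"
      using cj[of "Suc j"] Suc.prems by simp
    finally show ?case using Suc.IH Suc.prems by (cases "j = 0") (auto simp: distrib_left)
  qed simp
  have "sine_coeff m N V' p = sine_coeff m N V p + c m"
    unfolding c_def sine_coeff_add[symmetric] by (rule sine_coeff_cong) (rule K(3))
  with prod[of m] m c0 show ?thesis by (simp add: \<mu>_def G_def)
qed

section \<open>The defect of the exact trajectory\<close>

lemma increment_bound:
  fixes f :: "real \<Rightarrow> real"
  assumes "\<And>s. s \<in> {a..b} \<Longrightarrow> (f has_real_derivative f' s) (at s within {a..b})"
    and "\<And>s. s \<in> {a..b} \<Longrightarrow> \<bar>f' s\<bar> \<le> B" and "x \<in> {a..b}" "y \<in> {a..b}"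
  shows "\<bar>f x - f y\<bar> \<le> B * \<bar>x - y\<bar>"
  using field_differentiable_bound[of "{a..b}" f f' B x y] assms by simp

text \<open>
  The error as a function of the right end point \<open>s\<close> has derivative \<open>(x1 s - x1 a - (s - a) * x2 s) / 2\<close>,
  itself a first-order Taylor remainder of size \<open>B h\<^sup>2 / 2\<close>.
\<close>

lemma trapezoidal_error:
  fixes x :: "real \<Rightarrow> real"
  assumes d0: "\<And>s. s \<in> {a..a + h} \<Longrightarrow> (x has_real_derivative x1 s) (at s within {a..a + h})"
    and d1: "\<And>s. s \<in> {a..a + h} \<Longrightarrow> (x1 has_real_derivative x2 s) (at s within {a..a + h})"
    and d2: "\<And>s. s \<in> {a..a + h} \<Longrightarrow> (x2 has_real_derivative x3 s) (at s within {a..a + h})"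
    and B: "\<And>s. s \<in> {a..a + h} \<Longrightarrow> \<bar>x3 s\<bar> \<le> B" and h: "0 \<le> h"
  shows "\<bar>x (a + h) - x a - h / 2 * (x1 a + x1 (a + h))\<bar> \<le> B / 2 * h ^ 3"
proof -
  have "0 \<le> B" using B[of a] h by auto
  define e where "e = (\<lambda>s. x s - (s - a) / 2 * (x1 a + x1 s))"
  define e' where "e' = (\<lambda>s. (x1 s - x1 a - (s - a) * x2 s) / 2)"
  have "\<bar>e (a + h) - e a\<bar> \<le> B / 2 * h\<^sup>2 * \<bar>a + h - a\<bar>"
  proof (rule increment_bound[where f' = e'])
    fix s assume s: "s \<in> {a..a + h}"
    show "(e has_real_derivative e' s) (at s within {a..a + h})"
      unfolding e_def e'_def
      by (rule derivative_eq_intros d0[OF s] d1[OF s] refl | simp)+ (simp add: field_simps)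
    have sub: "{a..s} \<subseteq> {a..a + h}" using s by auto
    have x2: "\<bar>x2 r - x2 s\<bar> \<le> B * h" if "r \<in> {a..s}" for r
    proof -
      have "\<bar>x2 r - x2 s\<bar> \<le> B * \<bar>r - s\<bar>"
        by (rule increment_bound[of a "a + h" x2 x3]) (use d2 B that s sub in auto)
      also have "\<dots> \<le> B * h" using that s \<open>0 \<le> B\<close> by (intro mult_left_mono) auto
      finally show ?thesis .
    qed
    have "\<bar>(x1 s - s * x2 s) - (x1 a - a * x2 s)\<bar> \<le> B * h * \<bar>s - a\<bar>"
    proof (rule increment_bound[where f' = "\<lambda>r. x2 r - x2 s" and a = a and b = s
          and f = "\<lambda>r. x1 r - r * x2 s"])
      fix r assume r: "r \<in> {a..s}"
      have "(x1 has_real_derivative x2 r) (at r within {a..s})"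
        using d1[of r] r sub by (meson DERIV_subset subsetD)
      then show "((\<lambda>r. x1 r - r * x2 s) has_real_derivative x2 r - x2 s) (at r within {a..s})"
        by (auto intro!: derivative_eq_intros)
      show "\<bar>x2 r - x2 s\<bar> \<le> B * h" by (rule x2[OF r])
    qed (use s in auto)
    also have "\<dots> \<le> B * h * h" using s \<open>0 \<le> B\<close> by (intro mult_left_mono) auto
    also have "(x1 s - s * x2 s) - (x1 a - a * x2 s) = 2 * e' s" by (simp add: e'_def algebra_simps)
    finally show "\<bar>e' s\<bar> \<le> B / 2 * h\<^sup>2" by (simp add: power2_eq_square)
  qed (use h in auto)
  moreover have "e (a + h) - e a = x (a + h) - x a - h / 2 * (x1 a + x1 (a + h))"
    by (simp add: e_def)
  ultimately show ?thesis using h by (simp add: power3_eq_cube power2_eq_square)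
qed

text \<open>
  Only second derivatives of \<open>y\<close> are used, which costs one order in \<open>h\<close>; a factor \<open>h\<close> in front of this error
  restores it where the estimate is applied.
\<close>

lemma midpoint_error:
  fixes y :: "real \<Rightarrow> real"
  assumes d0: "\<And>s. s \<in> {a..a + h} \<Longrightarrow> (y has_real_derivative y1 s) (at s within {a..a + h})"
    and d1: "\<And>s. s \<in> {a..a + h} \<Longrightarrow> (y1 has_real_derivative y2 s) (at s within {a..a + h})"
    and B: "\<And>s. s \<in> {a..a + h} \<Longrightarrow> \<bar>y2 s\<bar> \<le> B" and h: "0 \<le> h"
  shows "\<bar>y (a + h) - y a - h * y1 (a + h / 2)\<bar> \<le> B * h\<^sup>2"
proof -
  define c where "c = a + h / 2"
  have c: "c \<in> {a..a + h}" using h by (auto simp: c_def)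
  have "0 \<le> B" using B[of a] h by auto
  have "\<bar>(y (a + h) - (a + h) * y1 c) - (y a - a * y1 c)\<bar> \<le> B * h * \<bar>a + h - a\<bar>"
  proof (rule increment_bound[where f' = "\<lambda>r. y1 r - y1 c" and f = "\<lambda>r. y r - r * y1 c"])
    fix r assume r: "r \<in> {a..a + h}"
    show "((\<lambda>r. y r - r * y1 c) has_real_derivative y1 r - y1 c) (at r within {a..a + h})"
      using d0[OF r] by (auto intro!: derivative_eq_intros)
    have "\<bar>y1 r - y1 c\<bar> \<le> B * \<bar>r - c\<bar>"
      by (rule increment_bound[of a "a + h" y1 y2]) (use d1 B r c in auto)
    also have "\<dots> \<le> B * h" using r h \<open>0 \<le> B\<close> by (intro mult_left_mono) (auto simp: c_def)
    finally show "\<bar>y1 r - y1 c\<bar> \<le> B * h" .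
  qed (use h in auto)
  moreover have "(y (a + h) - (a + h) * y1 c) - (y a - a * y1 c) = y (a + h) - y a - h * y1 c"
    by (simp add: algebra_simps)
  ultimately show ?thesis using h by (simp add: power2_eq_square c_def)
qed

lemma D_word_linear_diff: "D_word m N \<beta> is (\<lambda>l. v l - w l) k = D_word m N \<beta> is v k - D_word m N \<beta> is w k"
proof (induction "is" arbitrary: k)
  case (Cons i "is")
  then have "D_word m N \<beta> is (\<lambda>l. v l - w l) = (\<lambda>k. D_word m N \<beta> is v k - D_word m N \<beta> is w k)"
    by auto
  then show ?case by (simp add: mat_vec_def right_diff_distrib sum_subtractf)
qed simp

lemma D_word_cong:
  assumes "\<And>l. l \<in> grid m N \<Longrightarrow> v l = w l" "k \<in> grid m N"
  shows "D_word m N \<beta> is v k = D_word m N \<beta> is w k"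
  using assms(2)
proof (induction "is" arbitrary: k)
  case (Cons i "is")
  then show ?case by (simp add: mat_vec_def cong: sum.cong)
qed (use assms in simp)

lemma mat_vec_has_derivative:
  assumes "\<And>l. l \<in> grid m N \<Longrightarrow> ((\<lambda>s. v s l) has_real_derivative v' l) (at t within A)"
  shows "((\<lambda>s. mat_vec m N B (v s) k) has_real_derivative mat_vec m N B v' k) (at t within A)"
  unfolding mat_vec_def using assms by (intro DERIV_sum DERIV_cmult) auto

lemma D_word_has_derivative:
  assumes "\<And>l. l \<in> grid m N \<Longrightarrow> ((\<lambda>s. v s l) has_real_derivative v' l) (at t within A)" and "k \<in> grid m N"
  shows "((\<lambda>s. D_word m N \<beta> is (v s) k) has_real_derivative D_word m N \<beta> is v' k) (at t within A)"
  using assms(2)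
proof (induction "is" arbitrary: k)
  case (Cons i "is")
  then show ?case by (auto intro!: mat_vec_has_derivative)
qed (use assms in simp)

lemma has_derivative_shift:
  fixes f :: "real \<Rightarrow> real"
  assumes "\<And>s. s \<in> {0..T} \<Longrightarrow> (f has_real_derivative f' s) (at s within {0..T})"
    and "0 \<le> a" "t \<in> {0..T - a}"
  shows "((\<lambda>t. f (t + a)) has_real_derivative f' (t + a)) (at t within {0..T - a})"
proof -
  have "(f has_real_derivative f' (t + a)) (at (t + a) within (\<lambda>t. t + a) ` {0..T - a})"
    using assms by (intro DERIV_subset[OF assms(1)]) auto
  moreover have "((\<lambda>t. t + a) has_real_derivative 1) (at t within {0..T - a})"
    by (auto intro!: derivative_eq_intros)
  ultimately show ?thesis using DERIV_image_chain[of f _ "\<lambda>t. t + a" t "{0..T - a}" 1] by (simp add: o_def)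
qed

text \<open>
  Here \<open>V i\<close> is the \<open>i\<close>-th time derivative of the trajectory, so that \<open>V 2 - D (V 1)\<close> is the time derivative
  of the source. Passing the whole sequence makes the time derivative of the defect again a defect, of the
  shifted sequence.
\<close>

definition defect ::
  "nat \<Rightarrow> (nat \<Rightarrow> nat) \<Rightarrow> (nat \<Rightarrow> real) \<Rightarrow> real \<Rightarrow> (nat \<Rightarrow> real \<Rightarrow> (nat \<Rightarrow> nat) \<Rightarrow> real) \<Rightarrow> real \<Rightarrow> (nat \<Rightarrow> nat) \<Rightarrow> real" where
  "defect m N \<beta> \<tau> V t k =
     factored_apply m N \<beta> (\<tau> / 2) (\<lambda>l. V 0 (t + \<tau>) l - V 0 t l) k - \<tau> * V 1 t k
     - \<tau>\<^sup>2 / 2 * (V 2 (t + \<tau> / 2) k - mat_vec m N (D_total m N \<beta>) (V 1 (t + \<tau> / 2)) k)"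

lemma defect_has_derivative:
  assumes V: "\<And>i s l. \<lbrakk>i \<le> 2; s \<in> {0..T}; l \<in> grid m N\<rbrakk>
      \<Longrightarrow> ((\<lambda>s. V i s l) has_real_derivative V (Suc i) s l) (at s within {0..T})"
    and "0 \<le> \<tau>" "t \<in> {0..T - \<tau>}" and k: "k \<in> grid m N"
  shows "((\<lambda>t. defect m N \<beta> \<tau> V t k) has_real_derivative defect m N \<beta> \<tau> (\<lambda>i. V (Suc i)) t k)
           (at t within {0..T - \<tau>})"
proof -
  have sh: "((\<lambda>t. V i (t + a) l) has_real_derivative V (Suc i) (t + a) l) (at t within {0..T - \<tau>})"
    if "i \<le> 2" "0 \<le> a" "a \<le> \<tau>" "l \<in> grid m N" for i a l
  proof (rule DERIV_subset)
    show "((\<lambda>t. V i (t + a) l) has_real_derivative V (Suc i) (t + a) l) (at t within {0..T - a})"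
      using V that assms(2,3) by (intro has_derivative_shift) auto
  qed (use that in auto)
  have sh0: "((\<lambda>t. V i t l) has_real_derivative V (Suc i) t l) (at t within {0..T - \<tau>})"
    if "i \<le> 2" "l \<in> grid m N" for i l
    using sh[of i 0 l] that assms(2) by simp
  have "((\<lambda>t. factored_apply m N \<beta> (\<tau> / 2) (\<lambda>l. V 0 (t + \<tau>) l - V 0 t l) k) has_real_derivative
      factored_apply m N \<beta> (\<tau> / 2) (\<lambda>l. V 1 (t + \<tau>) l - V 1 t l) k) (at t within {0..T - \<tau>})"
    unfolding factored_apply_def
    using sh[of 0 \<tau>] sh0[of 0] assms(2) k
    by (intro DERIV_sum DERIV_cmult D_word_has_derivative DERIV_diff) auto
  moreover have "((\<lambda>t. \<tau> * V 1 t k) has_real_derivative \<tau> * V 2 t k) (at t within {0..T - \<tau>})"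
    using sh0[of 1 k] k by (intro DERIV_cmult) (auto simp: numeral_2_eq_2)
  moreover have "((\<lambda>t. \<tau>\<^sup>2 / 2 * (V 2 (t + \<tau> / 2) k - mat_vec m N (D_total m N \<beta>) (V 1 (t + \<tau> / 2)) k))
      has_real_derivative
        \<tau>\<^sup>2 / 2 * (V 3 (t + \<tau> / 2) k - mat_vec m N (D_total m N \<beta>) (V 2 (t + \<tau> / 2)) k)) (at t within {0..T - \<tau>})"
    using sh[of 2 "\<tau> / 2"] sh[of 1 "\<tau> / 2"] assms(2) k
    by (intro DERIV_cmult DERIV_diff mat_vec_has_derivative) (auto simp: numeral_2_eq_2 numeral_3_eq_3)
  ultimately show ?thesis
    unfolding defect_def by (auto intro!: DERIV_diff simp: numeral_2_eq_2 numeral_3_eq_3)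
qed

text \<open>
  Writing \<open>y = V 1 - D (V 0)\<close> for the source, the sets of at most one direction contribute
  \<open>\<Delta> (V 0) - \<tau>/2 (\<Delta> (V 1) - \<Delta> y)\<close>. Together with the subtracted terms this is the trapezoidal error of \<open>V 0\<close>
  plus \<open>\<tau>/2\<close> times the midpoint error of \<open>y\<close>; here \<open>\<theta> = 1/2\<close> is essential. Larger sets carry the factor
  \<open>(\<tau>/2) ^ card S\<close>, which supplies \<open>\<tau>\<^sup>2\<close>, and an increment of \<open>D_word\<close>, which supplies another \<open>\<tau>\<close>.
\<close>

lemma defect_bound:
  assumes V: "\<And>i s l. \<lbrakk>i \<le> 2; s \<in> {0..T}; l \<in> grid m N\<rbrakk>
      \<Longrightarrow> ((\<lambda>s. V i s l) has_real_derivative V (Suc i) s l) (at s within {0..T})"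
    and \<tau>: "0 < \<tau>" "t \<in> {0..T - \<tau>}" and k: "k \<in> grid m N"
    and C: "\<And>s. s \<in> {0..T} \<Longrightarrow> \<bar>V 3 s k\<bar> \<le> C"
      "\<And>s. s \<in> {0..T} \<Longrightarrow> \<bar>V 3 s k - mat_vec m N (D_total m N \<beta>) (V 2 s) k\<bar> \<le> C"
    and C2: "\<And>s S. \<lbrakk>s \<in> {0..T}; S \<subseteq> {1..m}; 2 \<le> card S\<rbrakk>
      \<Longrightarrow> \<bar>D_word m N \<beta> (sorted_list_of_set S) (V 1 s) k\<bar> \<le> C2"
  shows "\<bar>defect m N \<beta> \<tau> V t k\<bar> \<le> (C + 2 ^ m * (max 1 T ^ m * \<bar>C2\<bar>)) * \<tau> ^ 3"
proof -
  let ?D = "mat_vec m N (D_total m N \<beta>)"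
  let ?W = "\<lambda>S. D_word m N \<beta> (sorted_list_of_set S)"
  define \<Delta> where "\<Delta> = (\<lambda>l. V 0 (t + \<tau>) l - V 0 t l)"
  define Q where "Q = {S \<in> Pow {1..m}. 2 \<le> card S}"
  have sub: "{t..t + \<tau>} \<subseteq> {0..T}" using \<tau> by auto
  have V': "((\<lambda>s. V i s l) has_real_derivative V (Suc i) s l) (at s within {t..t + \<tau>})"
    if "i \<le> 2" "s \<in> {t..t + \<tau>}" "l \<in> grid m N" for i s l
    using V[OF that(1) _ that(3), of s] that(2) sub by (meson DERIV_subset subsetD)
  define y where "y = (\<lambda>i s. V (Suc i) s k - ?D (V i s) k)"
  have y': "(y i has_real_derivative y (Suc i) s) (at s within {t..t + \<tau>})"
    if "i \<le> 1" "s \<in> {t..t + \<tau>}" for i s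
    unfolding y_def using that k V'[of "Suc i" s k] V'[of i s]
    by (intro DERIV_diff mat_vec_has_derivative) auto
  have trap: "\<bar>V 0 (t + \<tau>) k - V 0 t k - \<tau> / 2 * (V 1 t k + V 1 (t + \<tau>) k)\<bar> \<le> C / 2 * \<tau> ^ 3"
    by (rule trapezoidal_error[where x = "\<lambda>s. V 0 s k" and ?x1.0 = "\<lambda>s. V 1 s k" and ?x2.0 = "\<lambda>s. V 2 s k"
         and ?x3.0 = "\<lambda>s. V 3 s k"])
       (use V'[of 0] V'[of 1] V'[of 2] k C(1) sub \<tau> in \<open>auto simp: numeral_2_eq_2 numeral_3_eq_3\<close>)
  have mid: "\<bar>y 0 (t + \<tau>) - y 0 t - \<tau> * y 1 (t + \<tau> / 2)\<bar> \<le> C * \<tau>\<^sup>2"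
    by (rule midpoint_error[where ?y2.0 = "y 2"])
       (use y'[of 0] y'[of 1] k C(2) sub \<tau> in \<open>auto simp: y_def numeral_2_eq_2 numeral_3_eq_3\<close>)
  have small: "(\<Sum>S\<in>Pow {1..m} - Q. (- (\<tau> / 2)) ^ card S * ?W S \<Delta> k) = \<Delta> k - \<tau> / 2 * ?D \<Delta> k"
  proof -
    have "Pow {1..m} - Q = insert {} ((\<lambda>j. {j}) ` {1..m})"
    proof (intro equalityI subsetI)
      fix S assume S: "S \<in> Pow {1..m} - Q"
      then have "finite S" using finite_subset by auto
      moreover have "card S < 2" using S by (auto simp: Q_def)
      then have "card S = 0 \<or> card S = 1" by auto
      ultimately show "S \<in> insert {} ((\<lambda>j. {j}) ` {1..m})"
        using S by (auto simp: card_1_singleton_iff)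
    qed (auto simp: Q_def)
    moreover have "(\<Sum>S\<in>(\<lambda>j. {j}) ` {1..m}. (- (\<tau> / 2)) ^ card S * ?W S \<Delta> k)
        = (\<Sum>j\<in>{1..m}. - (\<tau> / 2) * mat_vec m N (D_mat m N \<beta> j) \<Delta> k)"
      by (subst sum.reindex) auto
    moreover have "(\<Sum>S\<in>insert {} ((\<lambda>j. {j}) ` {1..m}). (- (\<tau> / 2)) ^ card S * ?W S \<Delta> k)
        = \<Delta> k + (\<Sum>S\<in>(\<lambda>j. {j}) ` {1..m}. (- (\<tau> / 2)) ^ card S * ?W S \<Delta> k)"
      by (subst sum.insert) auto
    ultimately show ?thesis
      by (simp add: mat_vec_D_total sum_distrib_left sum_negf)
  qed
  have \<Delta>D: "?D \<Delta> k = ?D (V 0 (t + \<tau>)) k - ?D (V 0 t) k"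
    by (simp add: \<Delta>_def mat_vec_def right_diff_distrib sum_subtractf)
  have \<Delta>k: "\<Delta> k = V 0 (t + \<tau>) k - V 0 t k" by (simp add: \<Delta>_def)
  have F: "factored_apply m N \<beta> (\<tau> / 2) \<Delta> k = \<Delta> k - \<tau> / 2 * ?D \<Delta> k
      + (\<Sum>S\<in>Q. (- (\<tau> / 2)) ^ card S * ?W S \<Delta> k)"
    unfolding factored_apply_def small[symmetric]
    by (subst sum.subset_diff[of Q]) (auto simp: Q_def)
  have split: "defect m N \<beta> \<tau> V t k
      = (V 0 (t + \<tau>) k - V 0 t k - \<tau> / 2 * (V 1 t k + V 1 (t + \<tau>) k))
        + \<tau> / 2 * (y 0 (t + \<tau>) - y 0 t - \<tau> * y 1 (t + \<tau> / 2))
        + (\<Sum>S\<in>Q. (- (\<tau> / 2)) ^ card S * ?W S \<Delta> k)"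
    unfolding defect_def \<Delta>_def[symmetric] F \<Delta>D \<Delta>k
    by (simp add: y_def numeral_2_eq_2 power2_eq_square algebra_simps)
  have large: "\<bar>(- (\<tau> / 2)) ^ card S * ?W S \<Delta> k\<bar> \<le> max 1 T ^ m * \<bar>C2\<bar> * \<tau> ^ 3" if S: "S \<in> Q" for S
  proof -
    have S': "S \<subseteq> {1..m}" "2 \<le> card S" using S by (auto simp: Q_def)
    have cm: "card S \<le> m" using card_mono[OF _ S'(1)] by simp
    have "\<bar>?W S (V 0 (t + \<tau>)) k - ?W S (V 0 t) k\<bar> \<le> C2 * \<bar>t + \<tau> - t\<bar>"
    proof (rule increment_bound)
      fix s assume s: "s \<in> {t..t + \<tau>}"
      show "((\<lambda>s. ?W S (V 0 s) k) has_real_derivative ?W S (V 1 s) k) (at s within {t..t + \<tau>})"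
        using V'[of 0 s] s k by (intro D_word_has_derivative) auto
      show "\<bar>?W S (V 1 s) k\<bar> \<le> C2" using s sub S' by (intro C2) auto
    qed (use \<tau> in auto)
    also have "C2 * \<bar>t + \<tau> - t\<bar> \<le> \<bar>C2\<bar> * \<tau>" using \<tau> by (simp add: mult_right_mono)
    finally have W: "\<bar>?W S \<Delta> k\<bar> \<le> \<bar>C2\<bar> * \<tau>"
      unfolding \<Delta>_def D_word_linear_diff .
    have "(\<tau> / 2) ^ card S = (\<tau> / 2)\<^sup>2 * (\<tau> / 2) ^ (card S - 2)"
      using S'(2) by (metis le_add_diff_inverse power_add)
    also have "\<dots> \<le> \<tau>\<^sup>2 * max 1 T ^ m"
    proof (rule mult_mono)
      have "(\<tau> / 2) ^ (card S - 2) \<le> max 1 T ^ (card S - 2)" using \<tau> by (intro power_mono) auto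
      also have "\<dots> \<le> max 1 T ^ m" using cm by (intro power_increasing) auto
      finally show "(\<tau> / 2) ^ (card S - 2) \<le> max 1 T ^ m" .
    qed (use \<tau> in \<open>auto intro!: power_mono\<close>)
    finally have "(\<tau> / 2) ^ card S * \<bar>?W S \<Delta> k\<bar> \<le> \<tau>\<^sup>2 * max 1 T ^ m * (\<bar>C2\<bar> * \<tau>)"
      using W \<tau> by (intro mult_mono) auto
    then show ?thesis using \<tau> by (simp add: abs_mult power_abs power3_eq_cube power2_eq_square mult_ac)
  qed
  have "\<bar>\<Sum>S\<in>Q. (- (\<tau> / 2)) ^ card S * ?W S \<Delta> k\<bar> \<le> (\<Sum>S\<in>Q. max 1 T ^ m * \<bar>C2\<bar> * \<tau> ^ 3)"
    by (intro order_trans[OF sum_abs] sum_mono large)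
  also have "\<dots> \<le> 2 ^ m * (max 1 T ^ m * \<bar>C2\<bar> * \<tau> ^ 3)"
  proof -
    have "card Q \<le> card (Pow {1..m})" unfolding Q_def by (intro card_mono) auto
    then have "card Q \<le> 2 ^ m" by (simp add: card_Pow)
    then have "real (card Q) \<le> 2 ^ m" using of_nat_mono[of "card Q" "2 ^ m"] by simp
    then show ?thesis unfolding sum_constant using \<tau> by (intro mult_right_mono) auto
  qed
  finally have rest: "\<bar>\<Sum>S\<in>Q. (- (\<tau> / 2)) ^ card S * ?W S \<Delta> k\<bar> \<le> 2 ^ m * (max 1 T ^ m * \<bar>C2\<bar> * \<tau> ^ 3)" .
  have "\<bar>\<tau> / 2 * (y 0 (t + \<tau>) - y 0 t - \<tau> * y 1 (t + \<tau> / 2))\<bar> \<le> \<tau> / 2 * (C * \<tau>\<^sup>2)"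
    unfolding abs_mult using mid \<tau> by (intro mult_mono) auto
  also have "\<dots> = C / 2 * \<tau> ^ 3" by (simp add: power3_eq_cube power2_eq_square)
  finally have "\<bar>defect m N \<beta> \<tau> V t k\<bar> \<le> C / 2 * \<tau> ^ 3 + C / 2 * \<tau> ^ 3 + 2 ^ m * (max 1 T ^ m * \<bar>C2\<bar> * \<tau> ^ 3)"
    unfolding split using trap rest by linarith
  then show ?thesis by (simp add: algebra_simps)
qed

section \<open>From the recursion to the global error\<close>

lemma sine_synth_add: "sine_synth m N (\<lambda>p. c p + c' p) k = sine_synth m N c k + sine_synth m N c' k"
  by (simp add: sine_synth_def distrib_right sum.distrib)

lemma sine_synth_scale: "sine_synth m N (\<lambda>p. a * c p) k = a * sine_synth m N c k"
  by (simp add: sine_synth_def sum_distrib_left mult.assoc)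

lemma sine_synth_sum: "sine_synth m N (\<lambda>p. \<Sum>i\<in>A. c i p) k = (\<Sum>i\<in>A. sine_synth m N (c i) k)"
  unfolding sine_synth_def sum_distrib_right by (rule sum.swap)

lemma sine_synth_cong:
  "(\<And>p. p \<in> grid m N \<Longrightarrow> c p = c' p) \<Longrightarrow> sine_synth m N c k = sine_synth m N c' k"
  by (simp add: sine_synth_def)

text \<open>
  The affine recursion has the moving fixed point \<open>e n\<close>: the deviation \<open>E n - e n\<close> is multiplied by \<open>r\<close> and then
  changed by \<open>- (e (n+1) - e n)\<close>.
\<close>

lemma recursion_summation_by_parts:
  fixes E e :: "nat \<Rightarrow> real"
  assumes "\<And>n. n \<le> n0 \<Longrightarrow> E (Suc n) = r * (E n - e n) + e n"
  shows "E (Suc n0) = e n0 + r ^ Suc n0 * (E 0 - e 0) - (\<Sum>i<n0. r ^ (n0 - i) * (e (Suc i) - e i))"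
  using assms
proof (induction n0)
  case 0
  then show ?case by simp
next
  case (Suc n)
  have IH: "E (Suc n) = e n + r ^ Suc n * (E 0 - e 0) - (\<Sum>i<n. r ^ (n - i) * (e (Suc i) - e i))"
    using Suc.IH Suc.prems by simp
  have "(\<Sum>i<Suc n. r ^ (Suc n - i) * (e (Suc i) - e i))
      = r * (\<Sum>i<n. r ^ (n - i) * (e (Suc i) - e i)) + r * (e (Suc n) - e n)"
    by (simp add: sum_distrib_left mult.assoc Suc_diff_le)
  then show ?case
    using Suc.prems[of "Suc n"] IH by (simp add: algebra_simps)
qed

text \<open>
  With \<open>e n = (\<tau> D)\<^sup>-\<^sup>1 (d n)\<close> the recursion takes the form required by \<open>recursion_summation_by_parts\<close>. Every term
  of the result contains exactly one factor \<open>R ^ i D\<^sup>-\<^sup>1\<close>, and there are fewer than \<open>T / \<tau>\<close> terms in the sum.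
\<close>

lemma amf_error_bound:
  fixes E d :: "nat \<Rightarrow> (nat \<Rightarrow> nat) \<Rightarrow> real"
  defines "\<mu> \<equiv> \<lambda>N \<beta> p j. eigenvalue (N j) (\<beta> j) (real (p j)) :: real"
  assumes m: "1 \<le> m" and \<tau>: "0 < \<tau>" and b: "0 < b" "\<And>j. j \<in> {1..m} \<Longrightarrow> b \<le> \<beta> j"
    and N: "\<And>j. j \<in> {1..m} \<Longrightarrow> 1 \<le> N j"
    and T: "real nstar * \<tau> = T"
    and rec: "\<And>n p. \<lbrakk>n < nstar; p \<in> grid m N\<rbrakk> \<Longrightarrow> sine_coeff m N (E (Suc n)) p
        = amf_symbol m \<tau> (\<mu> N \<beta> p) * sine_coeff m N (E n) p
          - sine_coeff m N (d n) p / (\<Prod>j\<in>{1..m}. 1 + \<tau> / 2 * \<mu> N \<beta> p j)"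
    and d: "\<And>n k. \<lbrakk>n < nstar; k \<in> grid m N\<rbrakk> \<Longrightarrow> \<bar>d n k\<bar> \<le> K * \<tau> ^ 3"
    and d': "\<And>n k. \<lbrakk>Suc n < nstar; k \<in> grid m N\<rbrakk> \<Longrightarrow> \<bar>d (Suc n) k - d n k\<bar> \<le> K' * \<tau> ^ 4"
    and E0: "\<And>k. k \<in> grid m N \<Longrightarrow> \<bar>mat_vec m N (D_total m N \<beta>) (E 0) k\<bar> \<le> K0 * \<tau>\<^sup>2"
    and n: "n \<in> {1..nstar}" and k: "k \<in> grid m N" and K': "0 \<le> K'"
  shows "\<bar>E n k\<bar> \<le> multiplier_constant m b * (2 * K + K0 + K' * T) * \<tau>\<^sup>2"
proof -
  define A where "A = (\<lambda>i p. amf_resolvent m N \<beta> \<tau> i (\<lambda>j. real (p j)) :: real)"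
  define M where "M = multiplier_constant m b"
  define S where "S = (\<lambda>p. \<Sum>j\<in>{1..m}. \<mu> N \<beta> p j)"
  define r where "r = (\<lambda>p. amf_symbol m \<tau> (\<mu> N \<beta> p))"
  define w0 where "w0 = (\<lambda>k. (-1) * mat_vec m N (D_total m N \<beta>) (E 0) k + (1 / \<tau>) * d 0 k)"
  obtain n0 where n0: "n = Suc n0" "n0 < nstar" using n by (cases n) auto
  have bound: "\<bar>sine_synth m N (\<lambda>p. A i p * sine_coeff m N v p) k\<bar> \<le> M * W"
    if "\<And>l. l \<in> grid m N \<Longrightarrow> \<bar>v l\<bar> \<le> W" for i v W
    unfolding A_def M_def using m \<tau> b N k that by (rule amf_resolvent_max_norm_bound)
  have coeff: "sine_coeff m N (E n) p = (- (1 / \<tau>)) * (A 0 p * sine_coeff m N (d n0) p)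
      + A n p * sine_coeff m N w0 p
      + (1 / \<tau>) * (\<Sum>i<n0. A (n0 - i) p * sine_coeff m N (\<lambda>k. d (Suc i) k - d i k) p)"
    if p: "p \<in> grid m N" for p
  proof -
    have pos: "0 < \<mu> N \<beta> p j" if "j \<in> {1..m}" for j
      unfolding \<mu>_def using p that b(1) b(2)[OF that]
      by (intro eigenvalue_pos) (auto simp: grid_def PiE_iff)
    have Sp: "0 < S p" unfolding S_def using m pos by (intro sum_pos) auto
    have "0 < (\<Prod>j\<in>{1..m}. 1 + \<tau> / 2 * \<mu> N \<beta> p j)"
      using pos \<tau> by (intro prod_pos) (auto intro!: add_pos_pos)
    then obtain P where P: "P = (\<Prod>j\<in>{1..m}. 1 + \<tau> / 2 * \<mu> N \<beta> p j)" "0 < P" by blast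
    have rP: "r p = 1 - \<tau> * S p / P"
      unfolding r_def amf_symbol_def S_def P(1) by simp
    have Ap: "A i p = r p ^ i / S p" for i
      unfolding A_def amf_resolvent_def r_def S_def \<mu>_def ..
    define c where "c = (\<lambda>i. sine_coeff m N (d i) p)"
    define e where "e = (\<lambda>i. - c i / (\<tau> * S p))"
    have "sine_coeff m N (E (Suc i)) p = r p * (sine_coeff m N (E i) p - e i) + e i" if "i \<le> n0" for i
    proof -
      have "i < nstar" using that n0 by simp
      from rec[OF this p] have "sine_coeff m N (E (Suc i)) p = r p * sine_coeff m N (E i) p - c i / P"
        by (simp add: r_def c_def P(1))
      moreover have "(1 - r p) * e i = - c i / P"
        using \<tau> Sp P(2) by (simp add: rP e_def)
      ultimately show ?thesis by (simp add: algebra_simps)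
    qed
    from recursion_summation_by_parts[of n0 "\<lambda>i. sine_coeff m N (E i) p", OF this]
    have "sine_coeff m N (E n) p = e n0 + r p ^ n * (sine_coeff m N (E 0) p - e 0)
        - (\<Sum>i<n0. r p ^ (n0 - i) * (e (Suc i) - e i))" by (simp add: n0)
    moreover have "e n0 = (- (1 / \<tau>)) * (A 0 p * c n0)"
      by (simp add: e_def Ap)
    moreover have "r p ^ n * (sine_coeff m N (E 0) p - e 0) = A n p * sine_coeff m N w0 p"
    proof -
      have "sine_coeff m N w0 p = S p * sine_coeff m N (E 0) p + c 0 / \<tau>"
        unfolding w0_def sine_coeff_add sine_coeff_scale sine_coeff_D_total S_def \<mu>_def c_def by simp
      then have "sine_coeff m N w0 p / S p = sine_coeff m N (E 0) p - e 0"
        using Sp by (simp add: e_def add_divide_distrib)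
      then show ?thesis unfolding Ap by (simp flip: times_divide_eq_right)
    qed
    moreover have "(\<Sum>i<n0. r p ^ (n0 - i) * (e (Suc i) - e i))
        = - ((1 / \<tau>) * (\<Sum>i<n0. A (n0 - i) p * sine_coeff m N (\<lambda>k. d (Suc i) k - d i k) p))"
      unfolding sum_distrib_left sum_negf[symmetric]
    proof (rule sum.cong)
      fix i
      have ei: "e (Suc i) - e i = - ((c (Suc i) - c i) / (\<tau> * S p))"
        by (simp add: e_def diff_divide_distrib)
      have cancel: "\<rho> * (- (x / (\<tau> * S p))) = - (1 / \<tau> * (\<rho> / S p * x))" for \<rho> x :: real by simp
      show "r p ^ (n0 - i) * (e (Suc i) - e i)
          = - (1 / \<tau> * (A (n0 - i) p * sine_coeff m N (\<lambda>k. d (Suc i) k - d i k) p))"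
        unfolding sine_coeff_diff Ap ei c_def by (rule cancel)
    qed simp
    ultimately show ?thesis by (simp only: c_def)
  qed
  have "E n k = sine_synth m N (sine_coeff m N (E n)) k"
    using sine_inversion[OF k] by simp
  also have "\<dots> = sine_synth m N (\<lambda>p. (- (1 / \<tau>)) * (A 0 p * sine_coeff m N (d n0) p)
      + A n p * sine_coeff m N w0 p
      + (1 / \<tau>) * (\<Sum>i<n0. A (n0 - i) p * sine_coeff m N (\<lambda>k. d (Suc i) k - d i k) p)) k"
    by (rule sine_synth_cong) (rule coeff)
  also have "\<dots> = (- (1 / \<tau>)) * sine_synth m N (\<lambda>p. A 0 p * sine_coeff m N (d n0) p) k
      + sine_synth m N (\<lambda>p. A n p * sine_coeff m N w0 p) k
      + (1 / \<tau>) * (\<Sum>i<n0. sine_synth m N (\<lambda>p. A (n0 - i) p * sine_coeff m N (\<lambda>k. d (Suc i) k - d i k) p) k)"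
    by (simp only: sine_synth_add sine_synth_scale sine_synth_sum)
  finally have En: "E n k = \<dots>" .
  \<comment> \<open>The contributions of the last defect, of the initial data, and of the differences of defects.\<close>
  define x where "x = sine_synth m N (\<lambda>p. A 0 p * sine_coeff m N (d n0) p) k"
  define y where "y = sine_synth m N (\<lambda>p. A n p * sine_coeff m N w0 p) k"
  define z where "z = (\<Sum>i<n0. sine_synth m N (\<lambda>p. A (n0 - i) p * sine_coeff m N (\<lambda>k. d (Suc i) k - d i k) p) k)"
  have M0: "0 \<le> M * 1" by (intro order_trans[OF abs_ge_zero bound[of "\<lambda>_. 0" 1 0]]) auto
  have x: "\<bar>x\<bar> \<le> M * (K * \<tau> ^ 3)"
    unfolding x_def by (intro bound d n0)
  have y: "\<bar>y\<bar> \<le> M * (K0 * \<tau>\<^sup>2 + K * \<tau>\<^sup>2)"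
    unfolding y_def
  proof (rule bound)
    fix l assume l: "l \<in> grid m N"
    have "\<bar>w0 l\<bar> \<le> \<bar>mat_vec m N (D_total m N \<beta>) (E 0) l\<bar> + 1 / \<tau> * \<bar>d 0 l\<bar>"
      unfolding w0_def using \<tau> by (intro order_trans[OF abs_triangle_ineq]) (simp add: abs_mult)
    also have "\<dots> \<le> K0 * \<tau>\<^sup>2 + 1 / \<tau> * (K * \<tau> ^ 3)"
      using \<tau> n0 by (intro add_mono mult_left_mono E0 d l) auto
    also have "1 / \<tau> * (K * \<tau> ^ 3) = K * \<tau>\<^sup>2" using \<tau> by (simp add: power3_eq_cube power2_eq_square)
    finally show "\<bar>w0 l\<bar> \<le> K0 * \<tau>\<^sup>2 + K * \<tau>\<^sup>2" .
  qed
  have z: "\<bar>z\<bar> \<le> M * (K' * T * \<tau> ^ 3)"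
  proof -
    have "\<bar>z\<bar> \<le> (\<Sum>i<n0. M * (K' * \<tau> ^ 4))"
      unfolding z_def using n0 by (intro order_trans[OF sum_abs] sum_mono bound d') auto
    also have "\<dots> = M * (K' * (real n0 * \<tau>) * \<tau> ^ 3)"
      by (simp add: power4_eq_xxxx power3_eq_cube)
    also have "\<dots> \<le> M * (K' * T * \<tau> ^ 3)"
    proof -
      have "real n0 * \<tau> \<le> T" unfolding T[symmetric] using n0 \<tau> by (intro mult_right_mono) auto
      then show ?thesis using M0 K' \<tau> by (intro mult_left_mono mult_right_mono) auto
    qed
    finally show ?thesis .
  qed
  have "\<bar>E n k\<bar> \<le> 1 / \<tau> * \<bar>x\<bar> + \<bar>y\<bar> + 1 / \<tau> * \<bar>z\<bar>"
    unfolding En x_def[symmetric] y_def[symmetric] z_def[symmetric] using \<tau>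
    by (intro order_trans[OF abs_triangle_ineq] add_mono) (auto simp: abs_mult)
  also have "\<dots> \<le> 1 / \<tau> * (M * (K * \<tau> ^ 3)) + M * (K0 * \<tau>\<^sup>2 + K * \<tau>\<^sup>2) + 1 / \<tau> * (M * (K' * T * \<tau> ^ 3))"
    using x y z \<tau> by (intro add_mono mult_left_mono) auto
  also have "\<dots> = M * (2 * K + K0 + K' * T) * \<tau>\<^sup>2"
    using \<tau> by (simp add: power3_eq_cube power2_eq_square algebra_simps)
  finally show ?thesis by (simp add: M_def)
qed

text \<open>
  Subtracting the defect equation from the step, both multiplied by \<open>P\<close>: the sources cancel because the
  trajectory \<open>V 0\<close> solves the semidiscrete system.
\<close>

lemma amf_error_recursion:
  defines "\<mu> \<equiv> \<lambda>N \<beta> p j. eigenvalue (N j) (\<beta> j) (real (p j)) :: real"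
  assumes step: "amf_w_step T m \<beta> N g (1 / 2) \<tau> t Y Y'" and m: "1 \<le> m" and \<tau>: "0 < \<tau>"
    and \<beta>: "\<And>j. j \<in> {1..m} \<Longrightarrow> 0 < \<beta> j"
    and g: "\<And>j k. \<lbrakk>j \<in> {2..m}; k \<in> grid m N\<rbrakk> \<Longrightarrow> time_deriv T (g j) (t + \<tau> / 2) k = 0"
    and ode: "\<And>k. k \<in> grid m N \<Longrightarrow> sum_parts m g t k = V 1 t k - mat_vec m N (D_total m N \<beta>) (V 0 t) k"
    and ode': "\<And>k. k \<in> grid m N \<Longrightarrow> time_deriv T (g 1) (t + \<tau> / 2) k
        = V 2 (t + \<tau> / 2) k - mat_vec m N (D_total m N \<beta>) (V 1 (t + \<tau> / 2)) k"
    and p: "p \<in> grid m N"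
  shows "sine_coeff m N (\<lambda>k. Y' k - V 0 (t + \<tau>) k) p
      = amf_symbol m \<tau> (\<mu> N \<beta> p) * sine_coeff m N (\<lambda>k. Y k - V 0 t k) p
        - sine_coeff m N (defect m N \<beta> \<tau> V t) p / (\<Prod>j\<in>{1..m}. 1 + \<tau> / 2 * \<mu> N \<beta> p j)"
proof -
  let ?c = "\<lambda>v. sine_coeff m N v p"
  define S where "S = (\<Sum>j\<in>{1..m}. \<mu> N \<beta> p j)"
  define P where "P = (\<Prod>j\<in>{1..m}. 1 + \<tau> / 2 * \<mu> N \<beta> p j)"
  have pos: "0 < \<mu> N \<beta> p j" if "j \<in> {1..m}" for j
    unfolding \<mu>_def using p that \<beta>[OF that] by (intro eigenvalue_pos) (auto simp: grid_def PiE_iff)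
  have pos1: "0 < 1 + \<tau> / 2 * \<mu> N \<beta> p j" if "j \<in> {1..m}" for j
    using pos[OF that] \<tau> by (intro add_pos_pos) auto
  have P0: "0 < P" unfolding P_def using pos1 by (intro prod_pos) auto
  have "P * (?c Y' - ?c Y) = \<tau> * (?c (sum_parts m g t) - S * ?c Y)
      + \<tau>\<^sup>2 / 2 * ?c (time_deriv T (g 1) (t + \<tau> / 2))"
    using amf_w_step_coeff[OF step m g, of p] pos1
    unfolding P_def S_def \<mu>_def by (force simp: field_simps)
  moreover have "?c (sum_parts m g t) = ?c (V 1 t) + S * ?c (V 0 t)"
  proof -
    have "?c (sum_parts m g t) = ?c (\<lambda>k. V 1 t k - mat_vec m N (D_total m N \<beta>) (V 0 t) k)"
      by (rule sine_coeff_cong) (rule ode)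
    then show ?thesis by (simp add: sine_coeff_diff sine_coeff_D_total S_def \<mu>_def)
  qed
  moreover have "?c (defect m N \<beta> \<tau> V t)
      = P * (?c (V 0 (t + \<tau>)) - ?c (V 0 t)) - \<tau> * ?c (V 1 t) - \<tau>\<^sup>2 / 2 * ?c (time_deriv T (g 1) (t + \<tau> / 2))"
  proof -
    have "?c (time_deriv T (g 1) (t + \<tau> / 2))
        = ?c (\<lambda>k. V 2 (t + \<tau> / 2) k - mat_vec m N (D_total m N \<beta>) (V 1 (t + \<tau> / 2)) k)"
      by (rule sine_coeff_cong) (rule ode')
    then show ?thesis
      unfolding defect_def
      by (simp only: sine_coeff_diff sine_coeff_scale sine_coeff_factored_apply P_def \<mu>_def)
  qed
  ultimately have "P * (?c Y' - ?c (V 0 (t + \<tau>)))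
      = P * (?c Y - ?c (V 0 t)) - \<tau> * S * (?c Y - ?c (V 0 t)) - ?c (defect m N \<beta> \<tau> V t)"
    by (simp add: algebra_simps)
  then have "?c Y' - ?c (V 0 (t + \<tau>))
      = (P * (?c Y - ?c (V 0 t)) - \<tau> * S * (?c Y - ?c (V 0 t)) - ?c (defect m N \<beta> \<tau> V t)) / P"
    using P0 by (simp add: eq_divide_eq mult.commute)
  also have "\<dots> = (1 - \<tau> * S / P) * (?c Y - ?c (V 0 t)) - ?c (defect m N \<beta> \<tau> V t) / P"
    using P0 by (simp add: diff_divide_distrib left_diff_distrib)
  finally show ?thesis
    by (simp add: sine_coeff_diff amf_symbol_def S_def P_def)
qed

section \<open>The trajectory of the semidiscrete system\<close>

lemma abs_le_max_norm: "k \<in> grid m N \<Longrightarrow> \<bar>v k\<bar> \<le> max_norm m N v"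
  by (simp add: max_norm_def)

lemma max_norm_le:
  assumes "\<And>j. j \<in> {1..m} \<Longrightarrow> 1 \<le> N j" and "\<And>k. k \<in> grid m N \<Longrightarrow> \<bar>v k\<bar> \<le> B"
  shows "max_norm m N v \<le> B"
proof -
  have "grid m N \<noteq> {}" using assms(1) by (auto simp: grid_def PiE_eq_empty_iff)
  then show ?thesis using assms(2) by (auto simp: max_norm_def)
qed

lemma mesh_bounds: "0 < mesh N j" "mesh N j \<le> 1"
  by (auto simp: mesh_def)

lemma grid_point_in_cube:
  assumes "k \<in> grid m N"
  shows "grid_point m N k \<in> cube m"
proof -
  have "real (k j) * mesh N j \<in> {0..1}" if "j \<in> {1..m}" for j
  proof -
    have "real (k j) \<le> real (N j)" using assms that by (auto simp: grid_def PiE_iff)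
    then show ?thesis by (auto simp: mesh_def divide_simps)
  qed
  then show ?thesis by (auto simp: grid_point_def cube_def)
qed

lemma time_deriv_grid_restrict:
  "(time_deriv T ^^ i) (grid_restrict m N u) = grid_restrict m N ((time_deriv T ^^ i) u)"
proof (induction i)
  case (Suc i)
  have "time_deriv T (grid_restrict m N w) = grid_restrict m N (time_deriv T w)" for w
    by (intro ext) (simp only: time_deriv_def grid_restrict_def)
  with Suc show ?case by simp
qed simp

lemma time_deriv_power: "(time_deriv T ^^ i) u = foldr (partial_deriv T) (replicate i 0) u"
  by (induction i) (auto simp: partial_deriv_def)

lemma time_deriv_eqI:
  assumes "0 < T" "t \<in> {0..T}" and eq: "\<And>s. s \<in> {0..T} \<Longrightarrow> w s k = f s"
    and f: "(f has_real_derivative d) (at t within {0..T})"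
  shows "time_deriv T w t k = d"
proof -
  have "((\<lambda>s. w s k) has_vector_derivative d) (at t within {0..T})"
    by (rule has_vector_derivative_transform[OF assms(2) eq f[unfolded has_real_derivative_iff_has_vector_derivative]])
  then show ?thesis
    unfolding time_deriv_def by (rule vector_derivative_within_closed_interval[OF assms(1,2)])
qed

lemma smooth_on_cylinderD:
  assumes "smooth_on_cylinder T m u" "set is \<subseteq> {0..m}"
  shows "continuous_on ({0..T} \<times> cube m) (\<lambda>(t, x). foldr (partial_deriv T) is u t x)"
    and "\<lbrakk>t \<in> {0..T}; x \<in> cube m\<rbrakk> \<Longrightarrow>
      (\<lambda>s. foldr (partial_deriv T) is u s x) differentiable (at t within {0..T})"
  using assms(1)[unfolded smooth_on_cylinder_def, THEN spec, THEN spec, THEN mp, THEN mp, OF assms(2) refl]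
  by simp_all

lemma smooth_time_derivative:
  assumes u: "smooth_on_cylinder T m u" and t: "t \<in> {0..T}" and x: "x \<in> cube m"
  shows "((\<lambda>s. (time_deriv T ^^ i) u s x) has_real_derivative (time_deriv T ^^ Suc i) u t x) (at t within {0..T})"
proof -
  have "(\<lambda>s. (time_deriv T ^^ i) u s x) differentiable (at t within {0..T})"
    unfolding time_deriv_power by (rule smooth_on_cylinderD(2)[OF u _ t x]) auto
  then show ?thesis
    unfolding has_real_derivative_iff_has_vector_derivative
    by (simp add: vector_derivative_works time_deriv_def)
qed

lemma smooth_derivative_bounded:
  assumes u: "smooth_on_cylinder T m u" and "set is \<subseteq> {0..m}"
  shows "\<exists>B. \<forall>t\<in>{0..T}. \<forall>x\<in>cube m. \<bar>foldr (partial_deriv T) is u t x\<bar> \<le> B"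
proof -
  let ?v = "foldr (partial_deriv T) is u"
  have cont: "continuous_on ({0..T} \<times> cube m) (\<lambda>(t, x). ?v t x)"
    using assms by (rule smooth_on_cylinderD(1))
  have "compact (cube m)"
  proof -
    have "compactin (product_topology (\<lambda>i. euclidean) UNIV) (PiE UNIV (\<lambda>i. if i \<in> {1..m} then {0..1::real} else {undefined}))"
      unfolding compactin_PiE by auto
    moreover have "PiE UNIV (\<lambda>i. if i \<in> {1..m} then {0..1::real} else {undefined}) = cube m"
      by (auto simp: cube_def PiE_iff extensional_def split: if_splits)
    ultimately have "compactin (product_topology (\<lambda>i. euclidean) UNIV) (cube m)" by (simp only:)
    then show ?thesis unfolding euclidean_product_topology compactin_euclidean_iff .
  qed
  then have "compact ((\<lambda>(t, x). ?v t x) ` ({0..T} \<times> cube m))"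
    using cont by (intro compact_continuous_image compact_Times) auto
  then obtain B where "\<forall>y\<in>(\<lambda>(t, x). ?v t x) ` ({0..T} \<times> cube m). norm y \<le> B"
    using compact_imp_bounded[THEN iffD1[OF bounded_iff]] by blast
  then show ?thesis by (intro exI[of _ B]) auto
qed

lemma second_space_derivatives:
  assumes "set is \<subseteq> {1..m}"
  shows "foldr (\<lambda>i v. space_deriv i (space_deriv i v)) is w
    = foldr (partial_deriv T) (concat (map (\<lambda>i. [i, i]) is)) w"
  using assms by (induction "is") (auto simp: partial_deriv_def)

text \<open>
  Compactness of the cylinder bounds each of these continuous derivatives, and there are only finitely many.
\<close>

lemma smooth_mixed_derivatives_bounded:
  assumes u: "smooth_on_cylinder T m u"
  shows "\<exists>B. \<forall>S p. S \<subseteq> {1..m} \<longrightarrow> p \<in> {1, 2} \<longrightarrow> (\<forall>t\<in>{0..T}. \<forall>x\<in>cube m.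
    \<bar>foldr (\<lambda>i v. space_deriv i (space_deriv i v)) (sorted_list_of_set S) ((time_deriv T ^^ p) u) t x\<bar> \<le> B)"
proof -
  let ?f = "\<lambda>S p. foldr (\<lambda>i v. space_deriv i (space_deriv i v)) (sorted_list_of_set S) ((time_deriv T ^^ p) u)"
  have ex: "\<exists>B. \<forall>t\<in>{0..T}. \<forall>x\<in>cube m. \<bar>?f S p t x\<bar> \<le> B" if "S \<subseteq> {1..m}" for S p
  proof -
    have fin: "finite S" using that finite_subset by auto
    have eq: "?f S p = foldr (partial_deriv T) (concat (map (\<lambda>i. [i, i]) (sorted_list_of_set S)) @ replicate p 0) u"
      using that fin by (simp add: second_space_derivatives[of _ m _ T] time_deriv_power)
    have "set (concat (map (\<lambda>i. [i, i]) (sorted_list_of_set S)) @ replicate p 0) \<subseteq> {0..m}"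
      using that fin by auto
    then show ?thesis unfolding eq by (rule smooth_derivative_bounded[OF u])
  qed
  define B where "B = (\<lambda>S p. SOME B. \<forall>t\<in>{0..T}. \<forall>x\<in>cube m. \<bar>?f S p t x\<bar> \<le> B)"
  have B: "\<bar>?f S p t x\<bar> \<le> B S p" if "S \<subseteq> {1..m}" "t \<in> {0..T}" "x \<in> cube m" for S p t x
    unfolding B_def using someI_ex[OF ex[OF that(1), of p]] that(2,3) by blast
  define B' where "B' = (\<Sum>(S, p)\<in>Pow {1..m} \<times> {1, 2}. \<bar>B S p\<bar>)"
  have B': "\<bar>B S p\<bar> \<le> B'" if "S \<subseteq> {1..m}" "p \<in> {1, 2}" for S and p :: nat
  proof -
    have "(\<lambda>(S, p). \<bar>B S p\<bar>) (S, p) \<le> B'"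
      unfolding B'_def by (rule member_le_sum) (use that in auto)
    then show ?thesis by (simp only: prod.case)
  qed
  show ?thesis
  proof (intro exI[of _ B'] allI impI ballI)
    fix S and p :: nat and t x
    assume "S \<subseteq> {1..m}" "p \<in> {1, 2}" "t \<in> {0..T}" "x \<in> cube m"
    then show "\<bar>?f S p t x\<bar> \<le> B'" using B[of S t x p] B'[of S p] by linarith
  qed
qed

text \<open>
  The trajectory is as smooth in time as \<open>u\<close>, and the source is determined by it through the semidiscrete
  equation. So all time derivatives of the sources and of \<open>phi\<close> can be expressed by those of the trajectory.
\<close>

lemma semidiscrete_trajectory:
  fixes N g
  assumes T: "0 < T" and u: "smooth_on_cylinder T m u"
    and semi: "semidiscretization T m \<beta> c b u Kc N g"
  defines "V \<equiv> \<lambda>i. (time_deriv T ^^ i) (grid_restrict m N u)"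
  shows trajectory_derivative: "\<And>i t k. \<lbrakk>t \<in> {0..T}; k \<in> grid m N\<rbrakk> \<Longrightarrow>
        ((\<lambda>s. V i s k) has_real_derivative V (Suc i) t k) (at t within {0..T})"
    and trajectory_ode: "\<And>i t k. \<lbrakk>t \<in> {0..T}; k \<in> grid m N\<rbrakk> \<Longrightarrow>
        (time_deriv T ^^ i) (sum_parts m g) t k = V (Suc i) t k - mat_vec m N (D_total m N \<beta>) (V i t) k"
    and trajectory_phi: "\<And>j p t k. \<lbrakk>j \<in> {2..m}; t \<in> {0..T}; k \<in> grid m N\<rbrakk> \<Longrightarrow>
        (time_deriv T ^^ Suc p) (phi m N \<beta> g (grid_restrict m N u) j) t k
          = mat_vec m N (D_mat m N \<beta> j) (V (Suc p) t) k"
    and trajectory_source: "\<And>t k. \<lbrakk>1 \<le> m; t \<in> {0..T}; k \<in> grid m N\<rbrakk> \<Longrightarrow>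
        time_deriv T (g 1) t k = V 2 t k - mat_vec m N (D_total m N \<beta>) (V 1 t) k"
proof -
  show der: "((\<lambda>s. V i s k) has_real_derivative V (Suc i) t k) (at t within {0..T})"
    if "t \<in> {0..T}" "k \<in> grid m N" for i t k
    using smooth_time_derivative[OF u that(1) grid_point_in_cube[OF that(2)], of i]
    unfolding V_def time_deriv_grid_restrict grid_restrict_def .
  have derD: "((\<lambda>s. mat_vec m N A (V i s) k) has_real_derivative mat_vec m N A (V (Suc i) t) k) (at t within {0..T})"
    if "t \<in> {0..T}" for i t k A
    using der that by (intro mat_vec_has_derivative) auto
  have gj: "g j t k = boundary_part m N \<beta> b j k" if "j \<in> {2..m}" "t \<in> {0..T}" "k \<in> grid m N" for j t k
    using semi that unfolding semidiscretization_def by blast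
  have ode0: "sum_parts m g t k = V 1 t k - mat_vec m N (D_total m N \<beta>) (V 0 t) k"
    if t: "t \<in> {0..T}" and k: "k \<in> grid m N" for t k
  proof -
    have "((\<lambda>s. V 0 s k) has_real_derivative
        mat_vec m N (D_total m N \<beta>) (V 0 t) k + sum_parts m g t k) (at t within {0..T})"
      using semi t k unfolding semidiscretization_def has_real_derivative_iff_has_vector_derivative V_def by simp
    then have "time_deriv T (V 0) t k = mat_vec m N (D_total m N \<beta>) (V 0 t) k + sum_parts m g t k"
      using T t by (intro time_deriv_eqI[where f = "\<lambda>s. V 0 s k"]) auto
    then show ?thesis by (simp add: V_def)
  qed
  show "(time_deriv T ^^ i) (sum_parts m g) t k = V (Suc i) t k - mat_vec m N (D_total m N \<beta>) (V i t) k"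
    if "t \<in> {0..T}" "k \<in> grid m N" for i t k
    using that
  proof (induction i arbitrary: t)
    case 0
    then show ?case using ode0 by simp
  next
    case (Suc i)
    have "time_deriv T ((time_deriv T ^^ i) (sum_parts m g)) t k
        = V (Suc (Suc i)) t k - mat_vec m N (D_total m N \<beta>) (V (Suc i) t) k"
    proof (rule time_deriv_eqI[OF T Suc.prems(1)])
      show "(time_deriv T ^^ i) (sum_parts m g) s k = V (Suc i) s k - mat_vec m N (D_total m N \<beta>) (V i s) k"
        if "s \<in> {0..T}" for s using Suc.IH that Suc.prems by blast
    qed (use Suc.prems in \<open>auto intro!: DERIV_diff der derD\<close>)
    then show ?case by simp
  qed
  show "(time_deriv T ^^ Suc p) (phi m N \<beta> g (grid_restrict m N u) j) t k
          = mat_vec m N (D_mat m N \<beta> j) (V (Suc p) t) k"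
    if j: "j \<in> {2..m}" and "t \<in> {0..T}" and k: "k \<in> grid m N" for j p t k
    using that(2)
  proof (induction p arbitrary: t)
    case 0
    have "time_deriv T (phi m N \<beta> g (grid_restrict m N u) j) t k = mat_vec m N (D_mat m N \<beta> j) (V (Suc 0) t) k"
    proof (rule time_deriv_eqI[OF T 0])
      show "phi m N \<beta> g (grid_restrict m N u) j s k
          = mat_vec m N (D_mat m N \<beta> j) (V 0 s) k + boundary_part m N \<beta> b j k" if "s \<in> {0..T}" for s
        using gj[OF j that k] by (simp add: phi_def V_def)
      show "((\<lambda>s. mat_vec m N (D_mat m N \<beta> j) (V 0 s) k + boundary_part m N \<beta> b j k)
          has_real_derivative mat_vec m N (D_mat m N \<beta> j) (V (Suc 0) t) k) (at t within {0..T})"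
        using derD[OF 0, of "D_mat m N \<beta> j" 0 k] by (auto intro!: derivative_eq_intros)
    qed
    then show ?case by simp
  next
    case (Suc p)
    have "time_deriv T ((time_deriv T ^^ Suc p) (phi m N \<beta> g (grid_restrict m N u) j)) t k
        = mat_vec m N (D_mat m N \<beta> j) (V (Suc (Suc p)) t) k"
    proof (rule time_deriv_eqI[OF T Suc.prems])
      show "(time_deriv T ^^ Suc p) (phi m N \<beta> g (grid_restrict m N u) j) s k
          = mat_vec m N (D_mat m N \<beta> j) (V (Suc p) s) k" if "s \<in> {0..T}" for s
        by (rule Suc.IH[OF that])
    qed (use Suc.prems in \<open>auto intro!: derD\<close>)
    then show ?case by simp
  qed
  show "time_deriv T (g 1) t k = V 2 t k - mat_vec m N (D_total m N \<beta>) (V 1 t) k"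
    if m: "1 \<le> m" and t: "t \<in> {0..T}" and k: "k \<in> grid m N" for t k
  proof (rule time_deriv_eqI[OF T t])
    show "g 1 s k = V 1 s k - mat_vec m N (D_total m N \<beta>) (V 0 s) k - (\<Sum>j\<in>{2..m}. boundary_part m N \<beta> b j k)"
      if s: "s \<in> {0..T}" for s
    proof -
      have "{1..m} = insert 1 {2..m}" using m by auto
      then have "sum_parts m g s k = g 1 s k + (\<Sum>j\<in>{2..m}. g j s k)"
        by (simp add: sum_parts_def)
      also have "(\<Sum>j\<in>{2..m}. g j s k) = (\<Sum>j\<in>{2..m}. boundary_part m N \<beta> b j k)"
        using gj s k by (intro sum.cong) auto
      finally show ?thesis using ode0[OF s k] by simp
    qed
    have "((\<lambda>s. V 1 s k - mat_vec m N (D_total m N \<beta>) (V 0 s) k - (\<Sum>j\<in>{2..m}. boundary_part m N \<beta> b j k))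
        has_real_derivative V (Suc 1) t k - mat_vec m N (D_total m N \<beta>) (V (Suc 0) t) k - 0) (at t within {0..T})"
      using t k by (intro DERIV_diff der derD DERIV_const)
    then show "((\<lambda>s. V 1 s k - mat_vec m N (D_total m N \<beta>) (V 0 s) k - (\<Sum>j\<in>{2..m}. boundary_part m N \<beta> b j k))
        has_real_derivative V 2 t k - mat_vec m N (D_total m N \<beta>) (V 1 t) k) (at t within {0..T})"
      by (simp add: numeral_2_eq_2)
  qed
qed

text \<open>
  Split off the largest direction \<open>j\<close>, which is the first to act. Since \<open>j \<ge> 2\<close>, applying \<open>D j\<close> to a time derivative of
  \<open>U\<close> gives that of \<open>phi\<close> in direction \<open>j\<close>, and the remaining directions are covered by the consistency
  hypothesis; the mesh widths in its error term are at most \<open>1\<close>.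
\<close>

lemma D_word_trajectory_bound:
  assumes T: "0 < T" and u: "smooth_on_cylinder T m u"
    and semi: "semidiscretization T m \<beta> c b u Kc N g"
    and cons: "\<And>j is p. \<lbrakk>j \<in> {1..m}; is \<noteq> []; sorted_wrt (<) is; set is \<subseteq> {1..<j}; p \<in> {1, 2}\<rbrakk> \<Longrightarrow>
       D_consistent T m \<beta> KO N is j ((time_deriv T ^^ p) (phi m N \<beta> g (grid_restrict m N u) j)) ((time_deriv T ^^ p) u)"
    and B: "\<And>S p t x. \<lbrakk>S \<subseteq> {1..m}; p \<in> {1, 2}; t \<in> {0..T}; x \<in> cube m\<rbrakk> \<Longrightarrow>
       \<bar>foldr (\<lambda>i v. space_deriv i (space_deriv i v)) (sorted_list_of_set S) ((time_deriv T ^^ p) u) t x\<bar> \<le> B"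
    and S: "S \<subseteq> {1..m}" "2 \<le> card S" and p: "p \<in> {1, 2}" and t: "t \<in> {0..T}" and k: "k \<in> grid m N"
  shows "\<bar>D_word m N \<beta> (sorted_list_of_set S) ((time_deriv T ^^ p) (grid_restrict m N u) t) k\<bar>
     \<le> (\<Prod>i\<in>{1..m}. max 1 \<bar>\<beta> i\<bar>) * B + \<bar>KO\<bar> * real m"
proof -
  define xs where "xs = sorted_list_of_set S"
  define "is" where "is = butlast xs"
  define j where "j = last xs"
  have fin: "finite S" using S finite_subset by auto
  have set_xs: "set xs = S" "distinct xs" "length xs = card S" "sorted_wrt (<) xs"
    using fin by (auto simp: xs_def)
  then have "xs \<noteq> []" using S by auto
  then have xs: "xs = is @ [j]" by (simp add: is_def j_def)
  have "is \<noteq> []" using S(2) set_xs(3) xs by auto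
  have sorted: "sorted_wrt (<) is" "\<forall>i\<in>set is. i < j"
    using set_xs(4) unfolding xs by (auto simp: sorted_wrt_append)
  have is1: "set is \<subseteq> {1..<j}" and j: "j \<in> {1..m}"
    using S(1) set_xs(1) sorted(2) unfolding xs by auto
  then have j2: "j \<in> {2..m}" using \<open>is \<noteq> []\<close> by (cases "is") auto
  define w where "w = (time_deriv T ^^ p) u"
  define \<psi> where "\<psi> = (time_deriv T ^^ p) (phi m N \<beta> g (grid_restrict m N u) j)"
  define h where "h = sum_list (map (\<lambda>i. (mesh N i)\<^sup>2) is) + (mesh N j)\<^sup>2"
  let ?Du = "foldr (\<lambda>i v. space_deriv i (space_deriv i v)) xs w"
  have "D_word m N \<beta> xs ((time_deriv T ^^ p) (grid_restrict m N u) t) k = D_word m N \<beta> is (\<psi> t) k"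
    unfolding xs D_word_append
  proof (rule D_word_cong[OF _ k])
    obtain p' where p': "p = Suc p'" using p by (cases p) auto
    fix l assume "l \<in> grid m N"
    from trajectory_phi[OF T u semi j2 t this, of p']
    show "D_word m N \<beta> [j] ((time_deriv T ^^ p) (grid_restrict m N u) t) l = \<psi> t l"
      unfolding \<psi>_def p' by simp
  qed
  moreover have "\<bar>D_word m N \<beta> is (\<psi> t) k - prod_list (map \<beta> is) * \<beta> j * ?Du t (grid_point m N k)\<bar> \<le> KO * h"
  proof -
    have "D_consistent T m \<beta> KO N is j \<psi> w"
      unfolding \<psi>_def w_def by (rule cons) (use \<open>is \<noteq> []\<close> sorted is1 j p in auto)
    then have "max_norm m N (\<lambda>k. D_word m N \<beta> is (\<psi> t) k - prod_list (map \<beta> is) * \<beta> j * ?Du t (grid_point m N k)) \<le> KO * h"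
      unfolding D_consistent_def grid_restrict_def D_word_def h_def xs using t by blast
    then show ?thesis using abs_le_max_norm[OF k] order_trans by blast
  qed
  moreover have "\<bar>prod_list (map \<beta> is) * \<beta> j * ?Du t (grid_point m N k)\<bar> \<le> (\<Prod>i\<in>{1..m}. max 1 \<bar>\<beta> i\<bar>) * B"
  proof -
    have "prod_list (map \<beta> is) * \<beta> j = prod_list (map \<beta> xs)" by (simp add: xs)
    also have "\<dots> = (\<Prod>i\<in>S. \<beta> i)"
      using prod.distinct_set_conv_list[OF set_xs(2), of \<beta>] by (simp only: set_xs(1))
    finally have "\<bar>prod_list (map \<beta> is) * \<beta> j\<bar> = (\<Prod>i\<in>S. \<bar>\<beta> i\<bar>)" by (simp add: abs_prod)
    also have "\<dots> \<le> (\<Prod>i\<in>S. max 1 \<bar>\<beta> i\<bar>)" by (intro prod_mono) auto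
    also have "\<dots> \<le> (\<Prod>i\<in>{1..m}. max 1 \<bar>\<beta> i\<bar>)"
      using S by (intro prod_mono2) auto
    finally have 1: "\<bar>prod_list (map \<beta> is) * \<beta> j\<bar> \<le> (\<Prod>i\<in>{1..m}. max 1 \<bar>\<beta> i\<bar>)" .
    have 2: "\<bar>?Du t (grid_point m N k)\<bar> \<le> B"
      unfolding xs_def w_def by (rule B[OF S(1) p t grid_point_in_cube[OF k]])
    show ?thesis unfolding abs_mult[of _ "?Du t (grid_point m N k)"]
      using 1 2 by (intro mult_mono) (auto intro: prod_nonneg)
  qed
  moreover have "KO * h \<le> \<bar>KO\<bar> * real m"
  proof -
    have "h = (\<Sum>i\<in>S. (mesh N i)\<^sup>2)"
    proof -
      have "h = sum_list (map (\<lambda>i. (mesh N i)\<^sup>2) xs)" by (simp add: h_def xs)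
      then show ?thesis
        using sum.distinct_set_conv_list[OF set_xs(2), of "\<lambda>i. (mesh N i)\<^sup>2"] by (simp only: set_xs(1))
    qed
    moreover have "(\<Sum>i\<in>S. (mesh N i)\<^sup>2) \<le> real (card S) * 1"
      using mesh_bounds by (intro sum_bounded_above power_le_one) (auto intro: less_imp_le)
    moreover have "card S \<le> m" using card_mono[OF _ S(1)] by simp
    ultimately have "h \<le> real m" "0 \<le> h" by (auto intro!: sum_nonneg)
    then show ?thesis by (intro mult_mono) auto
  qed
  ultimately show ?thesis unfolding xs_def[symmetric] by linarith
qed

section \<open>Convergence\<close>

theorem theorem4:
  fixes m :: nat
    and \<beta> :: "nat \<Rightarrow> real"
    and tstar C Kc Kphi KO K0 :: real
    and u c :: "real \<Rightarrow> (nat \<Rightarrow> real) \<Rightarrow> real"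
    and u0 b :: "(nat \<Rightarrow> real) \<Rightarrow> real"
  assumes "1 \<le> m"
    and "\<And>j. j \<in> {1..m} \<Longrightarrow> 0 < \<beta> j"
    and "0 < tstar"
    and "smooth_on_cylinder tstar m u"
    and "pde_solution tstar m \<beta> c u0 b u"
  shows "\<exists>C'. \<forall>(N :: nat \<Rightarrow> nat) (g :: nat \<Rightarrow> real \<Rightarrow> (nat \<Rightarrow> nat) \<Rightarrow> real)
      (U :: real \<Rightarrow> (nat \<Rightarrow> nat) \<Rightarrow> real) (\<tau> :: real) (nstar :: nat)
      (Y :: nat \<Rightarrow> (nat \<Rightarrow> nat) \<Rightarrow> real).
        (\<forall>j\<in>{1..m}. 1 \<le> N j) \<longrightarrow>
        U = grid_restrict m N u \<longrightarrow>
        semidiscretization tstar m \<beta> c b u Kc N g \<longrightarrow>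
        (\<forall>j\<in>{1..m}. \<forall>i\<in>{1, 2}. \<forall>t\<in>{0..tstar}.
           max_norm m N ((time_deriv tstar ^^ i) (phi m N \<beta> g U j) t) \<le> Kphi) \<longrightarrow>
        (\<forall>t\<in>{0..tstar}. \<forall>j\<in>{0..4}. max_norm m N ((time_deriv tstar ^^ j) U t) \<le> C) \<longrightarrow>
        (\<forall>t\<in>{0..tstar}. \<forall>i\<in>{0..3}. max_norm m N ((time_deriv tstar ^^ i) (sum_parts m g) t) \<le> C) \<longrightarrow>
        (\<forall>j\<in>{2..m}. \<forall>t\<in>{0..tstar}. \<forall>k\<in>grid m N. time_deriv tstar (g j) t k = 0) \<longrightarrow>
        (\<forall>j\<in>{1..m}. \<forall>is. is \<noteq> [] \<and> sorted_wrt (<) is \<and> set is \<subseteq> {1..<j} \<longrightarrow>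
           (\<forall>p\<in>{1, 2}. D_consistent tstar m \<beta> KO N is j
              ((time_deriv tstar ^^ p) (phi m N \<beta> g U j)) ((time_deriv tstar ^^ p) u))) \<longrightarrow>
        0 < \<tau> \<longrightarrow>
        tstar / \<tau> = real nstar \<longrightarrow>
        (\<forall>n<nstar. amf_w_step tstar m \<beta> N g (1 / 2) \<tau> (real n * \<tau>) (Y n) (Y (Suc n))) \<longrightarrow>
        max_norm m N (mat_vec m N (D_total m N \<beta>) (\<lambda>k. Y 0 k - U 0 k)) \<le> K0 * \<tau>\<^sup>2 \<longrightarrow>
        (\<forall>n\<in>{1..nstar}. max_norm m N (\<lambda>k. Y n k - U (real n * \<tau>) k) \<le> C' * \<tau>\<^sup>2)"
proof -
  define \<beta>0 where "\<beta>0 = Min (\<beta> ` {1..m})"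
  have \<beta>0: "0 < \<beta>0" "\<And>j. j \<in> {1..m} \<Longrightarrow> \<beta>0 \<le> \<beta> j"
    unfolding \<beta>0_def using assms(1,2) by (auto simp: Min_gr_iff)
  obtain B where B0: "\<forall>S p. S \<subseteq> {1..m} \<longrightarrow> p \<in> {1, 2} \<longrightarrow> (\<forall>t\<in>{0..tstar}. \<forall>x\<in>cube m.
    \<bar>foldr (\<lambda>i v. space_deriv i (space_deriv i v)) (sorted_list_of_set S) ((time_deriv tstar ^^ p) u) t x\<bar> \<le> B)"
    using smooth_mixed_derivatives_bounded[OF assms(4)] by (rule exE)
  have B: "\<bar>foldr (\<lambda>i v. space_deriv i (space_deriv i v)) (sorted_list_of_set S) ((time_deriv tstar ^^ p) u) t x\<bar> \<le> B"
    if "S \<subseteq> {1..m}" "p \<in> {1, 2}" "t \<in> {0..tstar}" "x \<in> cube m" for S p t x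
    using B0[rule_format, OF that] .
  \<comment> \<open>Bounds all products of at least two directional operators on the first two time derivatives.\<close>
  define C2 where "C2 = (\<Prod>i\<in>{1..m}. max 1 \<bar>\<beta> i\<bar>) * B + \<bar>KO\<bar> * real m"
  define K where "K = \<bar>C\<bar> + 2 ^ m * (max 1 tstar ^ m * \<bar>C2\<bar>)"
  have K: "0 \<le> K" by (auto simp: K_def intro!: add_nonneg_nonneg mult_nonneg_nonneg)
  show ?thesis
  proof (intro exI[of _ "multiplier_constant m \<beta>0 * (2 * K + K0 + K * tstar)"] allI impI ballI)
    fix N g U \<tau> nstar Y n
    assume N: "\<forall>j\<in>{1..m}. 1 \<le> N j" and U: "U = grid_restrict m N u"
      and semi: "semidiscretization tstar m \<beta> c b u Kc N g"
      and "\<forall>j\<in>{1..m}. \<forall>i\<in>{1, 2}. \<forall>t\<in>{0..tstar}. max_norm m N ((time_deriv tstar ^^ i) (phi m N \<beta> g U j) t) \<le> Kphi"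
      and UC: "\<forall>t\<in>{0..tstar}. \<forall>j\<in>{0..4}. max_norm m N ((time_deriv tstar ^^ j) U t) \<le> C"
      and gC: "\<forall>t\<in>{0..tstar}. \<forall>i\<in>{0..3}. max_norm m N ((time_deriv tstar ^^ i) (sum_parts m g) t) \<le> C"
      and g0: "\<forall>j\<in>{2..m}. \<forall>t\<in>{0..tstar}. \<forall>k\<in>grid m N. time_deriv tstar (g j) t k = 0"
      and cons: "\<forall>j\<in>{1..m}. \<forall>is. is \<noteq> [] \<and> sorted_wrt (<) is \<and> set is \<subseteq> {1..<j} \<longrightarrow>
           (\<forall>p\<in>{1, 2}. D_consistent tstar m \<beta> KO N is j
              ((time_deriv tstar ^^ p) (phi m N \<beta> g U j)) ((time_deriv tstar ^^ p) u))"
      and \<tau>: "0 < \<tau>" and nstar: "tstar / \<tau> = real nstar"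
      and step: "\<forall>n<nstar. amf_w_step tstar m \<beta> N g (1 / 2) \<tau> (real n * \<tau>) (Y n) (Y (Suc n))"
      and E0: "max_norm m N (mat_vec m N (D_total m N \<beta>) (\<lambda>k. Y 0 k - U 0 k)) \<le> K0 * \<tau>\<^sup>2"
      and n: "n \<in> {1..nstar}"
    define V where "V = (\<lambda>i. (time_deriv tstar ^^ i) (grid_restrict m N u))"
    \<comment> \<open>The shifted sequence, whose defect is the time derivative of the defect of \<open>V\<close>.\<close>
    define V' where "V' = (\<lambda>i. V (Suc i))"
    define E where "E = (\<lambda>n k. Y n k - V 0 (real n * \<tau>) k)"
    define d where "d = (\<lambda>n. defect m N \<beta> \<tau> V (real n * \<tau>))"
    have T: "real nstar * \<tau> = tstar" using nstar \<tau> by (simp add: field_simps)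
    have tn: "real n * \<tau> \<in> {0..tstar - \<tau>}" if "n < nstar" for n
    proof -
      have "real (Suc n) * \<tau> \<le> tstar" unfolding T[symmetric] using that \<tau> by (intro mult_right_mono) auto
      then show ?thesis using \<tau> by (auto simp: algebra_simps)
    qed
    have der: "((\<lambda>s. V i s k) has_real_derivative V (Suc i) t k) (at t within {0..tstar})"
      if "t \<in> {0..tstar}" "k \<in> grid m N" for i t k
      unfolding V_def by (rule trajectory_derivative[OF assms(3,4) semi that])
    have ode: "(time_deriv tstar ^^ i) (sum_parts m g) t k = V (Suc i) t k - mat_vec m N (D_total m N \<beta>) (V i t) k"
      if "t \<in> {0..tstar}" "k \<in> grid m N" for i t k
      unfolding V_def by (rule trajectory_ode[OF assms(3,4) semi that])
    have VC: "\<bar>V i t k\<bar> \<le> \<bar>C\<bar>" if "i \<le> 4" "t \<in> {0..tstar}" "k \<in> grid m N" for i t k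
    proof -
      have "max_norm m N (V i t) \<le> C" using UC that unfolding V_def U by simp
      then show ?thesis using abs_le_max_norm[OF that(3), of "V i t"] by linarith
    qed
    have gV: "\<bar>V (Suc i) t k - mat_vec m N (D_total m N \<beta>) (V i t) k\<bar> \<le> \<bar>C\<bar>"
      if "i \<le> 3" "t \<in> {0..tstar}" "k \<in> grid m N" for i t k
    proof -
      have "max_norm m N ((time_deriv tstar ^^ i) (sum_parts m g) t) \<le> C" using gC that by simp
      then show ?thesis
        using abs_le_max_norm[OF that(3), of "(time_deriv tstar ^^ i) (sum_parts m g) t"] ode[OF that(2,3), of i]
        by linarith
    qed
    have DV: "\<bar>D_word m N \<beta> (sorted_list_of_set S) (V p s) k\<bar> \<le> C2"
      if "S \<subseteq> {1..m}" "2 \<le> card S" "p \<in> {1, 2}" "s \<in> {0..tstar}" "k \<in> grid m N" for S p s k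
      unfolding V_def C2_def
    proof (rule D_word_trajectory_bound[OF assms(3,4) semi _ B that])
      show "D_consistent tstar m \<beta> KO N is j
          ((time_deriv tstar ^^ p) (phi m N \<beta> g (grid_restrict m N u) j)) ((time_deriv tstar ^^ p) u)"
        if "j \<in> {1..m}" "is \<noteq> []" "sorted_wrt (<) is" "set is \<subseteq> {1..<j}" "p \<in> {1, 2}" for j "is" p
        using cons that unfolding U by blast
    qed
    have dV: "\<bar>defect m N \<beta> \<tau> V t k\<bar> \<le> K * \<tau> ^ 3" if "t \<in> {0..tstar - \<tau>}" "k \<in> grid m N" for t k
      unfolding K_def
    proof (rule defect_bound[OF _ \<tau> that])
      show "((\<lambda>s. V i s l) has_real_derivative V (Suc i) s l) (at s within {0..tstar})"
        if "s \<in> {0..tstar}" "l \<in> grid m N" for i s l by (rule der[OF that])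
      show "\<bar>V 3 s k\<bar> \<le> \<bar>C\<bar>" if "s \<in> {0..tstar}" for s using VC[of 3 s k] that \<open>k \<in> grid m N\<close> by simp
      show "\<bar>V 3 s k - mat_vec m N (D_total m N \<beta>) (V 2 s) k\<bar> \<le> \<bar>C\<bar>" if "s \<in> {0..tstar}" for s
        using gV[of 2 s k] that \<open>k \<in> grid m N\<close> by (simp add: numeral_3_eq_3 numeral_2_eq_2)
      show "\<bar>D_word m N \<beta> (sorted_list_of_set S) (V 1 s) k\<bar> \<le> C2"
        if "s \<in> {0..tstar}" "S \<subseteq> {1..m}" "2 \<le> card S" for s S
        using DV[of S 1 s k] that \<open>k \<in> grid m N\<close> by simp
    qed
    have dV': "\<bar>defect m N \<beta> \<tau> V' t k\<bar> \<le> K * \<tau> ^ 3" if "t \<in> {0..tstar - \<tau>}" "k \<in> grid m N" for t k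
      unfolding K_def
    proof (rule defect_bound[OF _ \<tau> that])
      show "((\<lambda>s. V' i s l) has_real_derivative V' (Suc i) s l) (at s within {0..tstar})"
        if "s \<in> {0..tstar}" "l \<in> grid m N" for i s l unfolding V'_def by (rule der[OF that])
      show "\<bar>V' 3 s k\<bar> \<le> \<bar>C\<bar>" if "s \<in> {0..tstar}" for s
        using VC[of 4 s k] that \<open>k \<in> grid m N\<close> by (simp add: V'_def)
      show "\<bar>V' 3 s k - mat_vec m N (D_total m N \<beta>) (V' 2 s) k\<bar> \<le> \<bar>C\<bar>" if "s \<in> {0..tstar}" for s
        using gV[of 3 s k] that \<open>k \<in> grid m N\<close> by (simp add: V'_def eval_nat_numeral)
      show "\<bar>D_word m N \<beta> (sorted_list_of_set S) (V' 1 s) k\<bar> \<le> C2"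
        if "s \<in> {0..tstar}" "S \<subseteq> {1..m}" "2 \<le> card S" for s S
        using DV[of S 2 s k] that \<open>k \<in> grid m N\<close> by (simp add: V'_def numeral_2_eq_2)
    qed
    have En: "\<bar>E n k\<bar> \<le> multiplier_constant m \<beta>0 * (2 * K + K0 + K * tstar) * \<tau>\<^sup>2" if k: "k \<in> grid m N" for k
    proof (rule amf_error_bound[OF assms(1) \<tau> \<beta>0, where N = N and nstar = nstar and d = d and E = E])
      show "\<bar>d i l\<bar> \<le> K * \<tau> ^ 3" if "i < nstar" "l \<in> grid m N" for i l
        unfolding d_def by (rule dV[OF tn]) (use that in auto)
      show "\<bar>d (Suc i) l - d i l\<bar> \<le> K * \<tau> ^ 4" if "Suc i < nstar" "l \<in> grid m N" for i l
      proof -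
        have "\<bar>defect m N \<beta> \<tau> V (real (Suc i) * \<tau>) l - defect m N \<beta> \<tau> V (real i * \<tau>) l\<bar>
            \<le> K * \<tau> ^ 3 * \<bar>real (Suc i) * \<tau> - real i * \<tau>\<bar>"
        proof (rule increment_bound[where f' = "\<lambda>t. defect m N \<beta> \<tau> V' t l" and a = 0 and b = "tstar - \<tau>"])
          show "((\<lambda>t. defect m N \<beta> \<tau> V t l) has_real_derivative defect m N \<beta> \<tau> V' t l) (at t within {0..tstar - \<tau>})"
            if "t \<in> {0..tstar - \<tau>}" for t
            unfolding V'_def using \<tau> that \<open>l \<in> grid m N\<close> by (intro defect_has_derivative der) auto
          show "\<bar>defect m N \<beta> \<tau> V' t l\<bar> \<le> K * \<tau> ^ 3" if "t \<in> {0..tstar - \<tau>}" for t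
            using dV'[OF that] \<open>l \<in> grid m N\<close> by simp
          show "real (Suc i) * \<tau> \<in> {0..tstar - \<tau>}" "real i * \<tau> \<in> {0..tstar - \<tau>}"
            by (rule tn, use that in simp)+
        qed
        also have "real (Suc i) * \<tau> - real i * \<tau> = \<tau>" by (simp add: algebra_simps)
        finally show ?thesis using \<tau> by (simp add: d_def power4_eq_xxxx power3_eq_cube)
      qed
      show "\<bar>mat_vec m N (D_total m N \<beta>) (E 0) l\<bar> \<le> K0 * \<tau>\<^sup>2" if "l \<in> grid m N" for l
        using abs_le_max_norm[OF that, of "mat_vec m N (D_total m N \<beta>) (E 0)"] E0
        by (simp add: E_def V_def U)
      show "sine_coeff m N (E (Suc i)) p
          = amf_symbol m \<tau> (\<lambda>j. eigenvalue (N j) (\<beta> j) (real (p j))) * sine_coeff m N (E i) p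
            - sine_coeff m N (d i) p / (\<Prod>j\<in>{1..m}. 1 + \<tau> / 2 * eigenvalue (N j) (\<beta> j) (real (p j)))"
        if i: "i < nstar" and p: "p \<in> grid m N" for i p
      proof -
        have t: "real i * \<tau> \<in> {0..tstar}" "real i * \<tau> + \<tau> / 2 \<in> {0..tstar}" using tn[OF i] \<tau> by auto
        have "sine_coeff m N (\<lambda>k. Y (Suc i) k - V 0 (real i * \<tau> + \<tau>) k) p
          = amf_symbol m \<tau> (\<lambda>j. eigenvalue (N j) (\<beta> j) (real (p j))) * sine_coeff m N (\<lambda>k. Y i k - V 0 (real i * \<tau>) k) p
            - sine_coeff m N (defect m N \<beta> \<tau> V (real i * \<tau>)) p / (\<Prod>j\<in>{1..m}. 1 + \<tau> / 2 * eigenvalue (N j) (\<beta> j) (real (p j)))"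
        proof (rule amf_error_recursion[where T = tstar and g = g])
          show "sum_parts m g (real i * \<tau>) k = V 1 (real i * \<tau>) k - mat_vec m N (D_total m N \<beta>) (V 0 (real i * \<tau>)) k"
            if "k \<in> grid m N" for k using ode[OF t(1) that, of 0] by simp
          show "time_deriv tstar (g 1) (real i * \<tau> + \<tau> / 2) k
              = V 2 (real i * \<tau> + \<tau> / 2) k - mat_vec m N (D_total m N \<beta>) (V 1 (real i * \<tau> + \<tau> / 2)) k"
            if "k \<in> grid m N" for k
            unfolding V_def by (rule trajectory_source[OF assms(3,4) semi assms(1) t(2) that])
          show "amf_w_step tstar m \<beta> N g (1 / 2) \<tau> (real i * \<tau>) (Y i) (Y (Suc i))"
            using step i by blast
          show "time_deriv tstar (g j) (real i * \<tau> + \<tau> / 2) k = 0" if "j \<in> {2..m}" "k \<in> grid m N" for j k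
            using g0 t(2) that by blast
        qed (fact assms(1) assms(2) \<tau> p)+
        moreover have "real i * \<tau> + \<tau> = real (Suc i) * \<tau>" by (simp add: algebra_simps)
        ultimately show ?thesis by (simp only: E_def d_def)
      qed
      show "\<And>j. j \<in> {1..m} \<Longrightarrow> 1 \<le> N j" using N by blast
    qed (use T n k K in auto)
    have "max_norm m N (E n) \<le> multiplier_constant m \<beta>0 * (2 * K + K0 + K * tstar) * \<tau>\<^sup>2"
      by (rule max_norm_le[OF _ En]) (use N in blast)+
    then show "max_norm m N (\<lambda>k. Y n k - U (real n * \<tau>) k)
        \<le> multiplier_constant m \<beta>0 * (2 * K + K0 + K * tstar) * \<tau>\<^sup>2"
      unfolding E_def V_def U funpow_0 .
  qed
qed

end
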